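(* Let $r:\mathbb{R}^d\to\mathbb{R}\cup\{\infty\}$ be a closed convex function, let $g:\mathbb{R}^d\to\mathbb{R}$ be $\rho$-weakly convex with $\rho>0$, and set $\varphi:=g+r$. Assume (A1), (A2), (A3) stated in the context, and assume that $g$ is $L$-Lipschitz, with the same constant $L$ as in (A3). Fix a constant $\gamma\in(0,\frac{1}{2\rho}]$, an integer $T>0$ and a point $x_0\in\mathrm{dom}\, r$, and let $x_{t^*}$ be the point returned by the proximal stochastic subgradient method described in the context with constant steplength $\alpha_t=\alpha=\frac{\gamma}{\sqrt{T+1}}$. Then $$\mathbb{E}\left[\|\nabla\varphi_{1/(2\rho)}(x_{t^*})\|^2\right]\le 2\cdot\frac{\left(\varphi_{1/(2\rho)}(x_0)-\min\varphi\right)+2\rho L^2\gamma^2}{\gamma\sqrt{T+1}}.$$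
   Context: Norms are Euclidean. A function $g:\mathbb{R}^d\to\mathbb{R}$ is $\rho$-weakly convex if $x\mapsto g(x)+\frac{\rho}{2}\|x\|^2$ is convex. The subdifferential $\partial g(x)$ is the set of all $v\in\mathbb{R}^d$ with $g(y)\ge g(x)+\langle v,y-x\rangle+o(\|y-x\|)$ as $y\to x$. For a function $f$ and $\lambda>0$, $\mathrm{prox}_{\lambda f}(x):=\mathrm{argmin}_y\{f(y)+\frac{1}{2\lambda}\|y-x\|^2\}$. The Moreau envelope is $\varphi_\lambda(x):=\min_y\{\varphi(y)+\frac{1}{2\lambda}\|y-x\|^2\}$; for $\lambda<\rho^{-1}$ it is $C^1$ with $\nabla\varphi_\lambda(x)=\lambda^{-1}(x-\mathrm{prox}_{\lambda\varphi}(x))$. $\min\varphi$ denotes the minimum value of $\varphi$, assumed to exist. Stochastic oracle: fix a probability space $(\Omega,\mathcal{F},P)$ and equip $\mathbb{R}^d$ with the Borel $\sigma$-algebra. Assumptions: (A1) It is possible to generate i.i.d. realizations $\xi_0,\xi_1,\ldots\sim P$. (A2) There is an open set $U$ containing $\mathrm{dom}\, r$ and a measurable mapping $G:U\times\Omega\to\mathbb{R}^d$ with $\mathbb{E}_\xi[G(x,\xi)]\in\partial g(x)$ for all $x\in U$. (A3) There is a real $L\ge 0$ such that $\mathbb{E}_\xi[\|G(x,\xi)\|^2]\le L^2$ for all $x\in\mathrm{dom}\, r$. Proximal stochastic subgradient method: given $x_0\in\mathrm{dom}\, r$ and positive stepsizes $\alpha_t$, for $t=0,\ldots,T$ sample $\xi_t\sim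 P$ (independently) and set $x_{t+1}=\mathrm{prox}_{\alpha_t r}(x_t-\alpha_tG(x_t,\xi_t))$. Then sample $t^*\in\{0,\ldots,T\}$, independently of the $\xi_t$, with $\mathbb{P}(t^*=t)=\alpha_t/\sum_{s=0}^T\alpha_s$ (uniform for constant stepsize), and return $x_{t^*}$. The expectation is over all this randomness. *)

theory Defs
  imports "HOL-Probability.Probability" "HOL-Library.Landau_Symbols"
begin

text \<open>Functions into \<open>\<real> \<union> {\<infinity>}\<close> are rendered as \<^typ>\<open>'a \<Rightarrow> ereal\<close> that avoid \<open>-\<infinity>\<close>.\<close>

definition effective_domain :: "('a \<Rightarrow> ereal) \<Rightarrow> 'a set" where
  "effective_domain f = {x. f x < \<infinity>}"

definition ereal_epigraph :: "('a \<Rightarrow> ereal) \<Rightarrow> ('a \<times> real) set" where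
  "ereal_epigraph f = {(x, t). f x \<le> ereal t}"

text \<open>Properness is not part of this definition; the function identically \<open>\<infinity>\<close> satisfies it.\<close>

definition closed_convex_function :: "('a::euclidean_space \<Rightarrow> ereal) \<Rightarrow> bool" where
  "closed_convex_function f \<longleftrightarrow>
     (\<forall>x. f x \<noteq> -\<infinity>) \<and> convex (ereal_epigraph f) \<and> closed (ereal_epigraph f)"

definition weakly_convex :: "real \<Rightarrow> ('a::euclidean_space \<Rightarrow> real) \<Rightarrow> bool" where
  "weakly_convex \<rho> g \<longleftrightarrow> convex_on UNIV (\<lambda>x. g x + \<rho> / 2 * (norm x)\<^sup>2)"

definition subdifferential :: "('a::euclidean_space \<Rightarrow> real) \<Rightarrow> 'a \<Rightarrow> 'a set" where
  "subdifferential g x =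
     {v. \<exists>h \<in> o[at x](\<lambda>y. norm (y - x)).
           \<forall>\<^sub>F y in at x. g y \<ge> g x + v \<bullet> (y - x) + h y}"

definition prox :: "real \<Rightarrow> ('a::euclidean_space \<Rightarrow> ereal) \<Rightarrow> 'a \<Rightarrow> 'a" where
  "prox l f x = arg_min (\<lambda>y. f y + ereal (1 / (2 * l) * (norm (y - x))\<^sup>2)) (\<lambda>_. True)"

text \<open>The envelope is real-valued; the coercion is meaningful only where the infimum is finite,
  as it is for a proper function that is bounded below.\<close>

definition moreau_envelope :: "real \<Rightarrow> ('a::euclidean_space \<Rightarrow> ereal) \<Rightarrow> 'a \<Rightarrow> real" where
  "moreau_envelope l f x =
     real_of_ereal (INF y. f y + ereal (1 / (2 * l) * (norm (y - x))\<^sup>2))"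

definition gradient :: "('a::euclidean_space \<Rightarrow> real) \<Rightarrow> 'a \<Rightarrow> 'a" where
  "gradient f x = (THE D. GDERIV f x :> D)"

text \<open>\<open>prox_sgm r G \<alpha> x\<^sub>0 s t\<close> is the iterate \<open>x\<^sub>t\<close> of the proximal stochastic subgradient method
  along the sample path \<open>s\<close>, with stepsizes \<open>\<alpha>\<close>.\<close>

primrec prox_sgm ::
  "('a::euclidean_space \<Rightarrow> ereal) \<Rightarrow> ('a \<Rightarrow> 'w \<Rightarrow> 'a) \<Rightarrow> (nat \<Rightarrow> real) \<Rightarrow> 'a \<Rightarrow> (nat \<Rightarrow> 'w) \<Rightarrow> nat \<Rightarrow> 'a"
where
  "prox_sgm r G \<alpha> x0 s 0 = x0"
| "prox_sgm r G \<alpha> x0 s (Suc t) =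
     prox (\<alpha> t) r (prox_sgm r G \<alpha> x0 s t - \<alpha> t *\<^sub>R G (prox_sgm r G \<alpha> x0 s t) (s t))"

text \<open>\<^const>\<open>prob_space.indep_var\<close> requires both random variables to have the same value type;
  this is the same notion without that restriction.\<close>

definition indep_rvs ::
  "'m measure \<Rightarrow> 'b measure \<Rightarrow> ('m \<Rightarrow> 'b) \<Rightarrow> 'c measure \<Rightarrow> ('m \<Rightarrow> 'c) \<Rightarrow> bool" where
  "indep_rvs M N X N' Y \<longleftrightarrow>
     X \<in> measurable M N \<and> Y \<in> measurable M N' \<and>
     prob_space.indep_set M {X -` A \<inter> space M | A. A \<in> sets N} {Y -` B \<inter> space M | B. B \<in> sets N'}"

end

theory Submission
  imports Defs
begin

text \<open>Write \<open>\<kappa> = 2\<rho>\<close> and let \<open>h\<close> be the proximal point of \<open>\<phi>\<close> at the iterate \<open>x\<close>, so that the gradient of the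
  envelope is \<open>\<kappa>(x - h)\<close>. Comparing the next iterate with \<open>h\<close> shows that one step lowers the expected envelope by
  \<open>(\<alpha>/2)\<parallel>\<nabla>\<parallel>\<^sup>2\<close> up to an additive \<open>4\<rho>L\<^sup>2\<alpha>\<^sup>2\<close>; summing over the steps gives the result with \<open>4\<rho>L\<^sup>2\<gamma>\<^sup>2\<close> in place of
  \<open>2\<rho>L\<^sup>2\<gamma>\<^sup>2\<close>. For a single step that constant cannot be improved, so the factor two has to come from the interaction of
  consecutive steps: the worst case of one step is a bad starting position for the next.

  The interaction is captured by a potential \<open>Lyap\<close> with memory, the envelope plus corrections in the previous proximal
  point and the last subgradient of \<open>r\<close>. Its expected growth per step beyond \<open>-(\<alpha>/2)\<parallel>\<nabla>\<parallel>\<^sup>2\<close> is at most \<open>\<beta>\<close> times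
  \<open>(\<kappa>\<alpha>)\<^sup>2L\<^sup>2\<close> with \<open>\<beta>\<close> close to one (\<open>interior_step\<close>). Entering and leaving the potential costs \<open>s\<close> and \<open>p\<close>
  (\<open>initial_step\<close>, \<open>final_step\<close>). The last few steps use the plain one-step bound with a weight that grows from zero, since
  the envelope left over at the end is nonnegative and can be spent (\<open>tail_sum\<close>). For \<open>N = T + 1\<close> steps the constants
  add up to at most \<open>N\<close> (\<open>schedule_exists\<close>); when \<open>N\<kappa>\<alpha>\<close> is small the plain bound alone suffices (\<open>plain_budget\<close>).

  Each drift bound is a nonnegative combination of subgradient inequalities between the points involved. What remains is
  a quadratic form in seven (or four) vectors whose coefficients are polynomials in the stepsize; it has to be nonpositive.
  The multipliers come from a semidefinite program, rounded to rationals on four stepsize intervals. On each interval the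
  form is a Bernstein combination of integer matrices, and those are certified positive semidefinite by exact arithmetic
  (\<open>psd_check\<close>).

  The remaining ingredients are convex analysis (attainment and variational inequality of the proximal map, gradient of the
  envelope, splitting a subgradient of \<open>g + r\<close>), and Fubini's theorem on the product space of the samples, which
  removes all terms that are linear in the fresh noise.\<close>

section \<open>The potential with memory and its drift\<close>

text \<open>Lengths are measured in units in which the weak convexity parameter is \<open>1/2\<close>; the last part of the development
  rescales. In these units \<open>x - h\<close> is itself the gradient of the envelope and the quadratic error is \<open>1/4\<close>.\<close>

definition wc_subgrad :: "('a::real_inner \<Rightarrow> real) \<Rightarrow> 'a set \<Rightarrow> 'a \<Rightarrow> 'a \<Rightarrow> bool" where
  "wc_subgrad g D x v \<longleftrightarrow> (\<forall>y\<in>D. g y \<ge> g x + v \<bullet> (y - x) - 1/4 * ((y - x) \<bullet> (y - x)))"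

definition subgrad :: "('a::real_inner \<Rightarrow> real) \<Rightarrow> 'a set \<Rightarrow> 'a \<Rightarrow> 'a \<Rightarrow> bool" where
  "subgrad r D x s \<longleftrightarrow> (\<forall>y\<in>D. r y \<ge> r x + s \<bullet> (y - x))"

text \<open>An iterate \<open>x\<close> with its proximal point \<open>h\<close>, the mean \<open>v\<close> of the oracle at \<open>x\<close>, and a splitting of the
  optimality condition at \<open>h\<close> into a subgradient \<open>u\<close> of \<open>g\<close> and the subgradient \<open>x - h - u\<close> of \<open>r\<close>.\<close>

definition stage :: "('a::real_inner \<Rightarrow> real) \<Rightarrow> ('a \<Rightarrow> real) \<Rightarrow> 'a set \<Rightarrow> real \<Rightarrow> 'a \<Rightarrow> 'a \<Rightarrow> 'a \<Rightarrow> 'a \<Rightarrow> bool" where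
  "stage g r D L x h v u \<longleftrightarrow> x \<in> D \<and> h \<in> D \<and> wc_subgrad g D x v \<and> wc_subgrad g D h u \<and>
     subgrad r D h (x - h - u) \<and> v \<bullet> v \<le> L\<^sup>2 \<and> u \<bullet> u \<le> L\<^sup>2"

text \<open>The value of the envelope above the lower bound \<open>m\<close>.\<close>

definition gap :: "('a::real_inner \<Rightarrow> real) \<Rightarrow> ('a \<Rightarrow> real) \<Rightarrow> real \<Rightarrow> 'a \<Rightarrow> 'a \<Rightarrow> real" where
  "gap g r m x h = g h + r h + 1/2 * ((x - h) \<bullet> (x - h)) - m"

text \<open>Both subgradients at \<open>h\<close> add up to \<open>x - h\<close>, so the function minimized by \<open>h\<close> is strongly convex; the surplus
  \<open>1/4\<close> is what the potential with memory feeds on.\<close>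

lemma gap_bound:
  assumes "stage g r D L x h v u" "z \<in> D"
  shows "gap g r m x h + 1/4 * ((h - z) \<bullet> (h - z)) \<le> g z + r z - m + 1/2 * ((x - z) \<bullet> (x - z))"
proof -
  have "g z \<ge> g h + u \<bullet> (z - h) - 1/4 * ((z - h) \<bullet> (z - h))" "r z \<ge> r h + (x - h - u) \<bullet> (z - h)"
    using assms unfolding stage_def wc_subgrad_def subgrad_def by auto
  then show ?thesis
    unfolding gap_def by (simp add: inner_diff_left inner_diff_right inner_commute algebra_simps)
qed

text \<open>What is left of the drift inequality after the function values have cancelled. In order, \<open>e\<close> and \<open>y\<close> are the
  positions of the iterate and of its proximal point relative to the previous proximal point; \<open>S, V, H, Gp, Z\<close> are
  stepsize times: last subgradient of \<open>r\<close>, oracle mean, subgradient of \<open>g\<close> at the proximal point, previous oracle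
  sample, next subgradient of \<open>r\<close>. The letters \<open>k1\<close> to \<open>lg\<close> are the multipliers of the inequalities used.\<close>

definition memory_form :: "real \<Rightarrow> real \<Rightarrow> real \<Rightarrow> real \<Rightarrow> real \<Rightarrow> real \<Rightarrow> real \<Rightarrow> real \<Rightarrow> real \<Rightarrow> 
   real \<Rightarrow> real \<Rightarrow> real \<Rightarrow> real \<Rightarrow> real \<Rightarrow> real \<Rightarrow> real \<Rightarrow> real \<Rightarrow> real \<Rightarrow> real \<Rightarrow> real \<Rightarrow> real \<Rightarrow> real \<Rightarrow>
   real \<Rightarrow> real \<Rightarrow> real \<Rightarrow> real \<Rightarrow>
   'a::real_inner \<Rightarrow> 'a \<Rightarrow> 'a \<Rightarrow> 'a \<Rightarrow> 'a \<Rightarrow> 'a \<Rightarrow> 'a \<Rightarrow> real" where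
  "memory_form \<alpha> ce cp cr cg1 cp1 cr1 A2 k1 k2 k3 k4 b1 b2 c2 d1 d2 og o4 mg mr f5 f6 lv lh lg e y S V H Gp Z =
   (let w = e - y; p = Gp + S; q = e + p; c = w - V - Z; rr = \<alpha> *\<^sub>R w - H in
     (cp1 + A2/2 + \<alpha>/2 - 1/2) * (w \<bullet> w) + \<alpha> * ce * (e \<bullet> e) - 2 * cp * (p \<bullet> e) - cp * (p \<bullet> p) - A2 * (w \<bullet> V)
     + k1 * (V \<bullet> w + \<alpha>/4 * (w \<bullet> w)) + k2 * (V \<bullet> e + \<alpha>/4 * (e \<bullet> e))
     + k3 * (- (V \<bullet> p) + \<alpha>/4 * (p \<bullet> p) + Gp \<bullet> q + \<alpha>/4 * (q \<bullet> q))
     + k4 * (- (H \<bullet> w) + \<alpha>/4 * (w \<bullet> w)) - cg1 * (H \<bullet> c) - b1 * (rr \<bullet> c)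
     + og * (- \<alpha> * (q \<bullet> e) + \<alpha>/4 * (e \<bullet> e)) + o4 * (- \<alpha> * (q \<bullet> y) + \<alpha>/4 * (y \<bullet> y))
     + mg * (H \<bullet> y + \<alpha>/4 * (y \<bullet> y)) + mr * (rr \<bullet> y)
     + c2 * (S \<bullet> e) + d1 * (S \<bullet> w) - d2 * (rr \<bullet> w) + b2 * (S \<bullet> (V + Z)) + f5 * (Z \<bullet> y) - f6 * (Z \<bullet> w)
     - (A2/2 - cr1) * (Z \<bullet> Z) - cr * (S \<bullet> S) - 1/4 * (y \<bullet> y) - lv * (V \<bullet> V) - lh * (H \<bullet> H) - lg * (Gp \<bullet> Gp))"

text \<open>The potential with memory. The terms in \<open>cg\<close> and \<open>ce\<close> reward an iterate whose distance from the previous proximal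
  point is already paid for, those in \<open>cp\<close> and \<open>cr\<close> store progress of the last step that the envelope does not show.\<close>

definition Lyap where
  "Lyap g r m \<alpha> cg ce cp cr xp hp x h s = gap g r m x h + 1/4 * ((h - hp) \<bullet> (h - hp)) - cg * \<alpha> * (g x - g hp)
     - ce * \<alpha> * ((x - hp) \<bullet> (x - hp)) + cp * ((xp - hp) \<bullet> (xp - hp) - (x - hp) \<bullet> (x - hp)) + cr * \<alpha>\<^sup>2 * (s \<bullet> s)"

text \<open>The hypotheses \<open>bal\<close> are exactly the conditions under which the values of \<open>g\<close> and \<open>r\<close> at the five points cancel
  in the weighted sum of subgradient inequalities. The sample \<open>G\<close> is compared with its mean \<open>v\<close>; every term linear in
  \<open>G - v\<close> is kept explicitly because its expectation vanishes.\<close>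

lemma memory_drift:
  fixes g r :: "'a::real_inner \<Rightarrow> real"
  assumes p: "stage g r D L xp hp vp up" and c: "stage g r D L x h v u" and n: "stage g r D L xn hn vn un"
    and x: "xp - x = \<alpha> *\<^sub>R (Gp + s)" and s: "subgrad r D x s"
    and xn: "x - xn = \<alpha> *\<^sub>R (G + sn)" and sn: "subgrad r D xn sn"
    and m: "\<forall>y\<in>D. m \<le> g y + r y" and \<alpha>: "0 < \<alpha>"
    and nonneg: "0 \<le> k1" "0 \<le> k2" "0 \<le> k3" "0 \<le> k4" "0 \<le> b1" "0 \<le> b2" "0 \<le> c2" "0 \<le> d1" "0 \<le> d2" "0 \<le> og"
      "0 \<le> o4" "0 \<le> mg" "0 \<le> mr" "0 \<le> f5" "0 \<le> f6" "0 \<le> A2 - f5 - f6" "0 \<le> lv" "0 \<le> lh" "0 \<le> cg1" "0 \<le> a" "a \<le> 1"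
    and A2: "A2 = a - 2 * cp1 - 2 * \<alpha> * ce1 + \<alpha> * cg1 / 2"
    and bal: "og = k1 + k2 + k3 - k4 - cg" "b2 = A2 - b1" "mg = cg - k2 - k3 + og + o4" "c2 = og - b2 - d1 + d2 + f6" 
      "mr = og + o4 - c2 - f5"
    and form: "memory_form \<alpha> ce cp cr cg1 cp1 cr1 A2 k1 k2 k3 k4 b1 b2 c2 d1 d2 og o4 mg mr f5 f6 lv lh lg
       (x - hp) (h - hp) (\<alpha> *\<^sub>R s) (\<alpha> *\<^sub>R v) (\<alpha> *\<^sub>R u) (\<alpha> *\<^sub>R Gp) (\<alpha> *\<^sub>R sn) \<le> 0"
  shows "a * (gap g r m xn hn + 1/4 * ((hn - h) \<bullet> (hn - h))) - cg1 * \<alpha> * (g xn - g h)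
     - ce1 * \<alpha> * ((xn - h) \<bullet> (xn - h)) + cp1 * ((x - h) \<bullet> (x - h) - (xn - h) \<bullet> (xn - h)) + cr1 * \<alpha>\<^sup>2 * (sn \<bullet> sn)
     + \<alpha> / 2 * ((x - h) \<bullet> (x - h))
    \<le> Lyap g r m \<alpha> cg ce cp cr xp hp x h s
     + (A2/2 + lv + lh + lg) * \<alpha>\<^sup>2 * L\<^sup>2
     + \<alpha> * ((- A2 *\<^sub>R (x - h) + (cg1 * \<alpha>) *\<^sub>R u + (b1 * \<alpha>) *\<^sub>R (x - h - u) + (b2 * \<alpha>) *\<^sub>R s) \<bullet> (G - v))
     + A2/2 * \<alpha>\<^sup>2 * (G \<bullet> G - L\<^sup>2) + lg * \<alpha>\<^sup>2 * (Gp \<bullet> Gp - L\<^sup>2) + k3 * \<alpha> * ((vp - Gp) \<bullet> (xp - hp))"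
proof -
  define e y w S V H K Z q pp where defs: "e = x - hp" "y = h - hp" "w = x - h" "S = \<alpha> *\<^sub>R s" "V = \<alpha> *\<^sub>R v" "H = \<alpha> *\<^sub>R u"
    "K = \<alpha> *\<^sub>R Gp" "Z = \<alpha> *\<^sub>R sn" "q = xp - hp" "pp = xp - x"
  define N where "N = \<alpha> *\<^sub>R (G - v)"
  have D: "x \<in> D" "h \<in> D" "xp \<in> D" "hp \<in> D" "xn \<in> D" "hn \<in> D" using p c n unfolding stage_def by auto
  have pp: "pp = K + S" unfolding defs using x by (simp add: scaleR_right_distrib)
  have q: "q = e + pp" unfolding defs by simp
  have wey: "w = e - y" unfolding defs by simp
  have xnx: "x - xn = V + N + Z" unfolding defs N_def using xn by (simp add: algebra_simps)
  define cc where "cc = w - V - Z"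
  have ep: "xn - h = cc - N" using xnx unfolding cc_def defs by (simp add: algebra_simps)
  have sub: "z \<in> D \<Longrightarrow> 0 \<le> \<alpha> * (g z - g x) - V \<bullet> (z - x) + \<alpha>/4 * ((z - x) \<bullet> (z - x))" 
     "z \<in> D \<Longrightarrow> 0 \<le> \<alpha> * (g z - g h) - H \<bullet> (z - h) + \<alpha>/4 * ((z - h) \<bullet> (z - h))" 
     "z \<in> D \<Longrightarrow> 0 \<le> \<alpha> * (r z - r h) - (\<alpha> *\<^sub>R w - H) \<bullet> (z - h)"
     "z \<in> D \<Longrightarrow> 0 \<le> \<alpha> * (r z - r x) - S \<bullet> (z - x)"
     "z \<in> D \<Longrightarrow> 0 \<le> \<alpha> * (r z - r xn) - Z \<bullet> (z - xn)"
     "z \<in> D \<Longrightarrow> 0 \<le> \<alpha> * (g z - g xp) - (\<alpha> *\<^sub>R vp) \<bullet> (z - xp) + \<alpha>/4 * ((z - xp) \<bullet> (z - xp))"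
     "z \<in> D \<Longrightarrow> 0 \<le> \<alpha> * (g z + r z - g hp - r hp) - \<alpha> * (q \<bullet> (z - hp)) + \<alpha>/4 * ((z - hp) \<bullet> (z - hp))" for z
  proof -
    assume z: "z \<in> D"
    note mult = mult_nonneg_nonneg[OF less_imp_le[OF \<alpha>]]
    have "0 \<le> g z - (g x + v \<bullet> (z - x) - 1/4 * ((z - x) \<bullet> (z - x)))"
      using c z unfolding stage_def wc_subgrad_def by auto
    from mult[OF this] show "0 \<le> \<alpha> * (g z - g x) - V \<bullet> (z - x) + \<alpha>/4 * ((z - x) \<bullet> (z - x))"
      unfolding defs by (simp add: algebra_simps)
    have "0 \<le> g z - (g h + u \<bullet> (z - h) - 1/4 * ((z - h) \<bullet> (z - h)))"
      using c z unfolding stage_def wc_subgrad_def by auto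
    from mult[OF this] show "0 \<le> \<alpha> * (g z - g h) - H \<bullet> (z - h) + \<alpha>/4 * ((z - h) \<bullet> (z - h))"
      unfolding defs by (simp add: algebra_simps)
    have "0 \<le> r z - (r h + (x - h - u) \<bullet> (z - h))"
      using c z unfolding stage_def subgrad_def by auto
    from mult[OF this] show "0 \<le> \<alpha> * (r z - r h) - (\<alpha> *\<^sub>R w - H) \<bullet> (z - h)"
      unfolding defs by (simp add: algebra_simps)
    have "0 \<le> r z - (r x + s \<bullet> (z - x))"
      using s z unfolding subgrad_def by auto
    from mult[OF this] show "0 \<le> \<alpha> * (r z - r x) - S \<bullet> (z - x)"
      unfolding defs by (simp add: algebra_simps)
    have "0 \<le> r z - (r xn + sn \<bullet> (z - xn))"
      using sn z unfolding subgrad_def by auto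
    from mult[OF this] show "0 \<le> \<alpha> * (r z - r xn) - Z \<bullet> (z - xn)"
      unfolding defs by (simp add: algebra_simps)
    have "0 \<le> g z - (g xp + vp \<bullet> (z - xp) - 1/4 * ((z - xp) \<bullet> (z - xp)))"
      using p z unfolding stage_def wc_subgrad_def by auto
    from mult[OF this] show "0 \<le> \<alpha> * (g z - g xp) - (\<alpha> *\<^sub>R vp) \<bullet> (z - xp) + \<alpha>/4 * ((z - xp) \<bullet> (z - xp))"
      unfolding defs by (simp add: algebra_simps)
    have "g z \<ge> g hp + up \<bullet> (z - hp) - 1/4 * ((z - hp) \<bullet> (z - hp))" "r z \<ge> r hp + (q - up) \<bullet> (z - hp)"
      using p z unfolding stage_def wc_subgrad_def subgrad_def defs by auto
    then have "0 \<le> (g z + r z - g hp - r hp) - q \<bullet> (z - hp) + 1/4 * ((z - hp) \<bullet> (z - hp))"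
      by (simp add: inner_diff_left)
    from mult_left_mono[OF this, of \<alpha>] \<alpha>
    show "0 \<le> \<alpha> * (g z + r z - g hp - r hp) - \<alpha> * (q \<bullet> (z - hp)) + \<alpha>/4 * ((z - hp) \<bullet> (z - hp))"
      by (simp add: algebra_simps)
  qed
  define X where "X = (xn - h) \<bullet> (xn - h)"
  define Y where "Y = Z \<bullet> (xn - h)"
  define rr where "rr = \<alpha> *\<^sub>R w - H"
  have df: "h - x = - w" "hp - x = - e" "xp - x = pp" "x - h = w" "hp - h = - y" "hp - xp = - q" "x - hp = e" "h - hp = y" "xp - hp = q"
    unfolding defs by (simp_all add: algebra_simps)
  have di: "H \<bullet> (xn - h) = H \<bullet> cc - H \<bullet> N" "rr \<bullet> (xn - h) = rr \<bullet> cc - rr \<bullet> N"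
     "S \<bullet> (xn - x) = - (S \<bullet> (V + Z)) - S \<bullet> N" "Z \<bullet> (h - xn) = - Y" "Z \<bullet> (hp - xn) = - Y - Z \<bullet> y" "Z \<bullet> (x - xn) = Z \<bullet> w - Y"
  proof -
    have a: "xn - x = - (V + Z) - N" "hp - xn = - (xn - h) - y" "x - xn = w - (xn - h)" "h - xn = - (xn - h)"
      using xnx unfolding defs(2,3) by (simp_all add: algebra_simps)
    show "S \<bullet> (xn - x) = - (S \<bullet> (V + Z)) - S \<bullet> N" unfolding a(1) inner_diff_right inner_minus_right ..
    show "Z \<bullet> (h - xn) = - Y" unfolding a(4) Y_def inner_minus_right ..
    show "Z \<bullet> (hp - xn) = - Y - Z \<bullet> y" unfolding a(2) Y_def inner_diff_right[of Z "- (xn - h)"] inner_minus_right ..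
    show "Z \<bullet> (x - xn) = Z \<bullet> w - Y" unfolding a(3) Y_def inner_diff_right[of Z w] ..
    show "H \<bullet> (xn - h) = H \<bullet> cc - H \<bullet> N" "rr \<bullet> (xn - h) = rr \<bullet> cc - rr \<bullet> N" unfolding ep inner_diff_right by simp_all
  qed
  note R0 = sub(1)[OF D(2)] sub(1)[OF D(4)] sub(1)[OF D(3)] sub(6)[OF D(4)] sub(2)[OF D(1)] sub(2)[OF D(5)]
      sub(2)[OF D(4)] sub(3)[OF D(5)] sub(3)[OF D(4)] sub(3)[OF D(1)] sub(4)[OF D(4)] sub(4)[OF D(2)] sub(4)[OF D(5)]
      sub(5)[OF D(2)] sub(5)[OF D(4)] sub(5)[OF D(1)] sub(7)[OF D(1)] sub(7)[OF D(2)]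
  note R1 = R0[folded rr_def, unfolded df, unfolded inner_minus_left inner_minus_right inner_scaleR_left minus_minus, unfolded di, folded X_def Y_def]
  note R = R1(1)[THEN mult_nonneg_nonneg[OF nonneg(1)]] R1(2)[THEN mult_nonneg_nonneg[OF nonneg(2)]]
    R1(3)[THEN mult_nonneg_nonneg[OF nonneg(3)]] R1(4)[THEN mult_nonneg_nonneg[OF nonneg(3)]]
    R1(5)[THEN mult_nonneg_nonneg[OF nonneg(4)]] R1(6)[THEN mult_nonneg_nonneg[OF nonneg(19)]]
    R1(7)[THEN mult_nonneg_nonneg[OF nonneg(12)]] R1(8)[THEN mult_nonneg_nonneg[OF nonneg(5)]]
    R1(9)[THEN mult_nonneg_nonneg[OF nonneg(13)]] R1(10)[THEN mult_nonneg_nonneg[OF nonneg(9)]]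
    R1(11)[THEN mult_nonneg_nonneg[OF nonneg(7)]] R1(12)[THEN mult_nonneg_nonneg[OF nonneg(8)]]
    R1(13)[THEN mult_nonneg_nonneg[OF nonneg(6)]] R1(14)[THEN mult_nonneg_nonneg[OF nonneg(16)]]
    R1(15)[THEN mult_nonneg_nonneg[OF nonneg(14)]] R1(16)[THEN mult_nonneg_nonneg[OF nonneg(15)]]
    R1(17)[THEN mult_nonneg_nonneg[OF nonneg(10)]] R1(18)[THEN mult_nonneg_nonneg[OF nonneg(11)]]
  have bud: "0 \<le> lv * (\<alpha>\<^sup>2 * L\<^sup>2 - V \<bullet> V)" "0 \<le> lh * (\<alpha>\<^sup>2 * L\<^sup>2 - H \<bullet> H)"
  proof -
    have "V \<bullet> V = \<alpha>\<^sup>2 * (v \<bullet> v)" "H \<bullet> H = \<alpha>\<^sup>2 * (u \<bullet> u)" unfolding defs by (simp_all add: power2_eq_square)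
    moreover have "v \<bullet> v \<le> L\<^sup>2" "u \<bullet> u \<le> L\<^sup>2" using c unfolding stage_def by auto
    ultimately have "0 \<le> \<alpha>\<^sup>2 * L\<^sup>2 - V \<bullet> V" "0 \<le> \<alpha>\<^sup>2 * L\<^sup>2 - H \<bullet> H"
      using mult_left_mono[of _ "L\<^sup>2" "\<alpha>\<^sup>2"] by simp_all
    then show "0 \<le> lv * (\<alpha>\<^sup>2 * L\<^sup>2 - V \<bullet> V)" "0 \<le> lh * (\<alpha>\<^sup>2 * L\<^sup>2 - H \<bullet> H)"
      using nonneg by (simp_all only: mult_nonneg_nonneg)
  qed
  have P0: "0 \<le> (1 - a) * (g h + r h - m)" using nonneg m D by simp
  have gb: "0 \<le> a * (g h + r h - m + 1/2 * ((xn - h) \<bullet> (xn - h)) - gap g r m xn hn - 1/4 * ((hn - h) \<bullet> (hn - h)))"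
    using gap_bound[OF n D(2), of m] nonneg by simp
  have epsq: "(xn - h) \<bullet> (xn - h) = w \<bullet> w - 2 * (w \<bullet> V) - 2 * (w \<bullet> N) + \<alpha>\<^sup>2 * (G \<bullet> G) - 2 * (Z \<bullet> (xn - h)) - Z \<bullet> Z"
  proof -
    have "xn - h + Z = w - \<alpha> *\<^sub>R G" unfolding ep cc_def N_def defs by (simp add: algebra_simps)
    then have "(xn - h + Z) \<bullet> (xn - h + Z) = (w - \<alpha> *\<^sub>R G) \<bullet> (w - \<alpha> *\<^sub>R G)" by simp
    moreover have "w \<bullet> V + w \<bullet> N = \<alpha> * (w \<bullet> G)" unfolding N_def defs by (simp add: algebra_simps)
    ultimately show ?thesis
      by (simp add: inner_add_left inner_add_right inner_diff_left inner_diff_right power2_eq_square inner_commute algebra_simps)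
  qed
  have gp: "\<alpha> * (vp \<bullet> q) = K \<bullet> q + \<alpha> * ((vp - Gp) \<bullet> q)" unfolding defs by (simp add: algebra_simps)
  have wp: "q \<bullet> q - e \<bullet> e = 2 * (pp \<bullet> e) + pp \<bullet> pp" unfolding q by (simp add: algebra_simps inner_commute)
  have noise: "\<alpha> * ((- A2 *\<^sub>R (x - h) + (cg1 * \<alpha>) *\<^sub>R u + (b1 * \<alpha>) *\<^sub>R (x - h - u) + (b2 * \<alpha>) *\<^sub>R s) \<bullet> (G - v))
     = - A2 * (w \<bullet> N) + cg1 * (H \<bullet> N) + b1 * (rr \<bullet> N) + b2 * (S \<bullet> N)"
    unfolding N_def rr_def defs by (simp add: inner_add_left inner_diff_left algebra_simps)
  have sq: "\<alpha>\<^sup>2 * (s \<bullet> s) = S \<bullet> S" "\<alpha>\<^sup>2 * (sn \<bullet> sn) = Z \<bullet> Z" "\<alpha>\<^sup>2 * (Gp \<bullet> Gp) = K \<bullet> K" unfolding defs by (simp_all add: power2_eq_square)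
  have form': "(cp1 + A2/2 + \<alpha>/2 - 1/2) * (w \<bullet> w) + \<alpha> * ce * (e \<bullet> e) - 2 * cp * (pp \<bullet> e) - cp * (pp \<bullet> pp) - A2 * (w \<bullet> V)
     + k1 * (V \<bullet> w + \<alpha>/4 * (w \<bullet> w)) + k2 * (V \<bullet> e + \<alpha>/4 * (e \<bullet> e))
     + k3 * (- (V \<bullet> pp) + \<alpha>/4 * (pp \<bullet> pp) + K \<bullet> q + \<alpha>/4 * (q \<bullet> q))
     + k4 * (- (H \<bullet> w) + \<alpha>/4 * (w \<bullet> w)) - cg1 * (H \<bullet> cc) - b1 * (rr \<bullet> cc)
     + og * (- \<alpha> * (q \<bullet> e) + \<alpha>/4 * (e \<bullet> e)) + o4 * (- \<alpha> * (q \<bullet> y) + \<alpha>/4 * (y \<bullet> y))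
     + mg * (H \<bullet> y + \<alpha>/4 * (y \<bullet> y)) + mr * (rr \<bullet> y)
     + c2 * (S \<bullet> e) + d1 * (S \<bullet> w) - d2 * (rr \<bullet> w) + b2 * (S \<bullet> (V + Z)) + f5 * (Z \<bullet> y) - f6 * (Z \<bullet> w)
     - (A2/2 - cr1) * (Z \<bullet> Z) - cr * (S \<bullet> S) - 1/4 * (y \<bullet> y) - lv * (V \<bullet> V) - lh * (H \<bullet> H) - lg * (K \<bullet> K) \<le> 0"
    using form unfolding memory_form_def Let_def rr_def cc_def q pp wey unfolding defs by simp
  have gx: "gap g r m x h = g h + r h + 1/2 * (w \<bullet> w) - m" unfolding gap_def df(4) by simp
  have aeq: "a = A2 + 2 * cp1 + 2 * \<alpha> * ce1 - \<alpha> * cg1 / 2" using A2 by simp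
  have X: "A2 * X = A2 * (w \<bullet> w - 2 * (w \<bullet> V) - 2 * (w \<bullet> N) + \<alpha>\<^sup>2 * (G \<bullet> G) - 2 * Y - Z \<bullet> Z)"
    using epsq unfolding X_def Y_def by simp
  have eX: "e \<bullet> e = q \<bullet> q - 2 * (pp \<bullet> e) - pp \<bullet> pp" using wp by simp
  have cpe: "cp * (q \<bullet> q) = cp * (e \<bullet> e + 2 * (pp \<bullet> e) + pp \<bullet> pp)" using wp by simp
  have GG: "\<alpha>\<^sup>2 * (G \<bullet> G) = X - w \<bullet> w + 2 * (w \<bullet> V) + 2 * (w \<bullet> N) + 2 * Y + Z \<bullet> Z"
    using epsq unfolding X_def Y_def by simp
  have R2: "0 \<le> \<alpha> * (k1 * (g h - g x)) + k1 * (V \<bullet> w + \<alpha>/4 * (w \<bullet> w))"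
    "0 \<le> \<alpha> * (k2 * (g hp - g x)) + k2 * (V \<bullet> e + \<alpha>/4 * (e \<bullet> e))"
    "0 \<le> \<alpha> * (k3 * (g xp - g x)) + k3 * (- (V \<bullet> pp) + \<alpha>/4 * (pp \<bullet> pp))"
    "0 \<le> \<alpha> * (k3 * (g hp - g xp)) + k3 * (\<alpha> * (vp \<bullet> q) + \<alpha>/4 * (q \<bullet> q))"
    "0 \<le> \<alpha> * (k4 * (g x - g h)) + k4 * (- (H \<bullet> w) + \<alpha>/4 * (w \<bullet> w))"
    "0 \<le> \<alpha> * (cg1 * (g xn - g h)) + cg1 * (- (H \<bullet> cc) + H \<bullet> N + \<alpha>/4 * X)"
    "0 \<le> \<alpha> * (mg * (g hp - g h)) + mg * (H \<bullet> y + \<alpha>/4 * (y \<bullet> y))"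
    "0 \<le> \<alpha> * (b1 * (r xn - r h)) + b1 * (- (rr \<bullet> cc) + rr \<bullet> N)"
    "0 \<le> \<alpha> * (mr * (r hp - r h)) + mr * (rr \<bullet> y)"
    "0 \<le> \<alpha> * (d2 * (r x - r h)) + d2 * (- (rr \<bullet> w))"
    "0 \<le> \<alpha> * (c2 * (r hp - r x)) + c2 * (S \<bullet> e)"
    "0 \<le> \<alpha> * (d1 * (r h - r x)) + d1 * (S \<bullet> w)"
    "0 \<le> \<alpha> * (b2 * (r xn - r x)) + b2 * (S \<bullet> (V + Z) + S \<bullet> N)"
    "0 \<le> \<alpha> * ((A2 - f5 - f6) * (r h - r xn)) + (A2 - f5 - f6) * (Y)"
    "0 \<le> \<alpha> * (f5 * (r hp - r xn)) + f5 * (Y + Z \<bullet> y)"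
    "0 \<le> \<alpha> * (f6 * (r x - r xn)) + f6 * (- (Z \<bullet> w) + Y)"
    "0 \<le> \<alpha> * (og * (g x + r x - g hp - r hp)) + og * (- \<alpha> * (q \<bullet> e) + \<alpha>/4 * (e \<bullet> e))"
    "0 \<le> \<alpha> * (o4 * (g h + r h - g hp - r hp)) + o4 * (- \<alpha> * (q \<bullet> y) + \<alpha>/4 * (y \<bullet> y))"
    using R by (simp_all add: algebra_simps)
  have fs: "k1 * (g h - g x)
      + k2 * (g hp - g x)
      + k3 * (g xp - g x)
      + k3 * (g hp - g xp)
      + k4 * (g x - g h)
      + cg1 * (g xn - g h)
      + mg * (g hp - g h)
      + b1 * (r xn - r h)
      + mr * (r hp - r h)
      + d2 * (r x - r h)
      + c2 * (r hp - r x)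
      + d1 * (r h - r x)
      + b2 * (r xn - r x)
      + (A2 - f5 - f6) * (r h - r xn)
      + f5 * (r hp - r xn)
      + f6 * (r x - r xn)
      + og * (g x + r x - g hp - r hp)
      + o4 * (g h + r h - g hp - r hp)
    = cg * (g hp - g x) + cg1 * (g xn - g h)"
    unfolding bal by algebra
  have fs\<alpha>: "\<alpha> * (k1 * (g h - g x))
      + \<alpha> * (k2 * (g hp - g x))
      + \<alpha> * (k3 * (g xp - g x))
      + \<alpha> * (k3 * (g hp - g xp))
      + \<alpha> * (k4 * (g x - g h))
      + \<alpha> * (cg1 * (g xn - g h))
      + \<alpha> * (mg * (g hp - g h))
      + \<alpha> * (b1 * (r xn - r h))
      + \<alpha> * (mr * (r hp - r h))
      + \<alpha> * (d2 * (r x - r h))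
      + \<alpha> * (c2 * (r hp - r x))
      + \<alpha> * (d1 * (r h - r x))
      + \<alpha> * (b2 * (r xn - r x))
      + \<alpha> * ((A2 - f5 - f6) * (r h - r xn))
      + \<alpha> * (f5 * (r hp - r xn))
      + \<alpha> * (f6 * (r x - r xn))
      + \<alpha> * (og * (g x + r x - g hp - r hp))
      + \<alpha> * (o4 * (g h + r h - g hp - r hp))
    = \<alpha> * (cg * (g hp - g x)) + \<alpha> * (cg1 * (g xn - g h))"
    using arg_cong[OF fs, of "\<lambda>t. \<alpha> * t"] by (simp only: distrib_left)
  have spl: "k3 * (\<alpha> * (vp \<bullet> q) + \<alpha>/4 * (q \<bullet> q)) + k3 * (- (V \<bullet> pp) + \<alpha>/4 * (pp \<bullet> pp))
       = k3 * (- (V \<bullet> pp) + \<alpha>/4 * (pp \<bullet> pp) + K \<bullet> q + \<alpha>/4 * (q \<bullet> q)) + k3 * (\<alpha> * ((vp - Gp) \<bullet> q))"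
     "cg1 * (- (H \<bullet> cc) + H \<bullet> N + \<alpha>/4 * X) = - cg1 * (H \<bullet> cc) + cg1 * (H \<bullet> N) + \<alpha> * cg1 / 4 * X"
     "b1 * (- (rr \<bullet> cc) + rr \<bullet> N) = - b1 * (rr \<bullet> cc) + b1 * (rr \<bullet> N)"
     "b2 * (S \<bullet> (V + Z) + S \<bullet> N) = b2 * (S \<bullet> (V + Z)) + b2 * (S \<bullet> N)"
     "(A2 - f5 - f6) * Y + f5 * (Y + Z \<bullet> y) + f6 * (- (Z \<bullet> w) + Y) = A2 * Y + f5 * (Z \<bullet> y) - f6 * (Z \<bullet> w)"
     "d2 * (- (rr \<bullet> w)) = - d2 * (rr \<bullet> w)"
    unfolding gp by (simp_all add: algebra_simps)
  have PX: "(1 - a) * (g h + r h - m) + a * (g h + r h - m + 1 / 2 * X - gap g r m xn hn - 1 / 4 * ((hn - h) \<bullet> (hn - h)))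
     = g h + r h - m + (A2 / 2 * X + cp1 * X + ce1 * \<alpha> * X - \<alpha> * cg1 / 4 * X) - a * (gap g r m xn hn + 1 / 4 * ((hn - h) \<bullet> (hn - h)))"
    unfolding aeq by (simp add: field_simps)
  have X2: "A2 / 2 * X = A2/2 * (w \<bullet> w) - A2 * (w \<bullet> V) - A2 * (w \<bullet> N) + A2/2 * (\<alpha>\<^sup>2 * (G \<bullet> G)) - A2 * Y - A2/2 * (Z \<bullet> Z)"
    unfolding GG by (simp add: field_simps)
  have B: "lv * (\<alpha>\<^sup>2 * L\<^sup>2 - V \<bullet> V) = lv * (\<alpha>\<^sup>2 * L\<^sup>2) - lv * (V \<bullet> V)" "lh * (\<alpha>\<^sup>2 * L\<^sup>2 - H \<bullet> H) = lh * (\<alpha>\<^sup>2 * L\<^sup>2) - lh * (H \<bullet> H)"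
     "(cp1 + A2/2 + \<alpha>/2 - 1/2) * (w \<bullet> w) = cp1 * (w \<bullet> w) + A2/2 * (w \<bullet> w) + \<alpha>/2 * (w \<bullet> w) - 1/2 * (w \<bullet> w)"
     "(A2/2 - cr1) * (Z \<bullet> Z) = A2/2 * (Z \<bullet> Z) - cr1 * (Z \<bullet> Z)"
     "cp * (q \<bullet> q - e \<bullet> e) = 2 * cp * (pp \<bullet> e) + cp * (pp \<bullet> pp)"
     "cp1 * (w \<bullet> w - X) = cp1 * (w \<bullet> w) - cp1 * X"
     "(A2/2 + lv + lh + lg) * \<alpha>\<^sup>2 * L\<^sup>2 = A2/2 * (\<alpha>\<^sup>2 * L\<^sup>2) + lv * (\<alpha>\<^sup>2 * L\<^sup>2) + lh * (\<alpha>\<^sup>2 * L\<^sup>2) + lg * (\<alpha>\<^sup>2 * L\<^sup>2)"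
     "A2/2 * \<alpha>\<^sup>2 * (G \<bullet> G - L\<^sup>2) = A2/2 * (\<alpha>\<^sup>2 * (G \<bullet> G)) - A2/2 * (\<alpha>\<^sup>2 * L\<^sup>2)"
     "lg * \<alpha>\<^sup>2 * (Gp \<bullet> Gp - L\<^sup>2) = lg * (K \<bullet> K) - lg * (\<alpha>\<^sup>2 * L\<^sup>2)"
     "k3 * \<alpha> * ((vp - Gp) \<bullet> q) = k3 * (\<alpha> * ((vp - Gp) \<bullet> q))"
     "cg1 * \<alpha> * (g xn - g h) = \<alpha> * (cg1 * (g xn - g h))" "cg * \<alpha> * (g x - g hp) = - (\<alpha> * (cg * (g hp - g x)))"
     "cr * \<alpha>\<^sup>2 * (s \<bullet> s) = cr * (S \<bullet> S)" "cr1 * \<alpha>\<^sup>2 * (sn \<bullet> sn) = cr1 * (Z \<bullet> Z)" "ce * \<alpha> * (e \<bullet> e) = \<alpha> * ce * (e \<bullet> e)"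
    unfolding eX unfolding sq[symmetric] by (simp_all add: field_simps)
  show ?thesis
    unfolding noise unfolding Lyap_def gx df(4) df(7) df(8) df(9) X_def[symmetric] B
    using R2 fs\<alpha> bud[unfolded B] P0 gb[folded X_def] PX form'[unfolded B] X2 spl by linarith
qed


text \<open>The analogue for the first step, where there is no memory yet; only the current iterate and its successor enter.\<close>

definition initial_form :: "real \<Rightarrow> real \<Rightarrow> real \<Rightarrow> real \<Rightarrow> real \<Rightarrow> real \<Rightarrow> real \<Rightarrow> real \<Rightarrow> real \<Rightarrow>
   'a::real_inner \<Rightarrow> 'a \<Rightarrow> 'a \<Rightarrow> 'a \<Rightarrow> real" where
  "initial_form \<alpha> cg1 cp1 cr1 A2 k1 k0 lv lh w V H Z =
   (let c = w - V - Z; rr = \<alpha> *\<^sub>R w - H in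
     (cp1 + A2/2 + \<alpha>/2 - 1/2) * (w \<bullet> w) - A2 * (w \<bullet> V)
     + k1 * (V \<bullet> w + \<alpha>/4 * (w \<bullet> w)) + (k1 + k0) * (- (H \<bullet> w) + \<alpha>/4 * (w \<bullet> w))
     + k0 * (V \<bullet> (V + Z) + \<alpha>/4 * (w \<bullet> w) - \<alpha>/2 * (w \<bullet> c)) - (cg1 - k0) * (H \<bullet> c) - A2 * (rr \<bullet> c)
     - (A2/2 - cr1) * (Z \<bullet> Z) - lv * (V \<bullet> V) - lh * (H \<bullet> H))"

lemma initial_drift:
  fixes g r :: "'a::real_inner \<Rightarrow> real"
  assumes c: "stage g r D L x h v u" and n: "stage g r D L xn hn vn un"
    and xn: "x - xn = \<alpha> *\<^sub>R (G + sn)" and sn: "subgrad r D xn sn"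
    and \<alpha>: "0 < \<alpha>"
    and nonneg: "0 \<le> k1" "0 \<le> k0" "k0 \<le> cg1" "0 \<le> A2" "0 \<le> lv" "0 \<le> lh"
    and A2: "A2 = 1 - 2 * cp1 - 2 * \<alpha> * ce1 + \<alpha> * cg1 / 2"
    and form: "initial_form \<alpha> cg1 cp1 cr1 A2 k1 k0 lv lh (x - h) (\<alpha> *\<^sub>R v) (\<alpha> *\<^sub>R u) (\<alpha> *\<^sub>R sn) \<le> 0"
  shows "Lyap g r m \<alpha> cg1 ce1 cp1 cr1 x h xn hn sn + \<alpha> / 2 * ((x - h) \<bullet> (x - h))
    \<le> gap g r m x h + (A2/2 + lv + lh) * \<alpha>\<^sup>2 * L\<^sup>2
     + \<alpha> * ((- A2 *\<^sub>R (x - h) + (k0 * \<alpha>) *\<^sub>R v + (k0 * \<alpha> / 2) *\<^sub>R (x - h) + ((cg1 - k0) * \<alpha>) *\<^sub>R u + (A2 * \<alpha>) *\<^sub>R (x - h - u)) \<bullet> (G - v))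
     + A2/2 * \<alpha>\<^sup>2 * (G \<bullet> G - L\<^sup>2)"
proof -
  define w V H Z where defs: "w = x - h" "V = \<alpha> *\<^sub>R v" "H = \<alpha> *\<^sub>R u" "Z = \<alpha> *\<^sub>R sn"
  define N where "N = \<alpha> *\<^sub>R (G - v)"
  define cc where "cc = w - V - Z"
  define rr where "rr = \<alpha> *\<^sub>R w - H"
  have D: "x \<in> D" "h \<in> D" "xn \<in> D" using c n unfolding stage_def by auto
  have xnx: "x - xn = V + N + Z" unfolding defs N_def using xn by (simp add: algebra_simps)
  have ep: "xn - h = cc - N" using xnx unfolding cc_def defs by (simp add: algebra_simps)
  define X where "X = (xn - h) \<bullet> (xn - h)"
  define Y where "Y = Z \<bullet> (xn - h)"
  note mult = mult_nonneg_nonneg[OF less_imp_le[OF \<alpha>]]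
  have "0 \<le> g h - (g x + v \<bullet> (h - x) - 1/4 * ((h - x) \<bullet> (h - x)))"
       "0 \<le> g xn - (g x + v \<bullet> (xn - x) - 1/4 * ((xn - x) \<bullet> (xn - x)))"
       "0 \<le> g x - (g h + u \<bullet> (x - h) - 1/4 * ((x - h) \<bullet> (x - h)))"
       "0 \<le> g xn - (g h + u \<bullet> (xn - h) - 1/4 * ((xn - h) \<bullet> (xn - h)))"
       "0 \<le> r xn - (r h + (x - h - u) \<bullet> (xn - h))" "0 \<le> r h - (r xn + sn \<bullet> (h - xn))"
    using c sn D unfolding stage_def wc_subgrad_def subgrad_def by auto
  note M = this[THEN mult]
  have wX: "(xn - x) \<bullet> (xn - x) = w \<bullet> w - 2 * (w \<bullet> cc) + 2 * (w \<bullet> N) + X"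
  proof -
    have "(E - w) \<bullet> (E - w) = w \<bullet> w - 2 * (w \<bullet> E) + E \<bullet> E" for E
      by (simp add: inner_diff_left inner_diff_right inner_commute)
    from this[of "xn - h"] have "(xn - x) \<bullet> (xn - x) = w \<bullet> w - 2 * (w \<bullet> (xn - h)) + X"
      unfolding X_def defs by simp
    then show ?thesis unfolding ep by (simp add: inner_diff_right algebra_simps)
  qed
  have di: "V \<bullet> (h - x) = - (V \<bullet> w)" "V \<bullet> (xn - x) = - (V \<bullet> (V + Z)) - V \<bullet> N" "(h - x) \<bullet> (h - x) = w \<bullet> w"
     "H \<bullet> (xn - h) = H \<bullet> cc - H \<bullet> N" "rr \<bullet> (xn - h) = rr \<bullet> cc - rr \<bullet> N" "Z \<bullet> (h - xn) = - Y"
  proof -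
    have a: "xn - x = - (V + Z) - N" "h - xn = - (xn - h)" "h - x = - w"
      using xnx unfolding defs(1) by (simp_all add: algebra_simps)
    show "V \<bullet> (xn - x) = - (V \<bullet> (V + Z)) - V \<bullet> N" unfolding a(1) inner_diff_right inner_minus_right ..
    show "Z \<bullet> (h - xn) = - Y" unfolding a(2) Y_def inner_minus_right ..
    show "V \<bullet> (h - x) = - (V \<bullet> w)" "(h - x) \<bullet> (h - x) = w \<bullet> w" unfolding a(3) by simp_all
    show "H \<bullet> (xn - h) = H \<bullet> cc - H \<bullet> N" "rr \<bullet> (xn - h) = rr \<bullet> cc - rr \<bullet> N" unfolding ep inner_diff_right by simp_all
  qed
  have M': "0 \<le> \<alpha> * (g h - g x) + (V \<bullet> w + \<alpha>/4 * (w \<bullet> w))"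
     "0 \<le> \<alpha> * (g xn - g x) + (V \<bullet> (V + Z) + V \<bullet> N + \<alpha>/4 * (w \<bullet> w) - \<alpha>/2 * (w \<bullet> cc) + \<alpha>/2 * (w \<bullet> N) + \<alpha>/4 * X)"
     "0 \<le> \<alpha> * (g x - g h) + (- (H \<bullet> w) + \<alpha>/4 * (w \<bullet> w))"
     "0 \<le> \<alpha> * (g xn - g h) + (- (H \<bullet> cc) + H \<bullet> N + \<alpha>/4 * X)"
     "0 \<le> \<alpha> * (r xn - r h) + (- (rr \<bullet> cc) + rr \<bullet> N)"
     "0 \<le> \<alpha> * (r h - r xn) + Y"
  proof -
    have sc: "V \<bullet> z = \<alpha> * (v \<bullet> z)" "H \<bullet> z = \<alpha> * (u \<bullet> z)" "Z \<bullet> z = \<alpha> * (sn \<bullet> z)" "rr \<bullet> z = \<alpha> * ((x - h - u) \<bullet> z)" for z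
      unfolding defs rr_def by (simp_all add: inner_diff_left algebra_simps)
    have "0 \<le> \<alpha> * (g h - g x) - V \<bullet> (h - x) + \<alpha>/4 * ((h - x) \<bullet> (h - x))"
      "0 \<le> \<alpha> * (g xn - g x) - V \<bullet> (xn - x) + \<alpha>/4 * ((xn - x) \<bullet> (xn - x))"
      "0 \<le> \<alpha> * (g x - g h) - H \<bullet> (x - h) + \<alpha>/4 * ((x - h) \<bullet> (x - h))"
      "0 \<le> \<alpha> * (g xn - g h) - H \<bullet> (xn - h) + \<alpha>/4 * ((xn - h) \<bullet> (xn - h))"
      "0 \<le> \<alpha> * (r xn - r h) - rr \<bullet> (xn - h)" "0 \<le> \<alpha> * (r h - r xn) - Z \<bullet> (h - xn)"
      using M unfolding sc by (simp_all only: right_diff_distrib distrib_left) (simp_all add: algebra_simps)?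
    note this[unfolded wX di, folded X_def defs(1)]
    then show "0 \<le> \<alpha> * (g h - g x) + (V \<bullet> w + \<alpha>/4 * (w \<bullet> w))"
     "0 \<le> \<alpha> * (g xn - g x) + (V \<bullet> (V + Z) + V \<bullet> N + \<alpha>/4 * (w \<bullet> w) - \<alpha>/2 * (w \<bullet> cc) + \<alpha>/2 * (w \<bullet> N) + \<alpha>/4 * X)"
     "0 \<le> \<alpha> * (g x - g h) + (- (H \<bullet> w) + \<alpha>/4 * (w \<bullet> w))"
     "0 \<le> \<alpha> * (g xn - g h) + (- (H \<bullet> cc) + H \<bullet> N + \<alpha>/4 * X)"
     "0 \<le> \<alpha> * (r xn - r h) + (- (rr \<bullet> cc) + rr \<bullet> N)"
     "0 \<le> \<alpha> * (r h - r xn) + Y"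
      by (simp_all add: field_simps)
  qed
  have "0 \<le> cg1 - k0" "0 \<le> k1 + k0" using nonneg by auto
  note R = M'(1)[THEN mult_nonneg_nonneg[OF nonneg(1)]] M'(2)[THEN mult_nonneg_nonneg[OF nonneg(2)]]
    M'(3)[THEN mult_nonneg_nonneg[OF this(2)]] M'(4)[THEN mult_nonneg_nonneg[OF this(1)]]
    M'(5)[THEN mult_nonneg_nonneg[OF nonneg(4)]] M'(6)[THEN mult_nonneg_nonneg[OF nonneg(4)]]
  have bud: "0 \<le> lv * (\<alpha>\<^sup>2 * L\<^sup>2 - V \<bullet> V)" "0 \<le> lh * (\<alpha>\<^sup>2 * L\<^sup>2 - H \<bullet> H)"
  proof -
    have "V \<bullet> V = \<alpha>\<^sup>2 * (v \<bullet> v)" "H \<bullet> H = \<alpha>\<^sup>2 * (u \<bullet> u)" unfolding defs by (simp_all add: power2_eq_square)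
    moreover have "v \<bullet> v \<le> L\<^sup>2" "u \<bullet> u \<le> L\<^sup>2" using c unfolding stage_def by auto
    ultimately have "0 \<le> \<alpha>\<^sup>2 * L\<^sup>2 - V \<bullet> V" "0 \<le> \<alpha>\<^sup>2 * L\<^sup>2 - H \<bullet> H"
      using mult_left_mono[of _ "L\<^sup>2" "\<alpha>\<^sup>2"] by simp_all
    then show "0 \<le> lv * (\<alpha>\<^sup>2 * L\<^sup>2 - V \<bullet> V)" "0 \<le> lh * (\<alpha>\<^sup>2 * L\<^sup>2 - H \<bullet> H)"
      using nonneg by (simp_all only: mult_nonneg_nonneg)
  qed
  have gb: "gap g r m xn hn + 1/4 * ((hn - h) \<bullet> (hn - h)) \<le> g h + r h - m + 1/2 * X"
    using gap_bound[OF n D(2), of m] unfolding X_def .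
  have X2: "A2 / 2 * X = A2/2 * (w \<bullet> w) - A2 * (w \<bullet> V) - A2 * (w \<bullet> N) + A2/2 * (\<alpha>\<^sup>2 * (G \<bullet> G)) - A2 * Y - A2/2 * (Z \<bullet> Z)"
  proof -
    have "xn - h + Z = w - \<alpha> *\<^sub>R G" unfolding ep cc_def N_def defs by (simp add: algebra_simps)
    then have "(xn - h + Z) \<bullet> (xn - h + Z) = (w - \<alpha> *\<^sub>R G) \<bullet> (w - \<alpha> *\<^sub>R G)" by simp
    then have "X + 2 * Y + Z \<bullet> Z = w \<bullet> w - 2 * (\<alpha> * (w \<bullet> G)) + \<alpha>\<^sup>2 * (G \<bullet> G)"
      unfolding X_def Y_def
      by (simp add: inner_add_left inner_add_right inner_diff_left[of w] inner_diff_right[of _ w] power2_eq_square inner_commute)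
    moreover have "w \<bullet> V + w \<bullet> N = \<alpha> * (w \<bullet> G)" unfolding N_def defs by (simp add: algebra_simps)
    ultimately have GG: "\<alpha>\<^sup>2 * (G \<bullet> G) = X - w \<bullet> w + 2 * (w \<bullet> V) + 2 * (w \<bullet> N) + 2 * Y + Z \<bullet> Z" by simp
    show ?thesis unfolding GG by (simp add: field_simps)
  qed
  have noise: "\<alpha> * ((- A2 *\<^sub>R w + (k0 * \<alpha>) *\<^sub>R v + (k0 * \<alpha> / 2) *\<^sub>R w + ((cg1 - k0) * \<alpha>) *\<^sub>R u + (A2 * \<alpha>) *\<^sub>R (w - u)) \<bullet> (G - v))
     = - A2 * (w \<bullet> N) + k0 * (V \<bullet> N) + k0 * (\<alpha> / 2 * (w \<bullet> N)) + (cg1 - k0) * (H \<bullet> N) + A2 * (rr \<bullet> N)"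
    unfolding N_def rr_def defs(2,3) by (simp add: inner_add_left inner_diff_left algebra_simps)
  have A2X: "1 / 2 * X = A2 / 2 * X + cp1 * X + ce1 * \<alpha> * X - \<alpha> * cg1 / 4 * X"
    unfolding A2 by (simp add: field_simps)
  have sq: "\<alpha>\<^sup>2 * (sn \<bullet> sn) = Z \<bullet> Z" unfolding defs by (simp_all add: power2_eq_square)
  have gx: "gap g r m x h = g h + r h + 1/2 * (w \<bullet> w) - m" unfolding gap_def defs(1) by simp
  have R2: "0 \<le> \<alpha> * (k1 * (g h - g x)) + k1 * (V \<bullet> w + \<alpha>/4 * (w \<bullet> w))"
     "0 \<le> \<alpha> * (k0 * (g xn - g x)) + (k0 * (V \<bullet> (V + Z) + \<alpha>/4 * (w \<bullet> w) - \<alpha>/2 * (w \<bullet> cc)) + k0 * (V \<bullet> N) + k0 * (\<alpha>/2 * (w \<bullet> N)) + \<alpha> * k0/4 * X)"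
     "0 \<le> \<alpha> * ((k1 + k0) * (g x - g h)) + (k1 + k0) * (- (H \<bullet> w) + \<alpha>/4 * (w \<bullet> w))"
     "0 \<le> \<alpha> * ((cg1 - k0) * (g xn - g h)) - (cg1 - k0) * (H \<bullet> cc) + (cg1 - k0) * (H \<bullet> N) + \<alpha> * cg1/4 * X - \<alpha> * k0/4 * X"
     "0 \<le> \<alpha> * (A2 * (r xn - r h)) - A2 * (rr \<bullet> cc) + A2 * (rr \<bullet> N)"
     "0 \<le> \<alpha> * (A2 * (r h - r xn)) + A2 * Y"
    using R by (simp_all add: algebra_simps add_divide_distrib diff_divide_distrib)
  have fs: "k1 * (g h - g x) + k0 * (g xn - g x) + (k1 + k0) * (g x - g h) + (cg1 - k0) * (g xn - g h) + A2 * (r xn - r h) + A2 * (r h - r xn)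
     = cg1 * (g xn - g h)" by algebra
  have fs\<alpha>: "\<alpha> * (k1 * (g h - g x)) + \<alpha> * (k0 * (g xn - g x)) + \<alpha> * ((k1 + k0) * (g x - g h)) + \<alpha> * ((cg1 - k0) * (g xn - g h))
     + \<alpha> * (A2 * (r xn - r h)) + \<alpha> * (A2 * (r h - r xn)) = \<alpha> * (cg1 * (g xn - g h))"
    using arg_cong[OF fs, of "\<lambda>t. \<alpha> * t"] by (simp only: distrib_left)
  have B: "lv * (\<alpha>\<^sup>2 * L\<^sup>2 - V \<bullet> V) = lv * (\<alpha>\<^sup>2 * L\<^sup>2) - lv * (V \<bullet> V)" "lh * (\<alpha>\<^sup>2 * L\<^sup>2 - H \<bullet> H) = lh * (\<alpha>\<^sup>2 * L\<^sup>2) - lh * (H \<bullet> H)"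
     "(cp1 + A2/2 + \<alpha>/2 - 1/2) * (w \<bullet> w) = cp1 * (w \<bullet> w) + A2/2 * (w \<bullet> w) + \<alpha>/2 * (w \<bullet> w) - 1/2 * (w \<bullet> w)"
     "(A2/2 - cr1) * (Z \<bullet> Z) = A2/2 * (Z \<bullet> Z) - cr1 * (Z \<bullet> Z)"
     "cp1 * (w \<bullet> w - X) = cp1 * (w \<bullet> w) - cp1 * X"
     "(A2/2 + lv + lh) * \<alpha>\<^sup>2 * L\<^sup>2 = A2/2 * (\<alpha>\<^sup>2 * L\<^sup>2) + lv * (\<alpha>\<^sup>2 * L\<^sup>2) + lh * (\<alpha>\<^sup>2 * L\<^sup>2)"
     "A2/2 * \<alpha>\<^sup>2 * (G \<bullet> G - L\<^sup>2) = A2/2 * (\<alpha>\<^sup>2 * (G \<bullet> G)) - A2/2 * (\<alpha>\<^sup>2 * L\<^sup>2)"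
     "cg1 * \<alpha> * (g xn - g h) = \<alpha> * (cg1 * (g xn - g h))" 
     "cr1 * \<alpha>\<^sup>2 * (sn \<bullet> sn) = cr1 * (Z \<bullet> Z)"
    unfolding sq[symmetric] by (simp_all add: field_simps)
  note form' = form[unfolded initial_form_def Let_def, folded defs, folded cc_def rr_def]
  show ?thesis
    unfolding Lyap_def gx unfolding defs(1)[symmetric] noise X_def[symmetric] B
    using R2 fs\<alpha> gb X2 A2X form'[unfolded B] bud[unfolded B] by linarith
qed

text \<open>The terms whose expectation is nonpositive: linear in the fresh noise, excess of the second moments over \<open>L\<^sup>2\<close>, and
  the noise of the previous step against a quantity that was known before it.\<close>

definition correction :: "real \<Rightarrow> real \<Rightarrow> real \<Rightarrow> real \<Rightarrow> real \<Rightarrow> real \<Rightarrow> real \<Rightarrow> real \<Rightarrow>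
    'a::real_inner \<Rightarrow> 'a \<Rightarrow> 'a \<Rightarrow> 'a \<Rightarrow> 'a \<Rightarrow> 'a \<Rightarrow> 'a \<Rightarrow> 'a \<Rightarrow> 'a \<Rightarrow> 'a \<Rightarrow> real" where
  "correction L p1 p2 p3 p4 \<kappa> \<tau> \<mu> x h v u s xp hp vp Gp G =
     (p1 *\<^sub>R (x - h) + p2 *\<^sub>R u + p3 *\<^sub>R s + p4 *\<^sub>R v) \<bullet> (G - v) + \<kappa> * (G \<bullet> G - L\<^sup>2)
     + \<tau> * (Gp \<bullet> Gp - L\<^sup>2) + \<mu> * ((vp - Gp) \<bullet> (xp - hp))"

text \<open>The constants of the correction are fixed before the trajectory, so that the inequality may be integrated.\<close>

definition interior_step where
  "interior_step g r D L m \<alpha> cg ce cp cr \<beta> \<longleftrightarrow> (\<exists>p1 p2 p3 p4 \<kappa> \<tau> \<mu>. 0 \<le> \<kappa> \<and> 0 \<le> \<tau> \<and>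
     (\<forall>xp hp vp up x h v u xn hn vn un Gp s G sn.
        stage g r D L xp hp vp up \<and> stage g r D L x h v u \<and> stage g r D L xn hn vn un \<and>
        xp - x = \<alpha> *\<^sub>R (Gp + s) \<and> subgrad r D x s \<and> x - xn = \<alpha> *\<^sub>R (G + sn) \<and> subgrad r D xn sn \<longrightarrow>
        Lyap g r m \<alpha> cg ce cp cr x h xn hn sn + \<alpha> / 2 * ((x - h) \<bullet> (x - h))
          \<le> Lyap g r m \<alpha> cg ce cp cr xp hp x h s + \<beta> * \<alpha>\<^sup>2 * L\<^sup>2
            + correction L p1 p2 p3 p4 \<kappa> \<tau> \<mu> x h v u s xp hp vp Gp G))"

definition final_step where
  "final_step g r D L m \<alpha> cg ce cp cr a \<beta> \<longleftrightarrow> (\<exists>p1 p2 p3 p4 \<kappa> \<tau> \<mu>. 0 \<le> \<kappa> \<and> 0 \<le> \<tau> \<and>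
     (\<forall>xp hp vp up x h v u xn hn vn un Gp s G sn.
        stage g r D L xp hp vp up \<and> stage g r D L x h v u \<and> stage g r D L xn hn vn un \<and>
        xp - x = \<alpha> *\<^sub>R (Gp + s) \<and> subgrad r D x s \<and> x - xn = \<alpha> *\<^sub>R (G + sn) \<and> subgrad r D xn sn \<longrightarrow>
        a * gap g r m xn hn + \<alpha> / 2 * ((x - h) \<bullet> (x - h))
          \<le> Lyap g r m \<alpha> cg ce cp cr xp hp x h s + \<beta> * \<alpha>\<^sup>2 * L\<^sup>2
            + correction L p1 p2 p3 p4 \<kappa> \<tau> \<mu> x h v u s xp hp vp Gp G))"

definition initial_step where
  "initial_step g r D L m \<alpha> cg ce cp cr \<beta> \<longleftrightarrow> (\<exists>p1 p2 p4 \<kappa>. 0 \<le> \<kappa> \<and>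
     (\<forall>x h v u xn hn vn un G sn.
        stage g r D L x h v u \<and> stage g r D L xn hn vn un \<and> x - xn = \<alpha> *\<^sub>R (G + sn) \<and> subgrad r D xn sn \<longrightarrow>
        Lyap g r m \<alpha> cg ce cp cr x h xn hn sn + \<alpha> / 2 * ((x - h) \<bullet> (x - h))
          \<le> gap g r m x h + \<beta> * \<alpha>\<^sup>2 * L\<^sup>2 + correction L p1 p2 0 p4 \<kappa> 0 0 x h v u 0 0 0 0 0 G))"

lemma interior_stepI:
  fixes g r :: "'a::real_inner \<Rightarrow> real"
  assumes m: "\<forall>y\<in>D. m \<le> g y + r y" and \<alpha>: "0 < \<alpha>"
    and nonneg: "0 \<le> k1" "0 \<le> k2" "0 \<le> k3" "0 \<le> k4" "0 \<le> b1" "0 \<le> b2" "0 \<le> c2" "0 \<le> d1" "0 \<le> d2" "0 \<le> og"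
      "0 \<le> o4" "0 \<le> mg" "0 \<le> mr" "0 \<le> f5" "0 \<le> f6" "0 \<le> A2 - f5 - f6" "0 \<le> lv" "0 \<le> lh" "0 \<le> lg" "0 \<le> cg"
    and A2: "A2 = 1 - 2 * cp - 2 * \<alpha> * ce + \<alpha> * cg / 2"
    and bal: "og = k1 + k2 + k3 - k4 - cg" "b2 = A2 - b1" "mg = cg - k2 - k3 + og + o4" "c2 = og - b2 - d1 + d2 + f6" 
      "mr = og + o4 - c2 - f5" "\<beta> = A2/2 + lv + lh + lg"
    and form: "\<And>e y S V H K Z :: 'a. memory_form \<alpha> ce cp cr cg cp cr A2 k1 k2 k3 k4 b1 b2 c2 d1 d2 og o4 mg mr f5 f6 lv lh lg e y S V H K Z \<le> 0"
  shows "interior_step g r D L m \<alpha> cg ce cp cr \<beta>"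
  unfolding interior_step_def
proof (intro exI conjI allI impI)
  have "0 \<le> A2" using nonneg by linarith
  then show "0 \<le> A2/2 * \<alpha>\<^sup>2" "0 \<le> lg * \<alpha>\<^sup>2" using nonneg by simp_all
  fix xp hp vp up x h v u xn hn vn un Gp s G sn
  assume *: "stage g r D L xp hp vp up \<and> stage g r D L x h v u \<and> stage g r D L xn hn vn un \<and>
        xp - x = \<alpha> *\<^sub>R (Gp + s) \<and> subgrad r D x s \<and> x - xn = \<alpha> *\<^sub>R (G + sn) \<and> subgrad r D xn sn"
  have "1 * (gap g r m xn hn + 1/4 * ((hn - h) \<bullet> (hn - h))) - cg * \<alpha> * (g xn - g h)
     - ce * \<alpha> * ((xn - h) \<bullet> (xn - h)) + cp * ((x - h) \<bullet> (x - h) - (xn - h) \<bullet> (xn - h)) + cr * \<alpha>\<^sup>2 * (sn \<bullet> sn)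
     + \<alpha> / 2 * ((x - h) \<bullet> (x - h))
    \<le> Lyap g r m \<alpha> cg ce cp cr xp hp x h s
     + (A2/2 + lv + lh + lg) * \<alpha>\<^sup>2 * L\<^sup>2
     + \<alpha> * ((- A2 *\<^sub>R (x - h) + (cg * \<alpha>) *\<^sub>R u + (b1 * \<alpha>) *\<^sub>R (x - h - u) + (b2 * \<alpha>) *\<^sub>R s) \<bullet> (G - v))
     + A2/2 * \<alpha>\<^sup>2 * (G \<bullet> G - L\<^sup>2) + lg * \<alpha>\<^sup>2 * (Gp \<bullet> Gp - L\<^sup>2) + k3 * \<alpha> * ((vp - Gp) \<bullet> (xp - hp))"
    using * by (intro memory_drift[where D=D and L=L and xp=xp and hp=hp and vp=vp and up=up and x=x and h=h and v=v and u=u and xn=xn and hn=hn and vn=vn and un=un and Gp=Gp and s=s and G=G and sn=sn and ?cg1.0=cg, OF _ _ _ _ _ _ _ m \<alpha> nonneg(1-18) nonneg(20) _ _ A2 bal(1-5) form]) auto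
  then show "Lyap g r m \<alpha> cg ce cp cr x h xn hn sn + \<alpha> / 2 * ((x - h) \<bullet> (x - h))
          \<le> Lyap g r m \<alpha> cg ce cp cr xp hp x h s + \<beta> * \<alpha>\<^sup>2 * L\<^sup>2
            + correction L (\<alpha> * (b1 * \<alpha> - A2)) (\<alpha> * ((cg - b1) * \<alpha>)) (\<alpha> * (b2 * \<alpha>)) 0 (A2/2 * \<alpha>\<^sup>2) (lg * \<alpha>\<^sup>2) (k3 * \<alpha>) x h v u s xp hp vp Gp G"
    unfolding Lyap_def[of g r m \<alpha> cg ce cp cr x h] correction_def bal(6)
    by (simp add: inner_add_left inner_diff_left algebra_simps)
qed

lemma final_stepI:
  fixes g r :: "'a::real_inner \<Rightarrow> real"
  assumes m: "\<forall>y\<in>D. m \<le> g y + r y" and \<alpha>: "0 < \<alpha>"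
    and nonneg: "0 \<le> k1" "0 \<le> k2" "0 \<le> k3" "0 \<le> k4" "0 \<le> b1" "0 \<le> b2" "0 \<le> c2" "0 \<le> d1" "0 \<le> d2" "0 \<le> og"
      "0 \<le> o4" "0 \<le> mg" "0 \<le> mr" "0 \<le> f5" "0 \<le> f6" "0 \<le> a - f5 - f6" "0 \<le> lv" "0 \<le> lh" "0 \<le> lg" "a \<le> 1"
    and bal: "og = k1 + k2 + k3 - k4 - cg" "b2 = a - b1" "mg = cg - k2 - k3 + og + o4" "c2 = og - b2 - d1 + d2 + f6" 
      "mr = og + o4 - c2 - f5" "\<beta> = a/2 + lv + lh + lg"
    and form: "\<And>e y S V H K Z :: 'a. memory_form \<alpha> ce cp cr 0 0 0 a k1 k2 k3 k4 b1 b2 c2 d1 d2 og o4 mg mr f5 f6 lv lh lg e y S V H K Z \<le> 0"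
  shows "final_step g r D L m \<alpha> cg ce cp cr a \<beta>"
  unfolding final_step_def
proof (intro exI conjI allI impI)
  have a: "0 \<le> a" using nonneg by linarith
  then show "0 \<le> a/2 * \<alpha>\<^sup>2" "0 \<le> lg * \<alpha>\<^sup>2" using nonneg by simp_all
  fix xp hp vp up x h v u xn hn vn un Gp s G sn
  assume *: "stage g r D L xp hp vp up \<and> stage g r D L x h v u \<and> stage g r D L xn hn vn un \<and>
        xp - x = \<alpha> *\<^sub>R (Gp + s) \<and> subgrad r D x s \<and> x - xn = \<alpha> *\<^sub>R (G + sn) \<and> subgrad r D xn sn"
  have "a * (gap g r m xn hn + 1/4 * ((hn - h) \<bullet> (hn - h))) - 0 * \<alpha> * (g xn - g h)
     - 0 * \<alpha> * ((xn - h) \<bullet> (xn - h)) + 0 * ((x - h) \<bullet> (x - h) - (xn - h) \<bullet> (xn - h)) + 0 * \<alpha>\<^sup>2 * (sn \<bullet> sn)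
     + \<alpha> / 2 * ((x - h) \<bullet> (x - h))
    \<le> Lyap g r m \<alpha> cg ce cp cr xp hp x h s
     + (a/2 + lv + lh + lg) * \<alpha>\<^sup>2 * L\<^sup>2
     + \<alpha> * ((- a *\<^sub>R (x - h) + (0 * \<alpha>) *\<^sub>R u + (b1 * \<alpha>) *\<^sub>R (x - h - u) + (b2 * \<alpha>) *\<^sub>R s) \<bullet> (G - v))
     + a/2 * \<alpha>\<^sup>2 * (G \<bullet> G - L\<^sup>2) + lg * \<alpha>\<^sup>2 * (Gp \<bullet> Gp - L\<^sup>2) + k3 * \<alpha> * ((vp - Gp) \<bullet> (xp - hp))"
    using * a by (intro memory_drift[where D=D and L=L and xp=xp and hp=hp and vp=vp and up=up and x=x and h=h and v=v and u=u and xn=xn and hn=hn and vn=vn and un=un and Gp=Gp and s=s and G=G and sn=sn and ?cg1.0=0, OF _ _ _ _ _ _ _ m \<alpha> nonneg(1-18) _ _ nonneg(20) _ bal(1-5) form]) auto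
  moreover have "0 \<le> a * (1/4 * ((hn - h) \<bullet> (hn - h)))" using a by simp
  ultimately show "a * gap g r m xn hn + \<alpha> / 2 * ((x - h) \<bullet> (x - h))
          \<le> Lyap g r m \<alpha> cg ce cp cr xp hp x h s + \<beta> * \<alpha>\<^sup>2 * L\<^sup>2
            + correction L (\<alpha> * (b1 * \<alpha> - a)) (\<alpha> * (- b1 * \<alpha>)) (\<alpha> * (b2 * \<alpha>)) 0 (a/2 * \<alpha>\<^sup>2) (lg * \<alpha>\<^sup>2) (k3 * \<alpha>) x h v u s xp hp vp Gp G"
    unfolding correction_def bal(6)
    by (simp add: inner_add_left inner_diff_left algebra_simps)
qed

lemma initial_stepI:
  fixes g r :: "'a::real_inner \<Rightarrow> real"
  assumes \<alpha>: "0 < \<alpha>"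
    and nonneg: "0 \<le> k1" "0 \<le> k0" "k0 \<le> cg" "0 \<le> A2" "0 \<le> lv" "0 \<le> lh"
    and A2: "A2 = 1 - 2 * cp - 2 * \<alpha> * ce + \<alpha> * cg / 2" and \<beta>: "\<beta> = A2/2 + lv + lh"
    and form: "\<And>w V H Z :: 'a. initial_form \<alpha> cg cp cr A2 k1 k0 lv lh w V H Z \<le> 0"
  shows "initial_step g r D L m \<alpha> cg ce cp cr \<beta>"
  unfolding initial_step_def
proof (intro exI conjI allI impI)
  show "0 \<le> A2/2 * \<alpha>\<^sup>2" using nonneg by simp
  fix x h v u xn hn vn un G sn
  assume *: "stage g r D L x h v u \<and> stage g r D L xn hn vn un \<and> x - xn = \<alpha> *\<^sub>R (G + sn) \<and> subgrad r D xn sn"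
  have "Lyap g r m \<alpha> cg ce cp cr x h xn hn sn + \<alpha> / 2 * ((x - h) \<bullet> (x - h))
    \<le> gap g r m x h + (A2/2 + lv + lh) * \<alpha>\<^sup>2 * L\<^sup>2
     + \<alpha> * ((- A2 *\<^sub>R (x - h) + (k0 * \<alpha>) *\<^sub>R v + (k0 * \<alpha> / 2) *\<^sub>R (x - h) + ((cg - k0) * \<alpha>) *\<^sub>R u + (A2 * \<alpha>) *\<^sub>R (x - h - u)) \<bullet> (G - v))
     + A2/2 * \<alpha>\<^sup>2 * (G \<bullet> G - L\<^sup>2)"
    using * by (intro initial_drift[where D=D and L=L and x=x and h=h and v=v and u=u and xn=xn and hn=hn and vn=vn and un=un and G=G and sn=sn, OF _ _ _ _ \<alpha> nonneg A2 form]) auto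
  then show "Lyap g r m \<alpha> cg ce cp cr x h xn hn sn + \<alpha> / 2 * ((x - h) \<bullet> (x - h))
          \<le> gap g r m x h + \<beta> * \<alpha>\<^sup>2 * L\<^sup>2 + correction L (\<alpha> * (- A2 + k0 * \<alpha> / 2 + A2 * \<alpha>)) (\<alpha> * ((cg - k0) * \<alpha> - A2 * \<alpha>)) 0 (\<alpha> * (k0 * \<alpha>)) (A2/2 * \<alpha>\<^sup>2) 0 0 x h v u 0 0 0 0 0 G"
    unfolding correction_def \<beta>
    by (simp add: inner_add_left inner_diff_left algebra_simps)
qed

text \<open>This is the classical one-step bound, with constant two. With these multipliers the form is minus a sum of two
  squares; the first of them is the nonexpansiveness of the proximal map of \<open>r\<close>.\<close>

lemma plain_step:
  fixes g r :: "'a::real_inner \<Rightarrow> real"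
  assumes \<alpha>: "0 < \<alpha>" "\<alpha> \<le> 1"
  shows "initial_step g r D L m \<alpha> 0 0 0 0 2"
proof (rule initial_stepI[where ?k1.0 = "1 - \<alpha>" and ?k0.0 = 0 and ?A2.0 = 1 and lv = "1/2" and lh = 1])
  fix w V H Z :: 'a
  have "initial_form \<alpha> 0 0 0 1 (1 - \<alpha>) 0 (1/2) 1 w V H Z
     = - (1/2) * ((Z - (\<alpha> *\<^sub>R w - H)) \<bullet> (Z - (\<alpha> *\<^sub>R w - H))) - 1/2 * ((V + H) \<bullet> (V + H))"
    unfolding initial_form_def Let_def
    by (simp add: inner_add_left inner_add_right inner_diff_left inner_diff_right inner_commute algebra_simps add_divide_distrib diff_divide_distrib)
  also have "\<dots> \<le> 0"
    using inner_ge_zero[of "Z - (\<alpha> *\<^sub>R w - H)"] inner_ge_zero[of "V + H"] by linarith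
  finally show "initial_form \<alpha> 0 0 0 1 (1 - \<alpha>) 0 (1/2) 1 w V H Z \<le> 0" .
qed (use \<alpha> in auto)

text \<open>A step with weight \<open>w j\<close> on the next value can be charged to weight \<open>w (Suc j)\<close> on the current one, because the
  decrease \<open>d\<close> is at most \<open>\<alpha>\<close> times the value.\<close>

lemma tail_sum:
  fixes d F w :: "nat \<Rightarrow> real"
  assumes X: "\<And>t. F (Suc t) + d t \<le> F t + 2 * c" and dF: "\<And>t. d t \<le> \<alpha> * F t" and c: "0 \<le> c"
    and w: "w 0 = 0" "\<And>j. j < k \<Longrightarrow> w j + (1 - w j) * \<alpha> \<le> w (Suc j)" "\<And>j. j < k \<Longrightarrow> 0 \<le> w j \<and> w j \<le> 1"
    and F: "\<And>t. 0 \<le> F t"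
  shows "(\<Sum>j<k. d (t + j)) \<le> w k * F t + 2 * c * (\<Sum>j<k. w j)"
  using w
proof (induction k arbitrary: t)
  case 0 then show ?case by simp
next
  case (Suc k)
  have IH: "(\<Sum>j<k. d (Suc t + j)) \<le> w k * F (Suc t) + 2 * c * (\<Sum>j<k. w j)"
    by (rule Suc.IH) (use Suc.prems in auto)
  have wk: "0 \<le> w k" "w k \<le> 1" using Suc.prems by auto
  have "(\<Sum>j<Suc k. d (t + j)) = d t + (\<Sum>j<k. d (Suc t + j))"
    by (subst sum.lessThan_Suc_shift) simp
  also have "\<dots> \<le> d t + w k * (F t - d t + 2 * c) + 2 * c * (\<Sum>j<k. w j)"
    using IH mult_left_mono[OF X[of t] wk(1)] by (simp add: algebra_simps)
  also have "\<dots> = (1 - w k) * d t + w k * F t + 2 * c * (\<Sum>j<Suc k. w j)" by (simp add: algebra_simps)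
  also have "\<dots> \<le> (1 - w k) * (\<alpha> * F t) + w k * F t + 2 * c * (\<Sum>j<Suc k. w j)"
    using mult_left_mono[OF dF[of t], of "1 - w k"] wk by simp
  also have "\<dots> = (w k + (1 - w k) * \<alpha>) * F t + 2 * c * (\<Sum>j<Suc k. w j)" by (simp add: algebra_simps)
  also have "\<dots> \<le> w (Suc k) * F t + 2 * c * (\<Sum>j<Suc k. w j)"
    using mult_right_mono[OF Suc.prems(2)[of k] F[of t]] by simp
  finally show ?case .
qed

text \<open>One initial step, \<open>n\<close> steps of the potential with memory, one step back to the envelope, and \<open>k\<close> weighted plain steps.\<close>

lemma accounting:
  fixes d F w \<Psi> :: "nat \<Rightarrow> real"
  assumes X: "\<And>t. F (Suc t) + d t \<le> F t + 2 * c" and dF: "\<And>t. d t \<le> \<alpha> * F t" and c: "0 \<le> c"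
    and w: "w 0 = 0" "\<And>j. j < k \<Longrightarrow> w j + (1 - w j) * \<alpha> \<le> w (Suc j)" "\<And>j. j < k \<Longrightarrow> 0 \<le> w j \<and> w j \<le> 1"
    and F: "\<And>t. 0 \<le> F t"
    and initial: "\<Psi> 1 + d 0 \<le> F 0 + s * c"
    and interior: "\<And>t. 1 \<le> t \<Longrightarrow> t \<le> n \<Longrightarrow> \<Psi> (Suc t) + d t \<le> \<Psi> t + \<beta> * c"
    and last: "a * F (Suc (Suc n)) + d (Suc n) \<le> \<Psi> (Suc n) + p * c" and a: "w k \<le> a"
  shows "(\<Sum>t<Suc (Suc n) + k. d t) \<le> F 0 + (s + real n * \<beta> + p + 2 * (\<Sum>j<k. w j)) * c"
proof -
  have mem: "(\<Sum>t<Suc i. d t) + \<Psi> (Suc i) \<le> F 0 + (s + real i * \<beta>) * c" if "i \<le> n" for i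
    using that
  proof (induction i)
    case 0 then show ?case using initial by simp
  next
    case (Suc i)
    then show ?case using interior[of "Suc i"] by (simp add: algebra_simps)
  qed
  have "(\<Sum>t<Suc (Suc n) + k. d t) = (\<Sum>t<Suc n. d t) + d (Suc n) + (\<Sum>j<k. d (Suc (Suc n) + j))"
    by (induction k) auto
  also have "(\<Sum>j<k. d (Suc (Suc n) + j)) \<le> w k * F (Suc (Suc n)) + 2 * c * (\<Sum>j<k. w j)"
    by (rule tail_sum[where F=F and d=d and w=w and c=c and \<alpha>=\<alpha> and k=k]) (use assms in auto)
  also have "w k * F (Suc (Suc n)) \<le> a * F (Suc (Suc n))" using a F by (intro mult_right_mono)
  finally show ?thesis using mem[of n] last by (simp add: algebra_simps)
qed

section \<open>Certificates of semidefiniteness\<close>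

definition qform :: "int list list \<Rightarrow> 'a::real_inner list \<Rightarrow> real" where
  "qform M us = (\<Sum>i<length us. \<Sum>j<length us. of_int (M ! i ! j) * (us ! i \<bullet> us ! j))"

text \<open>A factor \<open>R\<close> found in floating point is rounded to integers; \<open>c M - R\<^sup>T R\<close> is then a small matrix, and diagonal
  dominance of it shows that \<open>M\<close> is positive semidefinite without any exact factorization.\<close>

definition gram_residual :: "int \<Rightarrow> int list list \<Rightarrow> int list list \<Rightarrow> nat \<Rightarrow> nat \<Rightarrow> int" where
  "gram_residual c M R i j = c * M ! i ! j - (\<Sum>k\<leftarrow>[0..<length M]. R ! k ! i * R ! k ! j)"

definition psd_check :: "int \<Rightarrow> int list list \<Rightarrow> int list list \<Rightarrow> bool" where
  "psd_check c M R \<longleftrightarrow> c > 0 \<and> (\<forall>i\<in>set [0..<length M].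
     (\<Sum>j\<leftarrow>[0..<length M]. if j = i then 0 else \<bar>gram_residual c M R i j\<bar> + \<bar>gram_residual c M R j i\<bar>)
       \<le> 2 * gram_residual c M R i i)"

text \<open>The Gram part is a sum of squares; a diagonally dominant remainder is nonnegative by
  \<open>\<bar>a \<bullet> b\<bar> \<le> (a \<bullet> a + b \<bullet> b) / 2\<close>.\<close>

lemma qform_nonneg:
  assumes check: "psd_check c M R" and len: "length us = length M"
  shows "0 \<le> qform M us"
proof -
  define n where "n = length us"
  define q where "q i j = real_of_int (gram_residual c M R i j)" for i j
  define a where "a i = us ! i \<bullet> us ! i" for i
  have q: "q i j = c * M ! i ! j - (\<Sum>k<n. of_int (R ! k ! i) * of_int (R ! k ! j))" for i j
    unfolding q_def gram_residual_def n_def len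
    by (simp add: interv_sum_list_conv_sum_set_nat atLeast0LessThan)
  have dom: "(\<Sum>j<n. if j = i then 0 else \<bar>q i j\<bar> + \<bar>q j i\<bar>) \<le> 2 * q i i" if "i < n" for i
  proof -
    have "(\<Sum>j<n. if j = i then 0 else \<bar>gram_residual c M R i j\<bar> + \<bar>gram_residual c M R j i\<bar>) \<le> 2 * gram_residual c M R i i"
      using check that unfolding psd_check_def n_def len
      by (simp add: interv_sum_list_conv_sum_set_nat atLeast0LessThan)
    then have "real_of_int (\<Sum>j<n. if j = i then 0 else \<bar>gram_residual c M R i j\<bar> + \<bar>gram_residual c M R j i\<bar>) 
        \<le> of_int (2 * gram_residual c M R i i)"
      by (simp only: of_int_le_iff)
    then show ?thesis unfolding q_def by (simp add: if_distrib cong: if_cong)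
  qed
  have "c * qform M us = (\<Sum>i<n. \<Sum>j<n. (q i j + (\<Sum>k<n. of_int (R ! k ! i) * of_int (R ! k ! j))) * (us ! i \<bullet> us ! j))"
    unfolding qform_def n_def[symmetric] q by (simp add: sum_distrib_left algebra_simps)
  also have "\<dots> = (\<Sum>i<n. \<Sum>j<n. q i j * (us ! i \<bullet> us ! j))
      + (\<Sum>i<n. \<Sum>j<n. \<Sum>k<n. of_int (R ! k ! i) * of_int (R ! k ! j) * (us ! i \<bullet> us ! j))"
    by (simp add: distrib_right sum.distrib sum_distrib_right)
  also have "(\<Sum>i<n. \<Sum>j<n. \<Sum>k<n. real_of_int (R ! k ! i) * of_int (R ! k ! j) * (us ! i \<bullet> us ! j))
      = (\<Sum>k<n. (\<Sum>i<n. of_int (R ! k ! i) *\<^sub>R us ! i) \<bullet> (\<Sum>j<n. of_int (R ! k ! j) *\<^sub>R us ! j))"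
  proof -
    have "(\<Sum>i<n. \<Sum>j<n. \<Sum>k<n. real_of_int (R ! k ! i) * of_int (R ! k ! j) * (us ! i \<bullet> us ! j))
       = (\<Sum>i<n. \<Sum>k<n. \<Sum>j<n. real_of_int (R ! k ! i) * of_int (R ! k ! j) * (us ! i \<bullet> us ! j))"
      by (intro sum.cong refl sum.swap)
    also have "\<dots> = (\<Sum>k<n. \<Sum>i<n. \<Sum>j<n. real_of_int (R ! k ! i) * of_int (R ! k ! j) * (us ! i \<bullet> us ! j))"
      by (rule sum.swap)
    finally show ?thesis
      by (simp only: inner_sum_left) (simp add: inner_sum_right mult.assoc mult.left_commute)
  qed
  finally have eq: "c * qform M us = (\<Sum>i<n. \<Sum>j<n. q i j * (us ! i \<bullet> us ! j))
      + (\<Sum>k<n. (\<Sum>i<n. of_int (R ! k ! i) *\<^sub>R us ! i) \<bullet> (\<Sum>j<n. of_int (R ! k ! j) *\<^sub>R us ! j))" .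
  have "0 \<le> (\<Sum>i<n. \<Sum>j<n. q i j * (us ! i \<bullet> us ! j))"
  proof -
    define b where "b i j = (if j = i then 0 else \<bar>q i j\<bar>)" for i j
    have "(\<Sum>i<n. q i i * a i) = (\<Sum>i<n. \<Sum>j<n. if j = i then q i i * a i else 0)"
      by (intro sum.cong refl) simp
    then have "(\<Sum>i<n. q i i * a i) - (\<Sum>i<n. \<Sum>j<n. b i j * (a i + a j) / 2)
        = (\<Sum>i<n. \<Sum>j<n. (if j = i then q i i * a i else 0) - b i j * (a i + a j) / 2)"
      by (simp add: sum_subtractf)
    also have "\<dots> \<le> (\<Sum>i<n. \<Sum>j<n. q i j * (us ! i \<bullet> us ! j))"
    proof (intro sum_mono)
      fix i j
      have "\<bar>us ! i \<bullet> us ! j\<bar> \<le> (a i + a j) / 2"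
      proof -
        have "0 \<le> (us ! i - us ! j) \<bullet> (us ! i - us ! j)" "0 \<le> (us ! i + us ! j) \<bullet> (us ! i + us ! j)" by simp_all
        then show ?thesis unfolding a_def
          by (simp add: inner_diff_left inner_diff_right inner_add_left inner_add_right inner_commute abs_le_iff)
      qed
      then have "\<bar>q i j * (us ! i \<bullet> us ! j)\<bar> \<le> \<bar>q i j\<bar> * ((a i + a j) / 2)"
        unfolding abs_mult by (intro mult_left_mono) auto
      then show "(if j = i then q i i * a i else 0) - b i j * (a i + a j) / 2 \<le> q i j * (us ! i \<bullet> us ! j)"
        by (cases "j = i") (auto simp: b_def a_def)
    qed
    finally have le: "(\<Sum>i<n. q i i * a i) - (\<Sum>i<n. \<Sum>j<n. b i j * (a i + a j) / 2) \<le> (\<Sum>i<n. \<Sum>j<n. q i j * (us ! i \<bullet> us ! j))" .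
    have "(\<Sum>i<n. \<Sum>j<n. b i j * (a i + a j) / 2) = (\<Sum>i<n. \<Sum>j<n. b i j * a i / 2) + (\<Sum>i<n. \<Sum>j<n. b i j * a j / 2)"
      by (simp add: sum.distrib distrib_left add_divide_distrib)
    also have "(\<Sum>i<n. \<Sum>j<n. b i j * a j / 2) = (\<Sum>i<n. \<Sum>j<n. b j i * a i / 2)" by (rule sum.swap)
    also have "(\<Sum>i<n. \<Sum>j<n. b i j * a i / 2) + (\<Sum>i<n. \<Sum>j<n. b j i * a i / 2)
        = (\<Sum>i<n. (\<Sum>j<n. if j = i then 0 else \<bar>q i j\<bar> + \<bar>q j i\<bar>) * a i / 2)"
      unfolding sum.distrib[symmetric] sum_distrib_right sum_divide_distrib b_def
      by (intro sum.cong refl) (auto simp: algebra_simps)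
    also have "\<dots> \<le> (\<Sum>i<n. 2 * q i i * a i / 2)"
      using dom by (intro sum_mono divide_right_mono mult_right_mono) (auto simp: a_def)
    finally have "(\<Sum>i<n. \<Sum>j<n. b i j * (a i + a j) / 2) \<le> (\<Sum>i<n. q i i * a i)" by simp
    with le show ?thesis by linarith
  qed
  moreover have "0 \<le> (\<Sum>k<n. (\<Sum>i<n. of_int (R ! k ! i) *\<^sub>R us ! i) \<bullet> (\<Sum>j<n. of_int (R ! k ! j) *\<^sub>R us ! j))"
    by (intro sum_nonneg) simp
  ultimately have "0 \<le> of_int c * qform M us" unfolding eq by simp
  then show ?thesis using check unfolding psd_check_def by (simp add: zero_le_mult_iff)
qed

text \<open>Quadratic forms are compared coefficient by coefficient: each is written as a linear combination of the inner products
  of pairs, so that an identity of forms becomes one polynomial identity in the stepsize per pair.\<close>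

fun lincomb :: "real list \<Rightarrow> real list \<Rightarrow> real" where
  "lincomb (c # cs) (x # xs) = c * x + lincomb cs xs"
| "lincomb _ _ = 0"

lemma lincomb_eq_Nil: "k * lincomb [] [] = - (a * lincomb [] [] + b * lincomb [] [] + c * lincomb [] [])"
  by simp

lemma lincomb_eq_Cons:
  assumes "k * x = - (a * p + b * q + c * r)"
    and "k * lincomb xs ts = - (a * lincomb ps ts + b * lincomb qs ts + c * lincomb rs ts)"
  shows "k * lincomb (x # xs) (t # ts) = - (a * lincomb (p # ps) (t # ts) + b * lincomb (q # qs) (t # ts) + c * lincomb (r # rs) (t # ts))"
proof -
  have "k * lincomb (x # xs) (t # ts) = (k * x) * t + k * lincomb xs ts" by (simp add: algebra_simps)
  then show ?thesis unfolding assms by (simp add: algebra_simps)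
qed

lemma nonpos_if_neg_combination:
  fixes x :: real
  assumes "k * x = - (a * p + b * q + c * s)" "0 < k" "0 \<le> a" "0 \<le> b" "0 \<le> c" "0 \<le> p" "0 \<le> q" "0 \<le> s"
  shows "x \<le> 0"
proof -
  have "0 \<le> a * p" "0 \<le> b * q" "0 \<le> c * s" using assms by simp_all
  then have "k * x \<le> 0" unfolding assms(1) by linarith
  then show ?thesis using \<open>0 < k\<close> by (simp add: mult_le_0_iff)
qed

definition pairs7 :: "'a::real_inner \<Rightarrow> 'a \<Rightarrow> 'a \<Rightarrow> 'a \<Rightarrow> 'a \<Rightarrow> 'a \<Rightarrow> 'a \<Rightarrow> real list" where
  "pairs7 e y S V H K Z = [e \<bullet> e, e \<bullet> y, e \<bullet> S, e \<bullet> V, e \<bullet> H, e \<bullet> K, e \<bullet> Z, y \<bullet> y, y \<bullet> S, y \<bullet> V, y \<bullet> H, y \<bullet> K, y \<bullet> Z, S \<bullet> S, S \<bullet> V, S \<bullet> H, S \<bullet> K, S \<bullet> Z, V \<bullet> V, V \<bullet> H, V \<bullet> K, V \<bullet> Z, H \<bullet> H, H \<bullet> K, H \<bullet> Z, K \<bullet> K, K \<bullet> Z, Z \<bullet> Z]"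

text \<open>The scaling factor \<open>t\<close> of the first vector is needed near stepsize zero, where the coefficients belonging to that
  vector vanish to second order and the unscaled matrices would be singular.\<close>

lemma qform7: "qform [[m00, m01, m02, m03, m04, m05, m06], [m10, m11, m12, m13, m14, m15, m16], [m20, m21, m22, m23, m24, m25, m26], [m30, m31, m32, m33, m34, m35, m36], [m40, m41, m42, m43, m44, m45, m46], [m50, m51, m52, m53, m54, m55, m56], [m60, m61, m62, m63, m64, m65, m66]] [t *\<^sub>R e, y, S, V, H, K, Z]
   = lincomb [t * (t * of_int m00),
     t * of_int (m01 + m10),
     t * of_int (m02 + m20),
     t * of_int (m03 + m30),
     t * of_int (m04 + m40),
     t * of_int (m05 + m50),
     t * of_int (m06 + m60),
     of_int m11,
     of_int (m12 + m21),
     of_int (m13 + m31),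
     of_int (m14 + m41),
     of_int (m15 + m51),
     of_int (m16 + m61),
     of_int m22,
     of_int (m23 + m32),
     of_int (m24 + m42),
     of_int (m25 + m52),
     of_int (m26 + m62),
     of_int m33,
     of_int (m34 + m43),
     of_int (m35 + m53),
     of_int (m36 + m63),
     of_int m44,
     of_int (m45 + m54),
     of_int (m46 + m64),
     of_int m55,
     of_int (m56 + m65),
     of_int m66] (pairs7 e y S V H K Z)"
  unfolding qform_def pairs7_def
  by (simp add: lessThan_Suc eval_nat_numeral inner_commute algebra_simps)

definition pairs4 :: "'a::real_inner \<Rightarrow> 'a \<Rightarrow> 'a \<Rightarrow> 'a \<Rightarrow> real list" where
  "pairs4 w V H Z = [w \<bullet> w, w \<bullet> V, w \<bullet> H, w \<bullet> Z, V \<bullet> V, V \<bullet> H, V \<bullet> Z, H \<bullet> H, H \<bullet> Z, Z \<bullet> Z]"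

lemma qform4: "qform [[m00, m01, m02, m03], [m10, m11, m12, m13], [m20, m21, m22, m23], [m30, m31, m32, m33]] [t *\<^sub>R w, V, H, Z]
   = lincomb [t * (t * of_int m00),
     t * of_int (m01 + m10),
     t * of_int (m02 + m20),
     t * of_int (m03 + m30),
     of_int m11,
     of_int (m12 + m21),
     of_int (m13 + m31),
     of_int m22,
     of_int (m23 + m32),
     of_int m33] (pairs4 w V H Z)"
  unfolding qform_def pairs4_def
  by (simp add: lessThan_Suc eval_nat_numeral inner_commute algebra_simps)

lemma memory_form_lincomb: "memory_form \<alpha> ce cp cr cg1 cp1 cr1 A2 k1 k2 k3 k4 b1 b2 c2 d1 d2 og o4 mg mr f5 f6 lv lh lg e y S V H K Z
  = lincomb [0 + (cp1 + A2/2 + \<alpha>/2 - 1/2) + \<alpha> * ce + k1 * (\<alpha>/4) + k2 * (\<alpha>/4) + k3 * (\<alpha>/4) + k4 * (\<alpha>/4) - b1 * \<alpha> - og * \<alpha> + og * (\<alpha>/4) - d2 * \<alpha>,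
     0 - (cp1 + A2/2 + \<alpha>/2 - 1/2) - (cp1 + A2/2 + \<alpha>/2 - 1/2) - k1 * (\<alpha>/4) - k1 * (\<alpha>/4) - k4 * (\<alpha>/4) - k4 * (\<alpha>/4) + b1 * \<alpha> + b1 * \<alpha> - o4 * \<alpha> + mr * \<alpha> + d2 * \<alpha> + d2 * \<alpha>,
     0 - 2 * cp + k3 * (\<alpha>/4) + k3 * (\<alpha>/4) - og * \<alpha> + c2 + d1,
     0 - A2 + k1 + k2 + b1 * \<alpha>,
     0 - k4 - cg1 + b1 + d2,
     0 - 2 * cp + k3 + k3 * (\<alpha>/4) + k3 * (\<alpha>/4) - og * \<alpha>,
     0 + b1 * \<alpha> - f6,
     0 + (cp1 + A2/2 + \<alpha>/2 - 1/2) + k1 * (\<alpha>/4) + k4 * (\<alpha>/4) - b1 * \<alpha> + o4 * (\<alpha>/4) + mg * (\<alpha>/4) - mr * \<alpha> - d2 * \<alpha> - (1/4),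
     0 - o4 * \<alpha> - d1,
     0 + A2 - k1 - b1 * \<alpha>,
     0 + k4 + cg1 - b1 + mg - mr - d2,
     0 - o4 * \<alpha>,
     0 - b1 * \<alpha> + f5 + f6,
     0 - cp + k3 * (\<alpha>/4) + k3 * (\<alpha>/4) - cr,
     0 - k3 + b2,
     0,
     0 - cp - cp + k3 * (\<alpha>/4) + k3 * (\<alpha>/4) + k3 + k3 * (\<alpha>/4) + k3 * (\<alpha>/4),
     0 + b2,
     0 - lv,
     0 + cg1 - b1,
     0 - k3,
     0,
     0 - lh,
     0,
     0 + cg1 - b1,
     0 - cp + k3 * (\<alpha>/4) + k3 + k3 * (\<alpha>/4) - lg,
     0,
     0 - (A2/2 - cr1)] (pairs7 e y S V H K Z)"
  unfolding memory_form_def Let_def pairs7_def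
  by (simp add: inner_add_left inner_add_right inner_diff_left inner_diff_right inner_commute algebra_simps add_divide_distrib diff_divide_distrib)

lemma initial_form_lincomb: "initial_form \<alpha> cg1 cp1 cr1 A2 k1 k0 lv lh w V H Z
  = lincomb [0 + (cp1 + A2/2 + \<alpha>/2 - 1/2) + k1 * (\<alpha>/4) + (k1 + k0) * (\<alpha>/4) + k0 * (\<alpha>/4) - k0 * (\<alpha>/2) - A2 * \<alpha>,
     0 - A2 + k1 + k0 * (\<alpha>/2) + A2 * \<alpha>,
     0 - (k1 + k0) - (cg1 - k0) + A2,
     0 + k0 * (\<alpha>/2) + A2 * \<alpha>,
     0 + k0 - lv,
     0 + (cg1 - k0) - A2,
     0 + k0,
     0 - lh,
     0 + (cg1 - k0) - A2,
     0 - (A2/2 - cr1)] (pairs4 w V H Z)"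
  unfolding initial_form_def Let_def pairs4_def
  by (simp add: inner_add_left inner_add_right inner_diff_left inner_diff_right inner_commute algebra_simps add_divide_distrib diff_divide_distrib)

section \<open>Rational certificates on four stepsize intervals\<close>

text \<open>On an interval of stepsizes the multipliers are affine functions of the stepsize, so the forms are polynomials in it.
  The matrices below are their Bernstein coefficients on that interval, and all weights of a Bernstein combination are
  nonnegative there. The suffixes name the interval (\<open>E\<close> up to \<open>3/25\<close>, \<open>D\<close> up to \<open>27/100\<close>, \<open>C\<close> up to \<open>9/25\<close>,
  \<open>A\<close> up to \<open>1/2\<close>) and the kind of step (\<open>I\<close> interior, \<open>S\<close> initial, \<open>P\<close> final). On \<open>E\<close> the initial cost
  contains a multiple of the inverse stepsize: entering the potential is expensive there, but many cheap interior
  steps follow.\<close>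

definition "matEI0 = ([[1544, -224, 597, -114, -1403, 157, -1957],
    [-224, 10000, 147, -2037, -2814, 0, 0],
    [597, 147, 8526, -2771, 0, 0, -8363],
    [-114, -2037, -2771, 10704, 1047, 5592, 0],
    [-1403, -2814, 0, 1047, 2282, 0, 1047],
    [157, 0, 0, 5592, 0, 5722, 0],
    [-1957, 0, -8363, 0, 1047, 0, 11474]] :: int list list)"

lemma psd_EI0: "psd_check 8715 matEI0
   [[3666, -533, 1419, -271, -3336, 373, -4653],
    [0, 9319, 219, -1920, -2822, 21, -266],
    [0, 0, 8498, -2747, 630, -63, -7792],
    [0, 0, 0, 9053, 500, 5380, -2560],
    [0, 0, 0, 0, 359, -3755, -2671],
    [0, 0, 0, 0, 0, 2581, 1935],
    [0, 0, 0, 0, 0, 0, 319]]"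
  unfolding matEI0_def by code_simp

definition "matEI1 = ([[77200, 28133, 35736, 16266, -70150, 13736, -75884],
    [28133, 531929, 26388, -85683, -160671, 22713, -129],
    [35736, 26388, 409524, -108511, 0, -49782, -421117],
    [16266, -85683, -108511, 432100, 30384, 312606, 0],
    [-70150, -160671, 0, 30384, 108100, 0, 30384],
    [13736, 22713, -49782, 312606, 0, 348712, 0],
    [-75884, -129, -421117, 0, 30384, 0, 554701]] :: int list list)"

lemma psd_EI1: "psd_check 16 matEI1
   [[1109, 406, 515, 235, -1012, 198, -1095],
    [0, 2888, 74, -508, -748, 98, 153],
    [0, 0, 2505, -726, 230, -362, -2469],
    [0, 0, 0, 2463, 207, 1925, -592],
    [0, 0, 0, 0, 213, -199, 864],
    [0, 0, 0, 0, 0, 1284, 483],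
    [0, 0, 0, 0, 0, 0, 472]]"
  unfolding matEI1_def by code_simp

definition "matEI2 = ([[965000, 843325, 520275, 477900, -876875, 245275, -673975],
    [843325, 6297673, 0, -934848, -2258025, 0, -69123],
    [520275, 0, 4810332, -980900, 0, -1343568, -5301050],
    [477900, -934848, -980900, 4112500, 105225, 4320150, 0],
    [-876875, -2258025, 0, 105225, 1276250, 0, 105225],
    [245275, 0, -1343568, 4320150, 0, 5042532, 0],
    [-673975, -69123, -5301050, 0, 105225, 0, 6696275]] :: int list list)"

lemma psd_EI2: "psd_check 1493 matEI2
   [[37947, 33180, 20470, 18803, -34500, 9650, -26517],
    [0, 91109, -7455, -22167, -24438, -3514, 8524],
    [0, 0, 81893, -24600, 6399, -27227, -89240],
    [0, 0, 0, 68477, 6155, 80623, -22019],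
    [0, 0, 0, 0, 6197, -12099, 25359],
    [0, 0, 0, 0, 0, 5876, -10519],
    [0, 0, 0, 0, 0, 0, 4326]]"
  unfolding matEI2_def by code_simp

lemma form_EI:
  fixes e y S V H K Z :: "'a::real_inner"
  assumes "0 < \<alpha>" "\<alpha> \<le> 3/25"
  shows "memory_form \<alpha> (138/625) (699/5000) (1467/20000) (2499/10000) (699/5000) (1467/20000) (1801/2500 + (-6333/20000) * \<alpha>) (12371/20000 + (-6989/20000) * \<alpha>) (2037/20000 + (-211/800) * \<alpha>) (699/2500 + 5501/10000 * \<alpha>) (1047/20000 + (-349/800) * \<alpha>) (1209/4000 + (-3661/10000) * \<alpha>) (8363/20000 + 989/20000 * \<alpha>) (1089/4000 + 11787/20000 * \<alpha>) (147/20000 + (-49/800) * \<alpha>) (0) (2791/4000 + 7463/20000 * \<alpha>) (7571/20000 + (-7571/2400) * \<alpha>) (3779/4000 + (-184067/60000) * \<alpha>) (16081/20000 + (-208247/60000) * \<alpha>) (1/10 * \<alpha>) (511/2500 * \<alpha>) (669/2500 + (-1031/1200) * \<alpha>) (1141/20000 + (-1/20) * \<alpha>) (5657/20000 + 727/600 * \<alpha>) e y S V H K Z \<le> 0"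
proof -
  let ?us = "[\<alpha> *\<^sub>R e, y, S, V, H, K, Z]"
  have "1 * memory_form \<alpha> (138/625) (699/5000) (1467/20000) (2499/10000) (699/5000) (1467/20000) (1801/2500 + (-6333/20000) * \<alpha>) (12371/20000 + (-6989/20000) * \<alpha>) (2037/20000 + (-211/800) * \<alpha>) (699/2500 + 5501/10000 * \<alpha>) (1047/20000 + (-349/800) * \<alpha>) (1209/4000 + (-3661/10000) * \<alpha>) (8363/20000 + 989/20000 * \<alpha>) (1089/4000 + 11787/20000 * \<alpha>) (147/20000 + (-49/800) * \<alpha>) (0) (2791/4000 + 7463/20000 * \<alpha>) (7571/20000 + (-7571/2400) * \<alpha>) (3779/4000 + (-184067/60000) * \<alpha>) (16081/20000 + (-208247/60000) * \<alpha>) (1/10 * \<alpha>) (511/2500 * \<alpha>) (669/2500 + (-1031/1200) * \<alpha>) (1141/20000 + (-1/20) * \<alpha>) (5657/20000 + 727/600 * \<alpha>) e y S V H K Z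
     = - ((1/576 * ((3/25 - \<alpha>)^2 * (\<alpha> - 0)^0)) * qform matEI0 ?us
       + (1/14400 * ((3/25 - \<alpha>)^1 * (\<alpha> - 0)^1)) * qform matEI1 ?us
       + (1/360000 * ((3/25 - \<alpha>)^0 * (\<alpha> - 0)^2)) * qform matEI2 ?us)"
    unfolding matEI0_def matEI1_def matEI2_def memory_form_lincomb qform7 pairs7_def
    using assms by (intro lincomb_eq_Cons lincomb_eq_Nil; simp add: field_simps power2_eq_square)
  then show ?thesis
    by (rule nonpos_if_neg_combination)
      (use assms qform_nonneg[OF psd_EI0, of ?us] qform_nonneg[OF psd_EI1, of ?us] qform_nonneg[OF psd_EI2, of ?us] in \<open>auto simp: qform_nonneg matEI0_def matEI1_def matEI2_def\<close>)
qed

definition "matES0 = ([[6028, 5287, -289, 0],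
    [5287, 4862, 0, 0],
    [-289, 0, 314, 0],
    [0, 0, 0, 0]] :: int list list)"

lemma psd_ES0: "psd_check 1493 matES0
   [[2999, 2632, -144, 0],
    [0, 575, 659, 0],
    [0, 0, 105, 0],
    [0, 0, 0, 0]]"
  unfolding matES0_def by code_simp

definition "matES1 = ([[263402, 202127, 4549, -43224],
    [202127, 243100, 28230, 0],
    [4549, 28230, 84550, 28230],
    [-43224, 0, 28230, 34422]] :: int list list)"

lemma psd_ES1: "psd_check 4 matES1
   [[1022, 791, 18, -169],
    [0, 582, 170, 230],
    [0, 0, 548, 140],
    [0, 0, 0, 167]]"
  unfolding matES1_def by code_simp

definition "matES2 = ([[2817550, 1805797, 294350, -1023603],
    [1805797, 3038750, 648753, 0],
    [294350, 648753, 1917500, 648753],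
    [-1023603, 0, 648753, 803553]] :: int list list)"

lemma psd_ES2: "psd_check 1 matES2
   [[1678, 1076, 175, -610],
    [0, 1371, 336, 479],
    [0, 0, 1331, 447],
    [0, 0, 0, 31]]"
  unfolding matES2_def by code_simp

lemma form_ES:
  fixes w V H Z :: "'a::real_inner"
  assumes "0 < \<alpha>" "\<alpha> \<le> 3/25"
  shows "initial_form \<alpha> (2499/10000) (699/5000) (1467/20000) (1801/2500 + (-6333/20000) * \<alpha>) (9121/20000) (0) ((0) + 2431/20000 / \<alpha>) ((459/800) + 157/20000 / \<alpha>) w V H Z \<le> 0"
proof -
  let ?us = "[\<alpha> *\<^sub>R w, V, H, Z]"
  have "\<alpha> * initial_form \<alpha> (2499/10000) (699/5000) (1467/20000) (1801/2500 + (-6333/20000) * \<alpha>) (9121/20000) (0) ((0) + 2431/20000 / \<alpha>) ((459/800) + 157/20000 / \<alpha>) w V H Z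
     = - ((1/576 * ((3/25 - \<alpha>)^2 * (\<alpha> - 0)^0)) * qform matES0 ?us
       + (1/14400 * ((3/25 - \<alpha>)^1 * (\<alpha> - 0)^1)) * qform matES1 ?us
       + (1/360000 * ((3/25 - \<alpha>)^0 * (\<alpha> - 0)^2)) * qform matES2 ?us)"
    unfolding matES0_def matES1_def matES2_def initial_form_lincomb qform4 pairs4_def
    using assms by (intro lincomb_eq_Cons lincomb_eq_Nil; simp add: field_simps power2_eq_square)
  then show ?thesis
    by (rule nonpos_if_neg_combination)
      (use assms qform_nonneg[OF psd_ES0, of ?us] qform_nonneg[OF psd_ES1, of ?us] qform_nonneg[OF psd_ES2, of ?us] in \<open>auto simp: qform_nonneg matES0_def matES1_def matES2_def\<close>)
qed

definition "matEP0 = ([[10000, -10000, 225, -2373, -866, -944, 590],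
    [-10000, 20000, 2, -115, -3274, 0, -3391],
    [225, 2, 8526, -1465, 0, -944, -8001],
    [-2373, -115, -1465, 10006, 1999, 6536, 0],
    [-866, -3274, 0, 1999, 4006, 0, 1999],
    [-944, 0, -944, 6536, 0, 5600, 0],
    [590, -3391, -8001, 0, 1999, 0, 10000]] :: int list list)"

lemma psd_EP0: "psd_check 500000 matEP0
   [[70707, -70715, 1591, -16781, -6124, -6675, 4172],
    [0, 70703, 1605, -17597, -29278, -6677, -19808],
    [0, 0, 65248, -10384, 870, -6907, -60926],
    [0, 0, 0, 65600, 5954, 45225, -13890],
    [0, 0, 0, 0, 32734, -15263, 17743],
    [0, 0, 0, 0, 0, 19605, 19067],
    [0, 0, 0, 0, 0, 0, 2524]]"
  unfolding matEP0_def by code_simp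

definition "matEP1 = ([[202936, -218455, -4149, -65322, -21650, -33374, 8753],
    [-218455, 474515, 24554, 3122, -81850, 24504, -78778],
    [-4149, 24554, 193542, -36625, 0, -43208, -200025],
    [-65322, 3122, -36625, 250150, 49975, 163400, 0],
    [-21650, -81850, 0, 49975, 100150, 0, 49975],
    [-33374, 24504, -43208, 163400, 0, 120392, 0],
    [8753, -78778, -200025, 0, 49975, 0, 250000]] :: int list list)"

lemma psd_EP1: "psd_check 21074 matEP1
   [[65392, -70402, -1337, -21051, -6977, -10756, 2821],
    [0, 71013, 5961, -19944, -31207, -3391, -20582],
    [0, 0, 63567, -10715, 2780, -14233, -64323],
    [0, 0, 0, 65691, 4775, 45622, -15836],
    [0, 0, 0, 0, 32510, -11048, 21070],
    [0, 0, 0, 0, 0, 1852, 158],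
    [0, 0, 0, 0, 0, 0, 2024]]"
  unfolding matEP1_def by code_simp

lemma form_EP:
  fixes e y S V H K Z :: "'a::real_inner"
  assumes "0 < \<alpha>" "\<alpha> \<le> 3/25"
  shows "memory_form \<alpha> (138/625) (699/5000) (1467/20000) (0) (0) (0) (1/2) (1977/4000) (311/2500) (817/2500) (13901/20000) (1999/20000) (8001/20000) (1073/4000) (1/10000) (399/625) (1/2000) (1021/2500) (519/2500) (3/5000) (2801/20000) (59/2000) (5003/20000) (2003/20000) (327/1000) e y S V H K Z \<le> 0"
proof -
  let ?us = "[1 *\<^sub>R e, y, S, V, H, K, Z]"
  have "1 * memory_form \<alpha> (138/625) (699/5000) (1467/20000) (0) (0) (0) (1/2) (1977/4000) (311/2500) (817/2500) (13901/20000) (1999/20000) (8001/20000) (1073/4000) (1/10000) (399/625) (1/2000) (1021/2500) (519/2500) (3/5000) (2801/20000) (59/2000) (5003/20000) (2003/20000) (327/1000) e y S V H K Z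
     = - ((1/4800 * ((3/25 - \<alpha>)^1 * (\<alpha> - 0)^0)) * qform matEP0 ?us
       + (1/120000 * ((3/25 - \<alpha>)^0 * (\<alpha> - 0)^1)) * qform matEP1 ?us
       + (0) * qform matEP0 ?us)"
    unfolding matEP0_def matEP1_def memory_form_lincomb qform7 pairs7_def
    using assms by (intro lincomb_eq_Cons lincomb_eq_Nil; simp add: field_simps power2_eq_square)
  then show ?thesis
    by (rule nonpos_if_neg_combination)
      (use assms qform_nonneg[OF psd_EP0, of ?us] qform_nonneg[OF psd_EP1, of ?us] in \<open>auto simp: qform_nonneg matEP0_def matEP1_def\<close>)
qed

definition "matDI0 = ([[32475, 253323, 11875, -6350, -227500, -13350, -259075],
    [253323, 6036829, 194850, -1821775, -4350400, 194850, -1873425],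
    [11875, 194850, 4537350, -1873975, 0, -990150, -4562725],
    [-6350, -1821775, -1873975, 5235000, 1448750, 2688750, 0],
    [-227500, -4350400, 0, 1448750, 3425000, 0, 1448750],
    [-13350, 194850, -990150, 2688750, 0, 1937350, 0],
    [-259075, -1873425, -4562725, 0, 1448750, 0, 7471475]] :: int list list)"

lemma psd_DI0: "psd_check 1338 matDI0
   [[6524, 51953, 2435, -1302, -46657, -2738, -53133],
    [0, 73330, 1830, -32318, -46323, 5495, 3461],
    [0, 0, 77851, -31407, 2548, -17061, -76837],
    [0, 0, 0, 70505, 6533, 45894, -33622],
    [0, 0, 0, 0, 14487, -8943, 2428],
    [0, 0, 0, 0, 0, 8736, 10231],
    [0, 0, 0, 0, 0, 0, 3982]]"
  unfolding matDI0_def by code_simp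

definition "matDI1 = ([[462075, 3358314, 121025, -196225, -3025000, 986850, -2355400],
    [3358314, 46232747, 1753650, -13681275, -34035825, 1753650, -13327100],
    [121025, 1753650, 34444350, -12624175, 0, -11785650, -36144175],
    [-196225, -13681275, -12624175, 33210000, 11105000, 23520000, 0],
    [-3025000, -34035825, 0, 11105000, 27790000, 0, 11105000],
    [986850, 1753650, -11785650, 23520000, 0, 24214350, 0],
    [-2355400, -13327100, -36144175, 0, 11105000, 0, 58929175]] :: int list list)"

lemma psd_DI1: "psd_check 2 matDI1
   [[947, 7093, 256, -414, -6389, 2084, -4975],
    [0, 6490, 261, -3763, -3505, -1738, 1330],
    [0, 0, 8290, -2914, 307, -2853, -8608],
    [0, 0, 0, 6601, 1101, 5007, -3355],
    [0, 0, 0, 0, 1066, 2431, 1339],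
    [0, 0, 0, 0, 0, 1384, 1204],
    [0, 0, 0, 0, 0, 0, 1647]]"
  unfolding matDI1_def by code_simp

definition "matDI2 = ([[1528200, 9705663, -541400, -392300, -8460000, 3325500, -4985400],
    [9705663, 83361574, 0, -25867700, -66536900, 0, -23624600],
    [-541400, 0, 63973800, -20513100, 0, -32506200, -71573100],
    [-392300, -25867700, -20513100, 49080000, 21240000, 51060000, 0],
    [-8460000, -66536900, 0, 21240000, 56360000, 0, 21240000],
    [3325500, 0, -32506200, 51060000, 0, 64653800, 0],
    [-4985400, -23624600, -71573100, 0, 21240000, 0, 116173100]] :: int list list)"

lemma psd_DI2: "psd_check 1 matDI2
   [[1227, 7911, -441, -320, -6896, 2711, -4064],
    [0, 4555, 766, -5123, -2631, -4707, 1871],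
    [0, 0, 7948, -2105, -129, -3486, -9411],
    [0, 0, 0, 4275, 1237, 4789, -2695],
    [0, 0, 0, 0, 565, -111, 453],
    [0, 0, 0, 0, 0, 170, -142],
    [0, 0, 0, 0, 0, 0, 272]]"
  unfolding matDI2_def by code_simp

lemma form_DI:
  fixes e y S V H K Z :: "'a::real_inner"
  assumes "3/25 \<le> \<alpha>" "\<alpha> \<le> 27/100"
  shows "memory_form \<alpha> (2843/20000) (1617/20000) (2271/20000) (3439/10000) (1617/20000) (2271/20000) (8383/10000 + (-2247/20000) * \<alpha>) (33867/50000 + (-167/375) * \<alpha>) (15821/100000 + (-299/3000) * \<alpha>) (9147/50000 + 67/250 * \<alpha>) (6237/50000 + (-169/750) * \<alpha>) (11689/25000 + (-97/1500) * \<alpha>) (18537/50000 + (-2861/60000) * \<alpha>) (512/3125 + 8207/20000 * \<alpha>) (0) (0) (10997/20000 + (-31/600) * \<alpha>) (11691/50000 + (-433/500) * \<alpha>) (39321/50000 + (-543/500) * \<alpha>) (42719/100000 + (-22887/20000) * \<alpha>) (602/3125 + (-551/3000) * \<alpha>) ((-1527/100000) + 1243/3000 * \<alpha>) (6969/25000 + (-289/500) * \<alpha>) (3347/25000 + 13/500 * \<alpha>) (10793/100000 + 1459/1500 * \<alpha>) e y S V H K Z \<le> 0"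
proof -
  let ?us = "[1 *\<^sub>R e, y, S, V, H, K, Z]"
  have "1 * memory_form \<alpha> (2843/20000) (1617/20000) (2271/20000) (3439/10000) (1617/20000) (2271/20000) (8383/10000 + (-2247/20000) * \<alpha>) (33867/50000 + (-167/375) * \<alpha>) (15821/100000 + (-299/3000) * \<alpha>) (9147/50000 + 67/250 * \<alpha>) (6237/50000 + (-169/750) * \<alpha>) (11689/25000 + (-97/1500) * \<alpha>) (18537/50000 + (-2861/60000) * \<alpha>) (512/3125 + 8207/20000 * \<alpha>) (0) (0) (10997/20000 + (-31/600) * \<alpha>) (11691/50000 + (-433/500) * \<alpha>) (39321/50000 + (-543/500) * \<alpha>) (42719/100000 + (-22887/20000) * \<alpha>) (602/3125 + (-551/3000) * \<alpha>) ((-1527/100000) + 1243/3000 * \<alpha>) (6969/25000 + (-289/500) * \<alpha>) (3347/25000 + 13/500 * \<alpha>) (10793/100000 + 1459/1500 * \<alpha>) e y S V H K Z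
     = - ((1/562500 * ((27/100 - \<alpha>)^2 * (\<alpha> - 3/25)^0)) * qform matDI0 ?us
       + (1/2250000 * ((27/100 - \<alpha>)^1 * (\<alpha> - 3/25)^1)) * qform matDI1 ?us
       + (1/9000000 * ((27/100 - \<alpha>)^0 * (\<alpha> - 3/25)^2)) * qform matDI2 ?us)"
    unfolding matDI0_def matDI1_def matDI2_def memory_form_lincomb qform7 pairs7_def
    using assms by (intro lincomb_eq_Cons lincomb_eq_Nil; simp add: field_simps power2_eq_square)
  then show ?thesis
    by (rule nonpos_if_neg_combination)
      (use assms qform_nonneg[OF psd_DI0, of ?us] qform_nonneg[OF psd_DI1, of ?us] qform_nonneg[OF psd_DI2, of ?us] in \<open>auto simp: qform_nonneg matDI0_def matDI1_def matDI2_def\<close>)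
qed

definition "matDS0 = ([[485304, 3592373, -530850, -1237227],
    [3592373, 46440000, 6011475, 0],
    [-530850, 6011475, 5685000, 6011475],
    [-1237227, 0, 6011475, 7471475]] :: int list list)"

lemma psd_DS0: "psd_check 215 matDS0
   [[10207, 75670, -11182, -26061],
    [0, 65257, 32772, 30220],
    [0, 0, 4805, 2228],
    [0, 0, 0, 2974]]"
  unfolding matDS0_def by code_simp

definition "matDS1 = ([[6734322, 27041339, -8634175, -15982836],
    [27041339, 320320000, 47249175, 0],
    [-8634175, 47249175, 45295000, 47249175],
    [-15982836, 0, 47249175, 58929175]] :: int list list)"

lemma psd_DS1: "psd_check 1 matDS1
   [[2592, 10431, -3331, -6166],
    [0, 14543, 5638, 4422],
    [0, 0, 1549, 1149],
    [0, 0, 0, 153]]"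
  unfolding matDS1_def by code_simp

definition "matDS2 = ([[21299274, 51192963, -26043100, -43630137],
    [51192963, 538240000, 92813100, 0],
    [-26043100, 92813100, 90220000, 92813100],
    [-43630137, 0, 92813100, 116173100]] :: int list list)"

lemma psd_DS2: "psd_check 1 matDS2
   [[4613, 11097, -5645, -9458],
    [0, 20373, 7631, 5152],
    [0, 0, 324, 340],
    [0, 0, 0, 224]]"
  unfolding matDS2_def by code_simp

lemma form_DS:
  fixes w V H Z :: "'a::real_inner"
  assumes "3/25 \<le> \<alpha>" "\<alpha> \<le> 27/100"
  shows "initial_form \<alpha> (3439/10000) (1617/20000) (2271/20000) (8383/10000 + (-2247/20000) * \<alpha>) (52213/100000 + (-523/750) * \<alpha>) (0) (1417/625 + (-256/75) * \<alpha>) (2861/12500 + (-37/3000) * \<alpha>) w V H Z \<le> 0"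
proof -
  let ?us = "[1 *\<^sub>R w, V, H, Z]"
  have "1 * initial_form \<alpha> (3439/10000) (1617/20000) (2271/20000) (8383/10000 + (-2247/20000) * \<alpha>) (52213/100000 + (-523/750) * \<alpha>) (0) (1417/625 + (-256/75) * \<alpha>) (2861/12500 + (-37/3000) * \<alpha>) w V H Z
     = - ((1/562500 * ((27/100 - \<alpha>)^2 * (\<alpha> - 3/25)^0)) * qform matDS0 ?us
       + (1/2250000 * ((27/100 - \<alpha>)^1 * (\<alpha> - 3/25)^1)) * qform matDS1 ?us
       + (1/9000000 * ((27/100 - \<alpha>)^0 * (\<alpha> - 3/25)^2)) * qform matDS2 ?us)"
    unfolding matDS0_def matDS1_def matDS2_def initial_form_lincomb qform4 pairs4_def
    using assms by (intro lincomb_eq_Cons lincomb_eq_Nil; simp add: field_simps power2_eq_square)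
  then show ?thesis
    by (rule nonpos_if_neg_combination)
      (use assms qform_nonneg[OF psd_DS0, of ?us] qform_nonneg[OF psd_DS1, of ?us] qform_nonneg[OF psd_DS2, of ?us] in \<open>auto simp: qform_nonneg matDS0_def matDS1_def matDS2_def\<close>)
qed

definition "matDP0 = ([[638809, -683560, 155742, -87117, -158900, 64617, 6758],
    [-683560, 1173687, 60, -83, -6675, 60, -6758],
    [155742, 60, 377802, -50475, 0, 59052, -142125],
    [-87117, -83, -50475, 124700, 89100, 91650, 0],
    [-158900, -6675, 0, 89100, 293300, 0, 89100],
    [64617, 60, 59052, 91650, 0, 160502, 0],
    [6758, -6758, -142125, 0, 89100, 0, 231225]] :: int list list)"

lemma psd_DP0: "psd_check 8520 matDP0
   [[73771, -78946, 17987, -10061, -18352, 7463, 780],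
    [0, 61375, 23145, -12953, -24532, 9608, 66],
    [0, 0, 48572, 1044, 18486, 3017, -25251],
    [0, 0, 0, 28140, 8437, 34727, 1246],
    [0, 0, 0, 0, 33867, 706, 36358],
    [0, 0, 0, 0, 0, 1850, 421],
    [0, 0, 0, 0, 0, 0, 2778]]"
  unfolding matDP0_def by code_simp

definition "matDP1 = ([[3701162, -4245929, 135007, -982164, -1378000, 133807, 389836],
    [-4245929, 8186952, 911332, -54436, 167000, 88932, -709836],
    [135007, 911332, 2925066, -655400, 0, 22066, -1741600],
    [-982164, -54436, -655400, 2390400, 1074200, 1086200, 0],
    [-1378000, 167000, 0, 1074200, 2610000, 0, 1074200],
    [133807, 88932, 22066, 1086200, 0, 1148266, 0],
    [389836, -709836, -1741600, 0, 1074200, 0, 2815800]] :: int list list)"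

lemma psd_DP1: "psd_check 1 matDP1
   [[1922, -2209, 70, -511, -717, 70, 203],
    [0, 1816, 587, -652, -780, 134, -144],
    [0, 0, 1602, -148, 317, -38, -1043],
    [0, 0, 0, 1294, 190, 930, -112],
    [0, 0, 0, 0, 1159, -9, 1259],
    [0, 0, 0, 0, 0, 502, 160],
    [0, 0, 0, 0, 0, 0, 185]]"
  unfolding matDP1_def by code_simp

definition "matDP2 = ([[702038, -861797, -245833, -343953, -371200, -64183, 154297],
    [-861797, 1895412, 510641, 53, 96850, 99441, -314297],
    [-245833, 510641, 680454, -226750, 0, -133546, -586550],
    [-343953, 53, -226750, 945800, 358900, 359800, 0],
    [-371200, 96850, 0, 358900, 718400, 0, 358900],
    [-64183, 99441, -133546, 359800, 0, 226654, 0],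
    [154297, -314297, -586550, 0, 358900, 0, 945450]] :: int list list)"

lemma psd_DP2: "psd_check 53 matDP2
   [[6099, -7489, -2136, -2989, -3226, -558, 1341],
    [0, 6660, 1661, -3361, -2857, 164, -993],
    [0, 0, 5360, -2392, -400, -1594, -4958],
    [0, 0, 0, 4915, -241, 2877, -2277],
    [0, 0, 0, 0, 4390, -291, 4095],
    [0, 0, 0, 0, 0, 870, 862],
    [0, 0, 0, 0, 0, 0, 180]]"
  unfolding matDP2_def by code_simp

lemma form_DP:
  fixes e y S V H K Z :: "'a::real_inner"
  assumes "3/25 \<le> \<alpha>" "\<alpha> \<le> 27/100"
  shows "memory_form \<alpha> (2843/20000) (1617/20000) (2271/20000) (0) (0) (0) (1521/40000 + 161/100 * \<alpha>) (5737/100000 + 1359/1000 * \<alpha>) (97/5000 + 113/200 * \<alpha>) (421/20000 + 353/600 * \<alpha>) ((-21627/100000) + 3389/1500 * \<alpha>) (841/50000 + 1807/3000 * \<alpha>) (4241/200000 + 3023/3000 * \<alpha>) ((-10231/200000) + 323/750 * \<alpha>) ((-514/3125) + 514/375 * \<alpha>) ((-1911/20000) + 367/200 * \<alpha>) ((-2981/100000) + 253/1000 * \<alpha>) ((-7321/50000) + 3673/3000 * \<alpha>) (6361/50000 + 81/250 * \<alpha>) ((-2443/40000) + 77/150 * \<alpha>) ((-8/125) + 8/15 * \<alpha>) ((-6907/100000) + 721/1000 * \<alpha>) ((-7693/100000) + 1741/1500 * \<alpha>) (12029/100000 + 659/3000 * \<alpha>) (2979/100000 + 1669/3000 * \<alpha>)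 e y S V H K Z \<le> 0"
proof -
  let ?us = "[1 *\<^sub>R e, y, S, V, H, K, Z]"
  have "1 * memory_form \<alpha> (2843/20000) (1617/20000) (2271/20000) (0) (0) (0) (1521/40000 + 161/100 * \<alpha>) (5737/100000 + 1359/1000 * \<alpha>) (97/5000 + 113/200 * \<alpha>) (421/20000 + 353/600 * \<alpha>) ((-21627/100000) + 3389/1500 * \<alpha>) (841/50000 + 1807/3000 * \<alpha>) (4241/200000 + 3023/3000 * \<alpha>) ((-10231/200000) + 323/750 * \<alpha>) ((-514/3125) + 514/375 * \<alpha>) ((-1911/20000) + 367/200 * \<alpha>) ((-2981/100000) + 253/1000 * \<alpha>) ((-7321/50000) + 3673/3000 * \<alpha>) (6361/50000 + 81/250 * \<alpha>) ((-2443/40000) + 77/150 * \<alpha>) ((-8/125) + 8/15 * \<alpha>) ((-6907/100000) + 721/1000 * \<alpha>) ((-7693/100000) + 1741/1500 * \<alpha>) (12029/100000 + 659/3000 * \<alpha>) (2979/100000 + 1669/3000 * \<alpha>) e y S V H K Z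
     = - ((1/45000 * ((27/100 - \<alpha>)^2 * (\<alpha> - 3/25)^0)) * qform matDP0 ?us
       + (1/180000 * ((27/100 - \<alpha>)^1 * (\<alpha> - 3/25)^1)) * qform matDP1 ?us
       + (1/90000 * ((27/100 - \<alpha>)^0 * (\<alpha> - 3/25)^2)) * qform matDP2 ?us)"
    unfolding matDP0_def matDP1_def matDP2_def memory_form_lincomb qform7 pairs7_def
    using assms by (intro lincomb_eq_Cons lincomb_eq_Nil; simp add: field_simps power2_eq_square)
  then show ?thesis
    by (rule nonpos_if_neg_combination)
      (use assms qform_nonneg[OF psd_DP0, of ?us] qform_nonneg[OF psd_DP1, of ?us] qform_nonneg[OF psd_DP2, of ?us] in \<open>auto simp: qform_nonneg matDP0_def matDP1_def matDP2_def\<close>)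
qed

definition "matCI0 = ([[1791720, 5327829, -455140, -406180, -7176000, 2423560, -4703480],
    [5327829, 32444482, 3657960, -8981820, -32066700, 3657960, -19292520],
    [-455140, 3657960, 20929680, -6161300, 0, -11358320, -25177300],
    [-406180, -8981820, -6161300, 23688000, 16168000, 19016000, 0],
    [-7176000, -32066700, 0, 16168000, 40920000, 0, 16168000],
    [2423560, 3657960, -11358320, 19016000, 0, 22177680, 0],
    [-4703480, -19292520, -25177300, 0, 16168000, 0, 49829300]] :: int list list)"

lemma psd_CI0: "psd_check 2 matCI0
   [[1890, 5637, -482, -430, -7593, 2564, -4977],
    [0, 5753, 1744, -2701, -3707, -1241, -1830],
    [0, 0, 6211, -1259, 452, -3110, -7979],
    [0, 0, 0, 6189, 3171, 5149, -2768],
    [0, 0, 0, 0, 411, -133, 358],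
    [0, 0, 0, 0, 0, 154, -178],
    [0, 0, 0, 0, 0, 0, 195]]"
  unfolding matCI0_def by code_simp

definition "matCI1 = ([[1198530, 2166066, -285030, -302215, -4353000, 1759545, -2610640],
    [2166066, 16370633, 1219320, -4135785, -12486575, 1219320, -5744360],
    [-285030, 1219320, 10004850, -2676425, 0, -6258150, -12303425],
    [-302215, -4135785, -2676425, 10296000, 8027000, 9627000, 0],
    [-4353000, -12486575, 0, 8027000, 21334000, 0, 8027000],
    [1759545, 1219320, -6258150, 9627000, 0, 14220850, 0],
    [-2610640, -5744360, -12303425, 0, 8027000, 0, 24572425]] :: int list list)"

lemma psd_CI1: "psd_check 407 matCI1
   [[22062, 39959, -5258, -5575, -80303, 32460, -48160],
    [0, 71169, 9925, -20521, -26320, -11252, -5810],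
    [0, 0, 62807, -14567, -2564, -36058, -82842],
    [0, 0, 0, 59372, 37759, 56306, -26857],
    [0, 0, 0, 0, 10403, 8840, 4646],
    [0, 0, 0, 0, 0, 7609, -2379],
    [0, 0, 0, 0, 0, 0, 5955]]"
  unfolding matCI1_def by code_simp

definition "matCI2 = ([[200430, 130041, -47300, -48885, -639750, 283925, -357410],
    [130041, 2129713, 0, -473865, -1117475, 0, -231590],
    [-47300, 0, 1190430, -284025, 0, -857320, -1502275],
    [-48885, -473865, -284025, 1093500, 996250, 1218250, 0],
    [-639750, -1117475, 0, 996250, 2776000, 0, 996250],
    [283925, 0, -857320, 1218250, 0, 2166430, 0],
    [-357410, -231590, -1502275, 0, 996250, 0, 3028775]] :: int list list)"

lemma psd_CI2: "psd_check 3302 matCI2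
   [[25715, 16698, -6074, -6277, -82147, 36457, -45893],
    [0, 82176, 1234, -17765, -28210, -7408, 20],
    [0, 0, 62385, -15293, -7439, -41682, -83983],
    [0, 0, 0, 54967, 39279, 63356, -28601],
    [0, 0, 0, 0, 4863, -2626, 3864],
    [0, 0, 0, 0, 0, 3278, -1554],
    [0, 0, 0, 0, 0, 0, 2401]]"
  unfolding matCI2_def by code_simp

lemma form_CI:
  fixes e y S V H K Z :: "'a::real_inner"
  assumes "27/100 \<le> \<alpha>" "\<alpha> \<le> 9/25"
  shows "memory_form \<alpha> (3261/20000) (1599/20000) (1659/20000) (5439/20000) (1599/20000) (1659/20000) (8401/10000 + (-1521/8000) * \<alpha>) (2689/4000 + (-11/24) * \<alpha>) (623/4000 + (-32/225) * \<alpha>) (4397/20000 + 119/1800 * \<alpha>) (2357/10000 + (-137/300) * \<alpha>) (2413/5000 + (-19/600) * \<alpha>) (143/400 + (-3803/24000) * \<alpha>) (3301/20000 + 28969/72000 * \<alpha>) (0) (0) (2701/5000 + (-7/90) * \<alpha>) (3387/5000 + (-1129/600) * \<alpha>) (22279/20000 + (-113/60) * \<alpha>) (4123/20000 + (-24329/72000) * \<alpha>) (529/625 + (-3643/1800) * \<alpha>) ((-353/20000) + 193/600 * \<alpha>) (5283/20000 + (-43/100) * \<alpha>) (951/5000 + 437/1800 * \<alpha>) (103/2500 + 383/360 * \<alpha>) e y S V H K Z \<le> 0"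
proof -
  let ?us = "[1 *\<^sub>R e, y, S, V, H, K, Z]"
  have "1 * memory_form \<alpha> (3261/20000) (1599/20000) (1659/20000) (5439/20000) (1599/20000) (1659/20000) (8401/10000 + (-1521/8000) * \<alpha>) (2689/4000 + (-11/24) * \<alpha>) (623/4000 + (-32/225) * \<alpha>) (4397/20000 + 119/1800 * \<alpha>) (2357/10000 + (-137/300) * \<alpha>) (2413/5000 + (-19/600) * \<alpha>) (143/400 + (-3803/24000) * \<alpha>) (3301/20000 + 28969/72000 * \<alpha>) (0) (0) (2701/5000 + (-7/90) * \<alpha>) (3387/5000 + (-1129/600) * \<alpha>) (22279/20000 + (-113/60) * \<alpha>) (4123/20000 + (-24329/72000) * \<alpha>) (529/625 + (-3643/1800) * \<alpha>) ((-353/20000) + 193/600 * \<alpha>) (5283/20000 + (-43/100) * \<alpha>) (951/5000 + 437/1800 * \<alpha>) (103/2500 + 383/360 * \<alpha>) e y S V H K Z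
     = - ((1/1296000 * ((9/25 - \<alpha>)^2 * (\<alpha> - 27/100)^0)) * qform matCI0 ?us
       + (1/324000 * ((9/25 - \<alpha>)^1 * (\<alpha> - 27/100)^1)) * qform matCI1 ?us
       + (1/81000 * ((9/25 - \<alpha>)^0 * (\<alpha> - 27/100)^2)) * qform matCI2 ?us)"
    unfolding matCI0_def matCI1_def matCI2_def memory_form_lincomb qform7 pairs7_def
    using assms by (intro lincomb_eq_Cons lincomb_eq_Nil; simp add: field_simps power2_eq_square)
  then show ?thesis
    by (rule nonpos_if_neg_combination)
      (use assms qform_nonneg[OF psd_CI0, of ?us] qform_nonneg[OF psd_CI1, of ?us] qform_nonneg[OF psd_CI2, of ?us] in \<open>auto simp: qform_nonneg matCI0_def matCI1_def matCI2_def\<close>)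
qed

definition "matCS0 = ([[7743762, 13331949, -8613300, -17037351],
    [13331949, 96200000, 41345300, 0],
    [-8613300, 41345300, 52840000, 41345300],
    [-17037351, 0, 41345300, 49829300]] :: int list list)"

lemma psd_CS0: "psd_check 1 matCS0
   [[2781, 4794, -3097, -6126],
    [0, 8556, 6567, 3432],
    [0, 0, 332, -504],
    [0, 0, 0, 508]]"
  unfolding matCS0_def by code_simp

definition "matCS1 = ([[4778163, 6647371, -5615425, -9846054],
    [6647371, 53796000, 20330425, 0],
    [-5615425, 20330425, 24816000, 20330425],
    [-9846054, 0, 20330425, 24572425]] :: int list list)"

lemma psd_CS1: "psd_check 2 matCS1
   [[3089, 4303, -3635, -6374],
    [0, 9437, 5966, 2907],
    [0, 0, 899, 165],
    [0, 0, 0, 170]]"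
  unfolding matCS1_def by code_simp

definition "matCS2 = ([[732303, 836296, -865525, -1388979],
    [836296, 7436500, 2498525, 0],
    [-865525, 2498525, 2901500, 2498525],
    [-1388979, 0, 2498525, 3028775]] :: int list list)"

lemma psd_CS2: "psd_check 1345 matCS2
   [[31382, 35843, -37096, -59530],
    [0, 93366, 50234, 22853],
    [0, 0, 1699, 2465],
    [0, 0, 0, 1166]]"
  unfolding matCS2_def by code_simp

lemma form_CS:
  fixes w V H Z :: "'a::real_inner"
  assumes "27/100 \<le> \<alpha>" "\<alpha> \<le> 9/25"
  shows "initial_form \<alpha> (5439/20000) (1599/20000) (1659/20000) (8401/10000 + (-1521/8000) * \<alpha>) (821/1250 + (-1651/1800) * \<alpha>) (0) (3481/20000 + 356/225 * \<alpha>) (9011/20000 + (-401/900) * \<alpha>) w V H Z \<le> 0"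
proof -
  let ?us = "[1 *\<^sub>R w, V, H, Z]"
  have "1 * initial_form \<alpha> (5439/20000) (1599/20000) (1659/20000) (8401/10000 + (-1521/8000) * \<alpha>) (821/1250 + (-1651/1800) * \<alpha>) (0) (3481/20000 + 356/225 * \<alpha>) (9011/20000 + (-401/900) * \<alpha>) w V H Z
     = - ((1/1296000 * ((9/25 - \<alpha>)^2 * (\<alpha> - 27/100)^0)) * qform matCS0 ?us
       + (1/324000 * ((9/25 - \<alpha>)^1 * (\<alpha> - 27/100)^1)) * qform matCS1 ?us
       + (1/81000 * ((9/25 - \<alpha>)^0 * (\<alpha> - 27/100)^2)) * qform matCS2 ?us)"
    unfolding matCS0_def matCS1_def matCS2_def initial_form_lincomb qform4 pairs4_def
    using assms by (intro lincomb_eq_Cons lincomb_eq_Nil; simp add: field_simps power2_eq_square)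
  then show ?thesis
    by (rule nonpos_if_neg_combination)
      (use assms qform_nonneg[OF psd_CS0, of ?us] qform_nonneg[OF psd_CS1, of ?us] qform_nonneg[OF psd_CS2, of ?us] in \<open>auto simp: qform_nonneg matCS0_def matCS1_def matCS2_def\<close>)
qed

definition "matCP0 = ([[1507009, -1966549, 63783, -544682, -1160000, 346283, -334382],
    [-1966549, 3928398, 539902, 1082, 872300, 702, 334182],
    [63783, 539902, 1233270, -330900, 0, 310670, -589900],
    [-544682, 1082, -330900, 1876800, 1286600, 259000, 0],
    [-1160000, 872300, 0, 1286600, 2574000, 0, 1286600],
    [346283, 702, 310670, 259000, 0, 570870, 0],
    [-334382, 334182, -589900, 0, 1286600, 0, 1876500]] :: int list list)"

lemma psd_CP0: "psd_check 2546 matCP0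
   [[61938, -80836, 2622, -22390, -47683, 14234, -13745],
    [0, 58878, 26946, -30693, -27746, 19573, -4421],
    [0, 0, 49055, 882, 17790, 4612, -27454],
    [0, 0, 0, 57738, 23222, 27275, -7260],
    [0, 0, 0, 0, 51514, 9830, 61239],
    [0, 0, 0, 0, 0, 2308, 2091],
    [0, 0, 0, 0, 0, 0, 2757]]"
  unfolding matCP0_def by code_simp

definition "matCP1 = ([[2318021, -3304394, 85696, -1086942, -1903400, 206296, -694142],
    [-3304394, 7248126, 726398, -858, 1362600, 57798, 693142],
    [85696, 726398, 2315412, -662400, 0, -3188, -1653800],
    [-1086942, -858, -662400, 4247600, 2592400, 991400, 0],
    [-1903400, 1362600, 0, 2592400, 5187200, 0, 2592400],
    [206296, 57798, -3188, 991400, 0, 989812, 0],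
    [-694142, 693142, -1653800, 0, 2592400, 0, 4246200]] :: int list list)"

lemma psd_CP1: "psd_check 1380 matCP1
   [[56553, -80634, 2091, -26524, -46447, 5034, -16938],
    [0, 59161, 19794, -36171, -31521, 8209, -6918],
    [0, 0, 52900, -2697, 13631, -3354, -39884],
    [0, 0, 0, 61984, 20041, 28871, -13021],
    [0, 0, 0, 0, 58476, -690, 57756],
    [0, 0, 0, 0, 0, 20671, 20514],
    [0, 0, 0, 0, 0, 0, 2739]]"
  unfolding matCP1_def by code_simp

definition "matCP2 = ([[202978, -327529, 5359, -135997, -185850, -35116, -90372],
    [-327529, 825729, 51304, -53, 122575, 18954, 90172],
    [5359, 51304, 259884, -82875, 0, -89116, -265975],
    [-135997, -53, -82875, 592700, 326450, 183100, 0],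
    [-185850, 122575, 0, 326450, 653300, 0, 326450],
    [-35116, 18954, -89116, 183100, 0, 94084, 0],
    [-90372, 90172, -265975, 0, 326450, 0, 592425]] :: int list list)"

lemma psd_CP2: "psd_check 121 matCP2
   [[4954, -7999, 131, -3321, -4539, -858, -2207],
    [0, 5992, 1211, -4435, -3584, -762, -1126],
    [0, 0, 5472, -772, 901, -1781, -5579],
    [0, 0, 0, 6356, 1451, 2289, -2616],
    [0, 0, 0, 0, 6532, -1277, 5247],
    [0, 0, 0, 0, 0, 92, 2],
    [0, 0, 0, 0, 0, 0, 167]]"
  unfolding matCP2_def by code_simp

lemma form_CP:
  fixes e y S V H K Z :: "'a::real_inner"
  assumes "27/100 \<le> \<alpha>" "\<alpha> \<le> 9/25"
  shows "memory_form \<alpha> (3261/20000) (1599/20000) (1659/20000) (0) (0) (0) (3969/40000 + 137/100 * \<alpha>) (2113/20000 + 923/900 * \<alpha>) (2709/20000 + 1/600 * \<alpha>) ((-2903/10000) + 263/200 * \<alpha>) ((-741/5000) + 3059/1800 * \<alpha>) (1229/4000 + 4/75 * \<alpha>) ((-8321/40000) + 79/60 * \<alpha>) ((-13141/40000) + 1097/900 * \<alpha>) (8843/20000 + (-683/600) * \<alpha>) (147/1000 + 22/45 * \<alpha>) ((-3459/20000) + 1157/1800 * \<alpha>) ((-3107/20000) + 26/45 * \<alpha>) (197/2000 + (-173/1800) * \<alpha>) (1/1600) ((-1/2500) + 1/600 * \<alpha>) ((-1369/20000) + 239/900 * \<alpha>) (987/20000 + 247/360 * \<alpha>) (6141/20000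 + 49/900 * \<alpha>) ((-5797/20000) + 473/360 * \<alpha>) e y S V H K Z \<le> 0"
proof -
  let ?us = "[1 *\<^sub>R e, y, S, V, H, K, Z]"
  have "1 * memory_form \<alpha> (3261/20000) (1599/20000) (1659/20000) (0) (0) (0) (3969/40000 + 137/100 * \<alpha>) (2113/20000 + 923/900 * \<alpha>) (2709/20000 + 1/600 * \<alpha>) ((-2903/10000) + 263/200 * \<alpha>) ((-741/5000) + 3059/1800 * \<alpha>) (1229/4000 + 4/75 * \<alpha>) ((-8321/40000) + 79/60 * \<alpha>) ((-13141/40000) + 1097/900 * \<alpha>) (8843/20000 + (-683/600) * \<alpha>) (147/1000 + 22/45 * \<alpha>) ((-3459/20000) + 1157/1800 * \<alpha>) ((-3107/20000) + 26/45 * \<alpha>) (197/2000 + (-173/1800) * \<alpha>) (1/1600) ((-1/2500) + 1/600 * \<alpha>) ((-1369/20000) + 239/900 * \<alpha>) (987/20000 + 247/360 * \<alpha>) (6141/20000 + 49/900 * \<alpha>) ((-5797/20000) + 473/360 * \<alpha>) e y S V H K Z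
     = - ((1/64800 * ((9/25 - \<alpha>)^2 * (\<alpha> - 27/100)^0)) * qform matCP0 ?us
       + (1/64800 * ((9/25 - \<alpha>)^1 * (\<alpha> - 27/100)^1)) * qform matCP1 ?us
       + (1/16200 * ((9/25 - \<alpha>)^0 * (\<alpha> - 27/100)^2)) * qform matCP2 ?us)"
    unfolding matCP0_def matCP1_def matCP2_def memory_form_lincomb qform7 pairs7_def
    using assms by (intro lincomb_eq_Cons lincomb_eq_Nil; simp add: field_simps power2_eq_square)
  then show ?thesis
    by (rule nonpos_if_neg_combination)
      (use assms qform_nonneg[OF psd_CP0, of ?us] qform_nonneg[OF psd_CP1, of ?us] qform_nonneg[OF psd_CP2, of ?us] in \<open>auto simp: qform_nonneg matCP0_def matCP1_def matCP2_def\<close>)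
qed

definition "matAI0 = ([[1611900, -218574, -84000, -281975, -4468750, 1805725, -2861000],
    [-218574, 11672423, 0, -1809275, -3922225, 0, 262250],
    [-84000, 0, 4669650, -1086525, 0, -3791600, -6740275],
    [-281975, -1809275, -1086525, 5537500, 6293750, 5653750, 0],
    [-4468750, -3922225, 0, 6293750, 18750000, 0, 6293750],
    [1805725, 0, -3791600, 5653750, 0, 10324650, 0],
    [-2861000, 262250, -6740275, 0, 6293750, 0, 16220275]] :: int list list)"

lemma psd_AI0: "psd_check 533 matAI0
   [[29305, -3975, -1528, -5129, -81277, 32842, -52035],
    [0, 78773, -77, -12501, -30640, 1657, -852],
    [0, 0, 49862, -11791, -2538, -39521, -73646],
    [0, 0, 0, 51279, 49236, 53367, -22345],
    [0, 0, 0, 0, 4243, -1833, 2949],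
    [0, 0, 0, 0, 0, 2831, -808],
    [0, 0, 0, 0, 0, 0, 2080]]"
  unfolding matAI0_def by code_simp

definition "matAI1 = ([[329976, -34717, -31426, -59503, -846000, 399877, -474200],
    [-34717, 1788239, 9028, -231997, -636903, 3528, 84600],
    [-31426, 9028, 690302, -140297, 0, -645498, -1026897],
    [-59503, -231997, -140297, 735800, 994000, 886600, 0],
    [-846000, -636903, 0, 994000, 3335200, 0, 994000],
    [399877, 3528, -645498, 886600, 0, 2148902, 0],
    [-474200, 84600, -1026897, 0, 994000, 0, 2530697]] :: int list list)"

lemma psd_AI1: "psd_check 2998 matAI1
   [[31439, -3311, -2997, -5674, -80674, 38132, -45220],
    [0, 73139, 234, -9767, -29759, 1871, 1421],
    [0, 0, 45383, -9592, -5173, -40133, -70830],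
    [0, 0, 0, 44559, 48969, 56279, -20695],
    [0, 0, 0, 0, 13394, 12575, 1582],
    [0, 0, 0, 0, 0, 6920, 3440],
    [0, 0, 0, 0, 0, 0, 8934]]"
  unfolding matAI1_def by code_simp

definition "matAI2 = ([[16764, -1159, -2532, -2810, -39080, 19878, -19480],
    [-1159, 66688, 832, -7126, -25850, 392, 4944],
    [-2532, 832, 25540, -4270, 0, -27172, -39014],
    [-2810, -7126, -4270, 23424, 39240, 34744, 0],
    [-39080, -25850, 0, 39240, 146816, 0, 39240],
    [19878, 392, -27172, 34744, 0, 106036, 0],
    [-19480, 4944, -39014, 0, 39240, 0, 98646]] :: int list list)"

lemma psd_AI2: "psd_check 681 matAI2
   [[3376, -234, -511, -567, -7882, 4009, -3929],
    [0, 6734, 66, -740, -2888, 179, 364],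
    [0, 0, 4137, -761, -927, -3981, -6914],
    [0, 0, 0, 3806, 5100, 6052, -1897],
    [0, 0, 0, 0, 1619, -1505, 42],
    [0, 0, 0, 0, 0, 1159, -254],
    [0, 0, 0, 0, 0, 0, 354]]"
  unfolding matAI2_def by code_simp

lemma form_AI:
  fixes e y S V H K Z :: "'a::real_inner"
  assumes "9/25 \<le> \<alpha>" "\<alpha> \<le> 1/2"
  shows "memory_form \<alpha> (219/1250) (1559/20000) (1123/20000) (959/4000) (1559/20000) (1123/20000) (8441/10000 + (-9221/40000) * \<alpha>) (3459/5000 + (-1/2) * \<alpha>) (19469/140000 + (-431/2800) * \<alpha>) (34901/140000 + (-9/140) * \<alpha>) (3587/14000 + (-57/112) * \<alpha>) (1423/2800 + (-13/280) * \<alpha>) (2939/8750 + (-51547/280000) * \<alpha>) (23263/140000 + 105447/280000 * \<alpha>) ((-99/14000) + 11/560 * \<alpha>) ((-27/14000) + 3/560 * \<alpha>) (81787/140000 + (-293/1400) * \<alpha>) ((-63/5000) + 7/200 * \<alpha>) (29609/70000 + 123/2800 * \<alpha>) (37491/140000 + (-128047/280000) * \<alpha>) (19269/140000 + (-131/1400) * \<alpha>) ((-611/7000) + 233/560 * \<alpha>) (29023/140000 + (-751/2800) * \<alpha>) (5583/35000 + 419/700 * \<alpha>) (4377/70000 + 2589/2800 * \<alpha>) e y S V H K Z \<le> 0"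
proof -
  let ?us = "[1 *\<^sub>R e, y, S, V, H, K, Z]"
  have "1 * memory_form \<alpha> (219/1250) (1559/20000) (1123/20000) (959/4000) (1559/20000) (1123/20000) (8441/10000 + (-9221/40000) * \<alpha>) (3459/5000 + (-1/2) * \<alpha>) (19469/140000 + (-431/2800) * \<alpha>) (34901/140000 + (-9/140) * \<alpha>) (3587/14000 + (-57/112) * \<alpha>) (1423/2800 + (-13/280) * \<alpha>) (2939/8750 + (-51547/280000) * \<alpha>) (23263/140000 + 105447/280000 * \<alpha>) ((-99/14000) + 11/560 * \<alpha>) ((-27/14000) + 3/560 * \<alpha>) (81787/140000 + (-293/1400) * \<alpha>) ((-63/5000) + 7/200 * \<alpha>) (29609/70000 + 123/2800 * \<alpha>) (37491/140000 + (-128047/280000) * \<alpha>) (19269/140000 + (-131/1400) * \<alpha>) ((-611/7000) + 233/560 * \<alpha>) (29023/140000 + (-751/2800) * \<alpha>) (5583/35000 + 419/700 * \<alpha>) (4377/70000 + 2589/2800 * \<alpha>) e y S V H K Z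
     = - ((1/980000 * ((1/2 - \<alpha>)^2 * (\<alpha> - 9/25)^0)) * qform matAI0 ?us
       + (1/78400 * ((1/2 - \<alpha>)^1 * (\<alpha> - 9/25)^1)) * qform matAI1 ?us
       + (1/6272 * ((1/2 - \<alpha>)^0 * (\<alpha> - 9/25)^2)) * qform matAI2 ?us)"
    unfolding matAI0_def matAI1_def matAI2_def memory_form_lincomb qform7 pairs7_def
    using assms by (intro lincomb_eq_Cons lincomb_eq_Nil; simp add: field_simps power2_eq_square)
  then show ?thesis
    by (rule nonpos_if_neg_combination)
      (use assms qform_nonneg[OF psd_AI0, of ?us] qform_nonneg[OF psd_AI1, of ?us] qform_nonneg[OF psd_AI2, of ?us] in \<open>auto simp: qform_nonneg matAI0_def matAI1_def matAI2_def\<close>)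
qed

definition "matAS0 = ([[3355173, 2679026, -3535275, -6849999],
    [2679026, 17310000, 13034025, 0],
    [-3535275, 13034025, 20342500, 13034025],
    [-6849999, 0, 13034025, 16220275]] :: int list list)"

lemma psd_AS0: "psd_check 5 matAS0
   [[4095, 3271, -4316, -8363],
    [0, 8709, 9104, 3141],
    [0, 0, 436, 1087],
    [0, 0, 0, 320]]"
  unfolding matAS0_def by code_simp

definition "matAS1 = ([[706409, 484423, -811297, -1285874],
    [484423, 4521600, 2020897, 0],
    [-811297, 2020897, 2902200, 2020897],
    [-1285874, 0, 2020897, 2530697]] :: int list list)"

lemma psd_AS1: "psd_check 22 matAS1
   [[3940, 2705, -4530, -7179],
    [0, 9599, 5908, 2023],
    [0, 0, 2901, -3],
    [0, 0, 0, 171]]"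
  unfolding matAS1_def by code_simp

definition "matAS2 = ([[37068, 22331, -42278, -58307],
    [22331, 250944, 78254, 0],
    [-42278, 78254, 101984, 78254],
    [-58307, 0, 78254, 98646]] :: int list list)"

lemma psd_AS2: "psd_check 39850 matAS2
   [[38429, 23157, -43842, -60464],
    [0, 97280, 42492, 14393],
    [0, 0, 18330, -7855],
    [0, 0, 0, 2440]]"
  unfolding matAS2_def by code_simp

lemma form_AS:
  fixes w V H Z :: "'a::real_inner"
  assumes "9/25 \<le> \<alpha>" "\<alpha> \<le> 1/2"
  shows "initial_form \<alpha> (959/4000) (1559/20000) (1123/20000) (8441/10000 + (-9221/40000) * \<alpha>) (109029/140000 + (-1551/1400) * \<alpha>) (0) ((-27303/35000) + 219/70 * \<alpha>) (88693/140000 + (-1763/2800) * \<alpha>) w V H Z \<le> 0"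
proof -
  let ?us = "[1 *\<^sub>R w, V, H, Z]"
  have "1 * initial_form \<alpha> (959/4000) (1559/20000) (1123/20000) (8441/10000 + (-9221/40000) * \<alpha>) (109029/140000 + (-1551/1400) * \<alpha>) (0) ((-27303/35000) + 219/70 * \<alpha>) (88693/140000 + (-1763/2800) * \<alpha>) w V H Z
     = - ((1/980000 * ((1/2 - \<alpha>)^2 * (\<alpha> - 9/25)^0)) * qform matAS0 ?us
       + (1/78400 * ((1/2 - \<alpha>)^1 * (\<alpha> - 9/25)^1)) * qform matAS1 ?us
       + (1/6272 * ((1/2 - \<alpha>)^0 * (\<alpha> - 9/25)^2)) * qform matAS2 ?us)"
    unfolding matAS0_def matAS1_def matAS2_def initial_form_lincomb qform4 pairs4_def
    using assms by (intro lincomb_eq_Cons lincomb_eq_Nil; simp add: field_simps power2_eq_square)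
  then show ?thesis
    by (rule nonpos_if_neg_combination)
      (use assms qform_nonneg[OF psd_AS0, of ?us] qform_nonneg[OF psd_AS1, of ?us] qform_nonneg[OF psd_AS2, of ?us] in \<open>auto simp: qform_nonneg matAS0_def matAS1_def matAS2_def\<close>)
qed

definition "matAP0 = ([[232737, -326220, -40016, -119844, -248500, -5516, -94094],
    [-326220, 833636, 133980, -6, 90850, 58680, 15544],
    [-40016, 133980, 211464, -56050, 0, -58436, -213650],
    [-119844, -6, -56050, 595500, 381650, 157600, 0],
    [-248500, 90850, 0, 381650, 763600, 0, 381650],
    [-5516, 58680, -58436, 157600, 0, 99364, 0],
    [-94094, 15544, -213650, 0, 381650, 0, 595300]] :: int list list)"

lemma psd_AP0: "psd_check 11996 matAP0
   [[52832, -74071, -9086, -27211, -56424, -1252, -21365],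
    [0, 67180, 13906, -30004, -45988, 9097, -20780],
    [0, 0, 47541, -10567, 2668, -17646, -51915],
    [0, 0, 0, 73421, 23035, 26463, -23882],
    [0, 0, 0, 0, 57647, -3726, 53876],
    [0, 0, 0, 0, 0, 9024, 8753],
    [0, 0, 0, 0, 0, 0, 2735]]"
  unfolding matAP0_def by code_simp

definition "matAP1 = ([[837063, -1166704, -188968, -446382, -1429300, 44432, -683282],
    [-1166704, 3115592, 313600, -37818, 714600, 163000, 526182],
    [-188968, 313600, 777824, -146600, 0, -368176, -843400],
    [-446382, -37818, -146600, 2306000, 1857000, 696800, 0],
    [-1429300, 714600, 0, 1857000, 3889200, 0, 1857000],
    [44432, 163000, -368176, 696800, 0, 629024, 0],
    [-683282, 526182, -843400, 0, 1857000, 0, 2700400]] :: int list list)"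

lemma psd_AP1: "psd_check 26 matAP1
   [[4662, -6507, -1054, -2489, -7971, 248, -3811],
    [0, 6216, 209, -2764, -5355, 941, -1788],
    [0, 0, 4364, -1343, -1669, -2179, -5860],
    [0, 0, 0, 6655, 1713, 2766, -3350],
    [0, 0, 0, 0, 1778, -765, 2413],
    [0, 0, 0, 0, 0, 1547, 628],
    [0, 0, 0, 0, 0, 0, 824]]"
  unfolding matAP1_def by code_simp

definition "matAP2 = ([[20449, -24336, -2244, -10118, -37292, 4332, -21654],
    [-24336, 60352, 0, 338, 21316, 0, 21654],
    [-2244, 0, 13824, -1380, 0, -10424, -16644],
    [-10118, 338, -1380, 44600, 43748, 15264, 0],
    [-37292, 21316, 0, 43748, 94480, 0, 43748],
    [4332, 0, -10424, 15264, 0, 16840, 0],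
    [-21654, 21654, -16644, 0, 43748, 0, 60392]] :: int list list)"

lemma psd_AP2: "psd_check 105843 matAP2
   [[46520, -55370, -5106, -23021, -84848, 9856, -49268],
    [0, 57634, -4905, -21496, -42368, 9469, -7565],
    [0, 0, 37587, -9818, -17054, -26779, -54549],
    [0, 0, 0, 60265, 26533, 29588, -30405],
    [0, 0, 0, 0, 3273, -1304, 1851],
    [0, 0, 0, 0, 0, 1018, -1479],
    [0, 0, 0, 0, 0, 0, 1251]]"
  unfolding matAP2_def by code_simp

lemma form_AP:
  fixes e y S V H K Z :: "'a::real_inner"
  assumes "9/25 \<le> \<alpha>" "\<alpha> \<le> 1/2"
  shows "memory_form \<alpha> (219/1250) (1559/20000) (1123/20000) (0) (0) (0) (1849/10000 + 57/50 * \<alpha>) (27049/70000 + 139/700 * \<alpha>) (3183/28000 + 3/175 * \<alpha>) (316/4375 + 83/350 * \<alpha>) (2773/3500 + (-1419/1400) * \<alpha>) ((-863/20000) + 59/50 * \<alpha>) (4561/20000 + (-1/25) * \<alpha>) ((-997/3500) + 781/700 * \<alpha>) (753/2800 + (-753/1400) * \<alpha>) (73397/140000 + (-1789/2800) * \<alpha>) ((-1609/3500) + 2053/1400 * \<alpha>) (163/280 + (-163/140) * \<alpha>) (12339/70000 + 67/1400 * \<alpha>) (507/4000 + (-101/400) * \<alpha>) (1571/5600 + (-1571/2800) * \<alpha>) (1033/7000 + (-811/2800) * \<alpha>) (1941/5600 + (-19/140) * \<alpha>) ((-271/1750) + 2087/1400 * \<alpha>) ((-8419/70000) + 1081/1400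 * \<alpha>) e y S V H K Z \<le> 0"
proof -
  let ?us = "[1 *\<^sub>R e, y, S, V, H, K, Z]"
  have "1 * memory_form \<alpha> (219/1250) (1559/20000) (1123/20000) (0) (0) (0) (1849/10000 + 57/50 * \<alpha>) (27049/70000 + 139/700 * \<alpha>) (3183/28000 + 3/175 * \<alpha>) (316/4375 + 83/350 * \<alpha>) (2773/3500 + (-1419/1400) * \<alpha>) ((-863/20000) + 59/50 * \<alpha>) (4561/20000 + (-1/25) * \<alpha>) ((-997/3500) + 781/700 * \<alpha>) (753/2800 + (-753/1400) * \<alpha>) (73397/140000 + (-1789/2800) * \<alpha>) ((-1609/3500) + 2053/1400 * \<alpha>) (163/280 + (-163/140) * \<alpha>) (12339/70000 + 67/1400 * \<alpha>) (507/4000 + (-101/400) * \<alpha>) (1571/5600 + (-1571/2800) * \<alpha>) (1033/7000 + (-811/2800) * \<alpha>) (1941/5600 + (-19/140) * \<alpha>) ((-271/1750) + 2087/1400 * \<alpha>) ((-8419/70000) + 1081/1400 * \<alpha>) e y S V H K Z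
     = - ((1/39200 * ((1/2 - \<alpha>)^2 * (\<alpha> - 9/25)^0)) * qform matAP0 ?us
       + (1/78400 * ((1/2 - \<alpha>)^1 * (\<alpha> - 9/25)^1)) * qform matAP1 ?us
       + (1/3136 * ((1/2 - \<alpha>)^0 * (\<alpha> - 9/25)^2)) * qform matAP2 ?us)"
    unfolding matAP0_def matAP1_def matAP2_def memory_form_lincomb qform7 pairs7_def
    using assms by (intro lincomb_eq_Cons lincomb_eq_Nil; simp add: field_simps power2_eq_square)
  then show ?thesis
    by (rule nonpos_if_neg_combination)
      (use assms qform_nonneg[OF psd_AP0, of ?us] qform_nonneg[OF psd_AP1, of ?us] qform_nonneg[OF psd_AP2, of ?us] in \<open>auto simp: qform_nonneg matAP0_def matAP1_def matAP2_def\<close>)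
qed

section \<open>Adding up the constants\<close>

text \<open>The total is affine in \<open>N\<close>, and the two smallness conditions bound \<open>N\<close> between \<open>3/(2\<alpha>)\<close> and \<open>1/\<alpha>\<^sup>2\<close>; it
  is enough to check both ends.\<close>

lemma budget:
  fixes \<alpha> \<beta> N c :: real
  assumes "0 < \<alpha>" "N * \<alpha>\<^sup>2 \<le> 1" "3/2 \<le> N * \<alpha>" 
    and "(\<beta> - 1) + c * \<alpha>\<^sup>2 \<le> 0" "(\<beta> - 1) * (3/2) + c * \<alpha> \<le> 0"
  shows "(\<beta> - 1) * N + c \<le> 0"
proof (cases "1 \<le> \<beta>")
  case True
  then have "(\<beta> - 1) * (N * \<alpha>\<^sup>2) \<le> (\<beta> - 1) * 1" using assms by (intro mult_left_mono) auto
  note le = this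
  have "((\<beta> - 1) * N + c) * \<alpha>\<^sup>2 = (\<beta> - 1) * (N * \<alpha>\<^sup>2) + c * \<alpha>\<^sup>2" by (simp add: algebra_simps)
  also have "\<dots> \<le> (\<beta> - 1) * 1 + c * \<alpha>\<^sup>2" using le by (rule add_right_mono)
  also have "\<dots> \<le> 0" using assms(4) by simp
  finally have "((\<beta> - 1) * N + c) * \<alpha>\<^sup>2 \<le> 0" .
  then show ?thesis using assms by (simp add: mult_le_0_iff)
next
  case False
  then have "(\<beta> - 1) * (N * \<alpha>) \<le> (\<beta> - 1) * (3/2)" using assms by (intro mult_left_mono_neg) auto
  note le = this
  have "((\<beta> - 1) * N + c) * \<alpha> = (\<beta> - 1) * (N * \<alpha>) + c * \<alpha>" by (simp add: algebra_simps)
  also have "\<dots> \<le> (\<beta> - 1) * (3/2) + c * \<alpha>" using le by (rule add_right_mono)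
  also have "\<dots> \<le> 0" using assms(5) by simp
  finally have "((\<beta> - 1) * N + c) * \<alpha> \<le> 0" .
  then show ?thesis using assms by (simp add: mult_le_0_iff)
qed

lemma interior_E:
  assumes "0 < \<alpha>" "\<alpha> \<le> 3/25" "\<forall>y\<in>D. m \<le> g y + r y"
  shows "interior_step g r D L m \<alpha> (2499/10000) (138/625) (699/5000) (1467/20000) (9677/10000 + 5767/40000 * \<alpha>)"
  by (rule interior_stepI[where ?k1.0 = "(12371/20000 + (-6989/20000) * \<alpha>)" and ?k2.0 = "(2037/20000 + (-211/800) * \<alpha>)" and ?k3.0 = "(699/2500 + 5501/10000 * \<alpha>)" and ?k4.0 = "(1047/20000 + (-349/800) * \<alpha>)" and ?b1.0 = "(1209/4000 + (-3661/10000) * \<alpha>)" and ?b2.0 = "(8363/20000 + 989/20000 * \<alpha>)" and ?c2.0 = "(1089/4000 + 11787/20000 * \<alpha>)" and ?d1.0 = "(147/20000 + (-49/800) * \<alpha>)" and ?d2.0 = "(0)" and og = "(2791/4000 + 7463/20000 * \<alpha>)" and ?o4.0 = "(7571/20000 + (-7571/2400) * \<alpha>)" and mg = "(3779/4000 + (-184067/60000) * \<alpha>)" and mr = "(16081/20000 + (-208247/60000) * \<alpha>)" and ?f5.0 = "(1/10 * \<alpha>)" and ?f6.0 = "(511/2500 * \<alpha>)" and lv = "(669/2500 + (-1031/1200) * \<alpha>)" and lh = "(1141/20000 + (-1/20) * \<alpha>)" and lg = "(5657/20000 + 727/600 * \<alpha>)" and ?A2.0 = "(1801/2500 + (-6333/20000)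 * \<alpha>)", OF assms(3) _ _ _ _ _ _ _ _ _ _ _ _ _ _ _ _ _ _ _ _ _ _ _ _ _ _ _ _ form_EI[OF assms(1,2)]])
     (use assms(1,2) in \<open>linarith | simp add: field_simps\<close>)+

lemma final_E:
  assumes "0 < \<alpha>" "\<alpha> \<le> 3/25" "\<forall>y\<in>D. m \<le> g y + r y"
  shows "final_step g r D L m \<alpha> (2499/10000) (138/625) (699/5000) (1467/20000) (1/2) (9273/10000)"
  by (rule final_stepI[where ?k1.0 = "(1977/4000)" and ?k2.0 = "(311/2500)" and ?k3.0 = "(817/2500)" and ?k4.0 = "(13901/20000)" and ?b1.0 = "(1999/20000)" and ?b2.0 = "(8001/20000)" and ?c2.0 = "(1073/4000)" and ?d1.0 = "(1/10000)" and ?d2.0 = "(399/625)" and og = "(1/2000)" and ?o4.0 = "(1021/2500)" and mg = "(519/2500)" and mr = "(3/5000)" and ?f5.0 = "(2801/20000)" and ?f6.0 = "(59/2000)" and lv = "(5003/20000)" and lh = "(2003/20000)" and lg = "(327/1000)", OF assms(3) _ _ _ _ _ _ _ _ _ _ _ _ _ _ _ _ _ _ _ _ _ _ _ _ _ _ _ form_EP[OF assms(1,2)]])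
     (use assms(1,2) in \<open>linarith | simp add: field_simps\<close>)+

lemma initial_E:
  assumes "0 < \<alpha>" "\<alpha> \<le> 3/25"
  shows "initial_step g r D L m \<alpha> (2499/10000) (138/625) (699/5000) (1467/20000) ((18679/20000 + (-6333/40000) * \<alpha>) + 647/5000 / \<alpha>)"
  by (rule initial_stepI[where ?k1.0 = "(9121/20000)" and ?k0.0 = "(0)" and ?A2.0 = "(1801/2500 + (-6333/20000) * \<alpha>)" and lv = "((0) + 2431/20000 / \<alpha>)" and lh = "((459/800) + 157/20000 / \<alpha>)", OF _ _ _ _ _ _ _ _ _ form_ES[OF assms]])
     (use assms in \<open>auto simp: field_simps\<close>)

lemma interior_D:
  assumes "3/25 \<le> \<alpha>" "\<alpha> \<le> 27/100" "\<forall>y\<in>D. m \<le> g y + r y"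
  shows "interior_step g r D L m \<alpha> (3439/10000) (2843/20000) (1617/20000) (2271/20000) (23493/25000 + 43739/120000 * \<alpha>)"
  by (rule interior_stepI[where ?k1.0 = "(33867/50000 + (-167/375) * \<alpha>)" and ?k2.0 = "(15821/100000 + (-299/3000) * \<alpha>)" and ?k3.0 = "(9147/50000 + 67/250 * \<alpha>)" and ?k4.0 = "(6237/50000 + (-169/750) * \<alpha>)" and ?b1.0 = "(11689/25000 + (-97/1500) * \<alpha>)" and ?b2.0 = "(18537/50000 + (-2861/60000) * \<alpha>)" and ?c2.0 = "(512/3125 + 8207/20000 * \<alpha>)" and ?d1.0 = "(0)" and ?d2.0 = "(0)" and og = "(10997/20000 + (-31/600) * \<alpha>)" and ?o4.0 = "(11691/50000 + (-433/500) * \<alpha>)" and mg = "(39321/50000 + (-543/500) * \<alpha>)" and mr = "(42719/100000 + (-22887/20000) * \<alpha>)" and ?f5.0 = "(602/3125 + (-551/3000) * \<alpha>)" and ?f6.0 = "((-1527/100000) + 1243/3000 * \<alpha>)" and lv = "(6969/25000 + (-289/500) * \<alpha>)" and lh = "(3347/25000 + 13/500 * \<alpha>)" and lg = "(10793/100000 + 1459/1500 * \<alpha>)" and ?A2.0 = "(8383/10000 + (-2247/20000) * \<alpha>)", OF assms(3) _ _ _ _ _ _ _ _ _ _ _ _ _ _ _ _ _ _ _ _ _ _ _ _ _ _ _ _ form_DI[OF assms(1,2)]])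
     (use assms(1,2) in \<open>linarith | simp add: field_simps\<close>)+

lemma final_D:
  assumes "3/25 \<le> \<alpha>" "\<alpha> \<le> 27/100" "\<forall>y\<in>D. m \<le> g y + r y"
  shows "final_step g r D L m \<alpha> (3439/10000) (2843/20000) (1617/20000) (2271/20000) (1521/40000 + 161/100 * \<alpha>) (7373/80000 + 329/120 * \<alpha>)"
  by (rule final_stepI[where ?k1.0 = "(5737/100000 + 1359/1000 * \<alpha>)" and ?k2.0 = "(97/5000 + 113/200 * \<alpha>)" and ?k3.0 = "(421/20000 + 353/600 * \<alpha>)" and ?k4.0 = "((-21627/100000) + 3389/1500 * \<alpha>)" and ?b1.0 = "(841/50000 + 1807/3000 * \<alpha>)" and ?b2.0 = "(4241/200000 + 3023/3000 * \<alpha>)" and ?c2.0 = "((-10231/200000) + 323/750 * \<alpha>)" and ?d1.0 = "((-514/3125) + 514/375 * \<alpha>)" and ?d2.0 = "((-1911/20000) + 367/200 * \<alpha>)" and og = "((-2981/100000) + 253/1000 * \<alpha>)" and ?o4.0 = "((-7321/50000) + 3673/3000 * \<alpha>)" and mg = "(6361/50000 + 81/250 * \<alpha>)" and mr = "((-2443/40000) + 77/150 * \<alpha>)" and ?f5.0 = "((-8/125) + 8/15 * \<alpha>)" and ?f6.0 = "((-6907/100000) + 721/1000 * \<alpha>)" and lv = "((-7693/100000) + 1741/1500 * \<alpha>)" and lh = "(12029/100000 + 659/3000 * \<alpha>)" and lg = "(2979/100000 + 1669/3000 * \<alpha>)", OF assms(3) _ _ _ _ _ _ _ _ _ _ _ _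 _ _ _ _ _ _ _ _ _ _ _ _ _ _ _ form_DP[OF assms(1,2)]])
     (use assms(1,2) in \<open>linarith | simp add: field_simps\<close>)+

lemma initial_D:
  assumes "3/25 \<le> \<alpha>" "\<alpha> \<le> 27/100"
  shows "initial_step g r D L m \<alpha> (3439/10000) (2843/20000) (1617/20000) (2271/20000) (291523/100000 + (-417821/120000) * \<alpha>)"
  by (rule initial_stepI[where ?k1.0 = "(52213/100000 + (-523/750) * \<alpha>)" and ?k0.0 = "(0)" and ?A2.0 = "(8383/10000 + (-2247/20000) * \<alpha>)" and lv = "(1417/625 + (-256/75) * \<alpha>)" and lh = "(2861/12500 + (-37/3000) * \<alpha>)", OF _ _ _ _ _ _ _ _ _ form_DS[OF assms]])
     (use assms in \<open>linarith | simp add: field_simps\<close>)+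

lemma budget_D:
  fixes N :: real
  assumes "3/25 \<le> \<alpha>" "\<alpha> \<le> 27/100" "N * \<alpha>\<^sup>2 \<le> 1" "3/2 \<le> N * \<alpha>"
  shows "(291523/100000 + (-417821/120000) * \<alpha>) + (N - 4) * (23493/25000 + 43739/120000 * \<alpha>) + (7373/80000 + 329/120 * \<alpha>) + 2 * \<alpha> \<le> N"
proof -
  have "((23493/25000 + 43739/120000 * \<alpha>) - 1) + ((-60119/80000) + (-23777/120000) * \<alpha>) * \<alpha>\<^sup>2 = - (34631011/4218750 * ((27/100 - \<alpha>)^3 * (\<alpha> - 3/25)^0) + 141945461/8437500 * ((27/100 - \<alpha>)^2 * (\<alpha> - 3/25)^1) + 979107173/67500000 * ((27/100 - \<alpha>)^1 * (\<alpha> - 3/25)^2) + 822028447/135000000 * ((27/100 - \<alpha>)^0 * (\<alpha> - 3/25)^3))" by (simp add: field_simps power2_eq_square power3_eq_cube)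
  moreover have "((23493/25000 + 43739/120000 * \<alpha>) - 1) * (3/2) + ((-60119/80000) + (-23777/120000) * \<alpha>) * \<alpha> = - (982027/187500 * ((27/100 - \<alpha>)^2 * (\<alpha> - 3/25)^0) + 1139717/93750 * ((27/100 - \<alpha>)^1 * (\<alpha> - 3/25)^1) + 21352937/3000000 * ((27/100 - \<alpha>)^0 * (\<alpha> - 3/25)^2))" by (simp add: field_simps power2_eq_square power3_eq_cube)
  moreover have "0 \<le> \<alpha> - 3/25" "0 \<le> 27/100 - \<alpha>" using assms by auto
  ultimately have "((23493/25000 + 43739/120000 * \<alpha>) - 1) + ((-60119/80000) + (-23777/120000) * \<alpha>) * \<alpha>\<^sup>2 \<le> 0" "((23493/25000 + 43739/120000 * \<alpha>) - 1) * (3/2) + ((-60119/80000) + (-23777/120000) * \<alpha>) * \<alpha> \<le> 0"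
    by (simp_all only: neg_le_0_iff_le) (intro add_nonneg_nonneg mult_nonneg_nonneg zero_le_power; simp)+
  from budget[OF _ assms(3,4) this] assms show ?thesis by (simp add: algebra_simps add_divide_distrib diff_divide_distrib)
qed

lemma interior_C:
  assumes "27/100 \<le> \<alpha>" "\<alpha> \<le> 9/25" "\<forall>y\<in>D. m \<le> g y + r y"
  shows "interior_step g r D L m \<alpha> (5439/20000) (3261/20000) (1599/20000) (1659/20000) (2289/2500 + 37517/48000 * \<alpha>)"
  by (rule interior_stepI[where ?k1.0 = "(2689/4000 + (-11/24) * \<alpha>)" and ?k2.0 = "(623/4000 + (-32/225) * \<alpha>)" and ?k3.0 = "(4397/20000 + 119/1800 * \<alpha>)" and ?k4.0 = "(2357/10000 + (-137/300) * \<alpha>)" and ?b1.0 = "(2413/5000 + (-19/600) * \<alpha>)" and ?b2.0 = "(143/400 + (-3803/24000) * \<alpha>)" and ?c2.0 = "(3301/20000 + 28969/72000 * \<alpha>)" and ?d1.0 = "(0)" and ?d2.0 = "(0)" and og = "(2701/5000 + (-7/90) * \<alpha>)" and ?o4.0 = "(3387/5000 + (-1129/600) * \<alpha>)" and mg = "(22279/20000 + (-113/60) * \<alpha>)" and mr = "(4123/20000 + (-24329/72000) * \<alpha>)" and ?f5.0 = "(529/625 + (-3643/1800) * \<alpha>)" and ?f6.0 = "((-353/20000) + 193/600 * \<alpha>)" and lv = "(5283/20000 + (-43/100) * \<alpha>)" and lh = "(951/5000 + 437/1800 * \<alpha>)" and lg = "(103/2500 + 383/360 * \<alpha>)" and ?A2.0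 = "(8401/10000 + (-1521/8000) * \<alpha>)", OF assms(3) _ _ _ _ _ _ _ _ _ _ _ _ _ _ _ _ _ _ _ _ _ _ _ _ _ _ _ _ form_CI[OF assms(1,2)]])
     (use assms(1,2) in \<open>linarith | simp add: field_simps\<close>)+

lemma final_C:
  assumes "27/100 \<le> \<alpha>" "\<alpha> \<le> 9/25" "\<forall>y\<in>D. m \<le> g y + r y"
  shows "final_step g r D L m \<alpha> (5439/20000) (3261/20000) (1599/20000) (1659/20000) (3969/40000 + 137/100 * \<alpha>) (9293/80000 + 4931/1800 * \<alpha>)"
  by (rule final_stepI[where ?k1.0 = "(2113/20000 + 923/900 * \<alpha>)" and ?k2.0 = "(2709/20000 + 1/600 * \<alpha>)" and ?k3.0 = "((-2903/10000) + 263/200 * \<alpha>)" and ?k4.0 = "((-741/5000) + 3059/1800 * \<alpha>)" and ?b1.0 = "(1229/4000 + 4/75 * \<alpha>)" and ?b2.0 = "((-8321/40000) + 79/60 * \<alpha>)" and ?c2.0 = "((-13141/40000) + 1097/900 * \<alpha>)" and ?d1.0 = "(8843/20000 + (-683/600) * \<alpha>)" and ?d2.0 = "(147/1000 + 22/45 * \<alpha>)" and og = "((-3459/20000) + 1157/1800 * \<alpha>)" and ?o4.0 = "((-3107/20000) + 26/45 * \<alpha>)" and mg = "(197/2000 + (-173/1800) * \<alpha>)" and mr = "(1/1600)" and ?f5.0 = "((-1/2500) + 1/600 * \<alpha>)" and ?f6.0 = "((-1369/20000) + 239/900 * \<alpha>)" and lv = "(987/20000 + 247/360 * \<alpha>)"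 and lh = "(6141/20000 + 49/900 * \<alpha>)" and lg = "((-5797/20000) + 473/360 * \<alpha>)", OF assms(3) _ _ _ _ _ _ _ _ _ _ _ _ _ _ _ _ _ _ _ _ _ _ _ _ _ _ _ form_CP[OF assms(1,2)]])
     (use assms(1,2) in \<open>linarith | simp add: field_simps\<close>)+

lemma initial_C:
  assumes "27/100 \<le> \<alpha>" "\<alpha> \<le> 9/25"
  shows "initial_step g r D L m \<alpha> (5439/20000) (3261/20000) (1599/20000) (1659/20000) (20893/20000 + 49997/48000 * \<alpha>)"
  by (rule initial_stepI[where ?k1.0 = "(821/1250 + (-1651/1800) * \<alpha>)" and ?k0.0 = "(0)" and ?A2.0 = "(8401/10000 + (-1521/8000) * \<alpha>)" and lv = "(3481/20000 + 356/225 * \<alpha>)" and lh = "(9011/20000 + (-401/900) * \<alpha>)", OF _ _ _ _ _ _ _ _ _ form_CS[OF assms]])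
     (use assms in \<open>linarith | simp add: field_simps\<close>)+

lemma budget_C:
  fixes N :: real
  assumes "27/100 \<le> \<alpha>" "\<alpha> \<le> 9/25" "N * \<alpha>\<^sup>2 \<le> 1" "3/2 \<le> N * \<alpha>"
  shows "(20893/20000 + 49997/48000 * \<alpha>) + (N - 4) * (2289/2500 + 37517/48000 * \<alpha>) + (9293/80000 + 4931/1800 * \<alpha>) + 2 * \<alpha> \<le> N"
proof -
  have "((2289/2500 + 37517/48000 * \<alpha>) - 1) + ((-200127/80000) + 382267/144000 * \<alpha>) * \<alpha>\<^sup>2 = - (55703731/11664000 * ((9/25 - \<alpha>)^3 * (\<alpha> - 27/100)^0) + 6284071/486000 * ((9/25 - \<alpha>)^2 * (\<alpha> - 27/100)^1) + 625199/40500 * ((9/25 - \<alpha>)^1 * (\<alpha> - 27/100)^2) + 843433/182250 * ((9/25 - \<alpha>)^0 * (\<alpha> - 27/100)^3))" by (simp add: field_simps power2_eq_square power3_eq_cube)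
  moreover have "((2289/2500 + 37517/48000 * \<alpha>) - 1) * (3/2) + ((-200127/80000) + 382267/144000 * \<alpha>) * \<alpha> = - (15571001/432000 * ((9/25 - \<alpha>)^2 * (\<alpha> - 27/100)^0) + 15320633/216000 * ((9/25 - \<alpha>)^1 * (\<alpha> - 27/100)^1) + 1740433/54000 * ((9/25 - \<alpha>)^0 * (\<alpha> - 27/100)^2))" by (simp add: field_simps power2_eq_square power3_eq_cube)
  moreover have "0 \<le> \<alpha> - 27/100" "0 \<le> 9/25 - \<alpha>" using assms by auto
  ultimately have "((2289/2500 + 37517/48000 * \<alpha>) - 1) + ((-200127/80000) + 382267/144000 * \<alpha>) * \<alpha>\<^sup>2 \<le> 0" "((2289/2500 + 37517/48000 * \<alpha>) - 1) * (3/2) + ((-200127/80000) + 382267/144000 * \<alpha>) * \<alpha> \<le> 0"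
    by (simp_all only: neg_le_0_iff_le) (intro add_nonneg_nonneg mult_nonneg_nonneg zero_le_power; simp)+
  from budget[OF _ assms(3,4) this] assms show ?thesis by (simp add: algebra_simps add_divide_distrib diff_divide_distrib)
qed

lemma interior_A:
  assumes "9/25 \<le> \<alpha>" "\<alpha> \<le> 1/2" "\<forall>y\<in>D. m \<le> g y + r y"
  shows "interior_step g r D L m \<alpha> (959/4000) (219/1250) (1559/20000) (1123/20000) (4257/5000 + 91179/80000 * \<alpha>)"
  by (rule interior_stepI[where ?k1.0 = "(3459/5000 + (-1/2) * \<alpha>)" and ?k2.0 = "(19469/140000 + (-431/2800) * \<alpha>)" and ?k3.0 = "(34901/140000 + (-9/140) * \<alpha>)" and ?k4.0 = "(3587/14000 + (-57/112) * \<alpha>)" and ?b1.0 = "(1423/2800 + (-13/280) * \<alpha>)" and ?b2.0 = "(2939/8750 + (-51547/280000) * \<alpha>)" and ?c2.0 = "(23263/140000 + 105447/280000 * \<alpha>)" and ?d1.0 = "((-99/14000) + 11/560 * \<alpha>)" and ?d2.0 = "((-27/14000) + 3/560 * \<alpha>)" and og = "(81787/140000 + (-293/1400) * \<alpha>)" and ?o4.0 = "((-63/5000) + 7/200 * \<alpha>)" and mg = "(29609/70000 + 123/2800 * \<alpha>)" and mr = "(37491/140000 + (-128047/280000) * \<alpha>)" and ?f5.0 = "(19269/140000 + (-131/1400) * \<alpha>)" and ?f6.0 = "((-611/7000) + 233/560 * \<alpha>)" and lv = "(29023/140000 + (-751/2800) * \<alpha>)" and lh = "(5583/35000 + 419/700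 * \<alpha>)" and lg = "(4377/70000 + 2589/2800 * \<alpha>)" and ?A2.0 = "(8441/10000 + (-9221/40000) * \<alpha>)", OF assms(3) _ _ _ _ _ _ _ _ _ _ _ _ _ _ _ _ _ _ _ _ _ _ _ _ _ _ _ _ form_AI[OF assms(1,2)]])
     (use assms(1,2) in \<open>linarith | simp add: field_simps\<close>)+

lemma final_A:
  assumes "9/25 \<le> \<alpha>" "\<alpha> \<le> 1/2" "\<forall>y\<in>D. m \<le> g y + r y"
  shows "final_step g r D L m \<alpha> (959/4000) (219/1250) (1559/20000) (1123/20000) (1849/10000 + 57/50 * \<alpha>) (459/2800 + 472/175 * \<alpha>)"
  by (rule final_stepI[where ?k1.0 = "(27049/70000 + 139/700 * \<alpha>)" and ?k2.0 = "(3183/28000 + 3/175 * \<alpha>)" and ?k3.0 = "(316/4375 + 83/350 * \<alpha>)" and ?k4.0 = "(2773/3500 + (-1419/1400) * \<alpha>)" and ?b1.0 = "((-863/20000) + 59/50 * \<alpha>)" and ?b2.0 = "(4561/20000 + (-1/25) * \<alpha>)" and ?c2.0 = "((-997/3500) + 781/700 * \<alpha>)" and ?d1.0 = "(753/2800 + (-753/1400) * \<alpha>)" and ?d2.0 = "(73397/140000 + (-1789/2800) * \<alpha>)" and og = "((-1609/3500) + 2053/1400 * \<alpha>)" and ?o4.0 = "(163/280 + (-163/140) * \<alpha>)" and mg = "(12339/70000 + 67/1400 * \<alpha>)" and mr = "(507/4000 + (-101/400) * \<alpha>)" and ?f5.0 = "(1571/5600 + (-1571/2800) * \<alpha>)"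 and ?f6.0 = "(1033/7000 + (-811/2800) * \<alpha>)" and lv = "(1941/5600 + (-19/140) * \<alpha>)" and lh = "((-271/1750) + 2087/1400 * \<alpha>)" and lg = "((-8419/70000) + 1081/1400 * \<alpha>)", OF assms(3) _ _ _ _ _ _ _ _ _ _ _ _ _ _ _ _ _ _ _ _ _ _ _ _ _ _ _ form_AP[OF assms(1,2)]])
     (use assms(1,2) in \<open>linarith | simp add: field_simps\<close>)+

lemma initial_A:
  assumes "9/25 \<le> \<alpha>" "\<alpha> \<le> 1/2"
  shows "initial_step g r D L m \<alpha> (959/4000) (219/1250) (1559/20000) (1123/20000) (4821/17500 + 1334853/560000 * \<alpha>)"
  by (rule initial_stepI[where ?k1.0 = "(109029/140000 + (-1551/1400) * \<alpha>)" and ?k0.0 = "(0)" and ?A2.0 = "(8441/10000 + (-9221/40000) * \<alpha>)" and lv = "((-27303/35000) + 219/70 * \<alpha>)" and lh = "(88693/140000 + (-1763/2800) * \<alpha>)", OF _ _ _ _ _ _ _ _ _ form_AS[OF assms]])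
     (use assms in \<open>linarith | simp add: field_simps\<close>)+

lemma budget_A:
  fixes N :: real
  assumes "9/25 \<le> \<alpha>" "\<alpha> \<le> 1/2" "N * \<alpha>\<^sup>2 \<le> 1" "3/2 \<le> N * \<alpha>"
  shows "(4821/17500 + 1334853/560000 * \<alpha>) + (N - 4) * (4257/5000 + 91179/80000 * \<alpha>) + (459/2800 + 472/175 * \<alpha>) + 2 * \<alpha> \<le> N"
proof -
  have "((4257/5000 + 91179/80000 * \<alpha>) - 1) + ((-207633/70000) + 1412241/560000 * \<alpha>) * \<alpha>\<^sup>2 = - (3157699/1715000 * ((1/2 - \<alpha>)^3 * (\<alpha> - 9/25)^0) + 86577/13720 * ((1/2 - \<alpha>)^2 * (\<alpha> - 9/25)^1) + 193827/21952 * ((1/2 - \<alpha>)^1 * (\<alpha> - 9/25)^2) + 80725/43904 * ((1/2 - \<alpha>)^0 * (\<alpha> - 9/25)^3))" by (simp add: field_simps power2_eq_square power3_eq_cube)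
  moreover have "((4257/5000 + 91179/80000 * \<alpha>) - 1) * (3/2) + ((-207633/70000) + 1412241/560000 * \<alpha>) * \<alpha> = - (34843569/1960000 * ((1/2 - \<alpha>)^2 * (\<alpha> - 9/25)^0) + 706959/22400 * ((1/2 - \<alpha>)^1 * (\<alpha> - 9/25)^1) + 8829/784 * ((1/2 - \<alpha>)^0 * (\<alpha> - 9/25)^2))" by (simp add: field_simps power2_eq_square power3_eq_cube)
  moreover have "0 \<le> \<alpha> - 9/25" "0 \<le> 1/2 - \<alpha>" using assms by auto
  ultimately have "((4257/5000 + 91179/80000 * \<alpha>) - 1) + ((-207633/70000) + 1412241/560000 * \<alpha>) * \<alpha>\<^sup>2 \<le> 0" "((4257/5000 + 91179/80000 * \<alpha>) - 1) * (3/2) + ((-207633/70000) + 1412241/560000 * \<alpha>) * \<alpha> \<le> 0"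
    by (simp_all only: neg_le_0_iff_le) (intro add_nonneg_nonneg mult_nonneg_nonneg zero_le_power; simp)+
  from budget[OF _ assms(3,4) this] assms show ?thesis by (simp add: algebra_simps add_divide_distrib diff_divide_distrib)
qed

definition schedule where
  "schedule g r D L m \<alpha> N cg ce cp cr \<beta> s p a k w n \<longleftrightarrow> N = Suc (Suc n) + k \<and>
     interior_step g r D L m \<alpha> cg ce cp cr \<beta> \<and> initial_step g r D L m \<alpha> cg ce cp cr s \<and>
     final_step g r D L m \<alpha> cg ce cp cr a p \<and>
     w (0::nat) = (0::real) \<and> (\<forall>j<k. w j + (1 - w j) * \<alpha> \<le> w (Suc j) \<and> 0 \<le> w j \<and> w j \<le> 1) \<and> w k \<le> a \<and>
     s + real n * \<beta> + p + 2 * (\<Sum>j<k. w j) \<le> N"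

text \<open>The weight of the last plain steps, \<open>2\<alpha> - \<alpha>\<^sup>2\<close>, is replaced by a tangent so that it is affine in the stepsize.\<close>

lemma schedule_D:
  assumes "3/25 \<le> \<alpha>" "\<alpha> \<le> 27/100" "\<forall>y\<in>D. m \<le> g y + r y"
    and N: "4 \<le> N" "real N * \<alpha>\<^sup>2 \<le> 1" "3/2 \<le> real N * \<alpha>"
  shows "schedule g r D L m \<alpha> N (3439/10000) (2843/20000) (1617/20000) (2271/20000) (23493/25000 + 43739/120000 * \<alpha>) (291523/100000 + (-417821/120000) * \<alpha>) (7373/80000 + 329/120 * \<alpha>) (1521/40000 + 161/100 * \<alpha>) 2 (\<lambda>j. 1 - (1 - \<alpha>)^j) (N - 4)"
proof -
  have "1 - (1 - \<alpha>)^2 = (1521/40000 + 161/100 * \<alpha>) - (\<alpha> - (39/200))^2" by (simp add: field_simps power2_eq_square)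
  also have "\<dots> \<le> (1521/40000 + 161/100 * \<alpha>)" by simp
  finally have a: "1 - (1 - \<alpha>)\<^sup>2 \<le> (1521/40000 + 161/100 * \<alpha>)" .
  have "(1 - \<alpha>)^j \<le> 1" "0 \<le> (1 - \<alpha>)^j" for j using assms by (simp_all add: power_le_one)
  moreover have "(1 - (1 - \<alpha>)^j) + (1 - (1 - (1 - \<alpha>)^j)) * \<alpha> \<le> 1 - (1 - \<alpha>)^Suc j" for j
    by (simp add: algebra_simps)
  moreover have "(\<Sum>j<2. 1 - (1 - \<alpha>)^j) = \<alpha>" by (simp add: numeral_2_eq_2)
  ultimately have w: "\<forall>j<2. 1 - (1 - \<alpha>)^j + (1 - (1 - (1 - \<alpha>)^j)) * \<alpha> \<le> 1 - (1 - \<alpha>)^Suc j \<and> 0 \<le> 1 - (1 - \<alpha>)^j \<and> 1 - (1 - \<alpha>)^j \<le> 1"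
    and sum: "(\<Sum>j<2. 1 - (1 - \<alpha>)^j) = \<alpha>" by auto
  have n: "N = Suc (Suc (N - 4)) + 2" "real (N - 4) = real N - 4" using N(1) by auto
  show ?thesis
    unfolding schedule_def sum n(2)
    by (intro conjI n(1) w a interior_D[OF assms(1-3)] final_D[OF assms(1-3)] initial_D[OF assms(1,2)] budget_D[OF assms(1,2) N(2,3)]) simp
qed

lemma schedule_C:
  assumes "27/100 \<le> \<alpha>" "\<alpha> \<le> 9/25" "\<forall>y\<in>D. m \<le> g y + r y"
    and N: "4 \<le> N" "real N * \<alpha>\<^sup>2 \<le> 1" "3/2 \<le> real N * \<alpha>"
  shows "schedule g r D L m \<alpha> N (5439/20000) (3261/20000) (1599/20000) (1659/20000) (2289/2500 + 37517/48000 * \<alpha>) (20893/20000 + 49997/48000 * \<alpha>) (9293/80000 + 4931/1800 * \<alpha>) (3969/40000 + 137/100 * \<alpha>) 2 (\<lambda>j. 1 - (1 - \<alpha>)^j) (N - 4)"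
proof -
  have "1 - (1 - \<alpha>)^2 = (3969/40000 + 137/100 * \<alpha>) - (\<alpha> - (63/200))^2" by (simp add: field_simps power2_eq_square)
  also have "\<dots> \<le> (3969/40000 + 137/100 * \<alpha>)" by simp
  finally have a: "1 - (1 - \<alpha>)\<^sup>2 \<le> (3969/40000 + 137/100 * \<alpha>)" .
  have "(1 - \<alpha>)^j \<le> 1" "0 \<le> (1 - \<alpha>)^j" for j using assms by (simp_all add: power_le_one)
  moreover have "(1 - (1 - \<alpha>)^j) + (1 - (1 - (1 - \<alpha>)^j)) * \<alpha> \<le> 1 - (1 - \<alpha>)^Suc j" for j
    by (simp add: algebra_simps)
  moreover have "(\<Sum>j<2. 1 - (1 - \<alpha>)^j) = \<alpha>" by (simp add: numeral_2_eq_2)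
  ultimately have w: "\<forall>j<2. 1 - (1 - \<alpha>)^j + (1 - (1 - (1 - \<alpha>)^j)) * \<alpha> \<le> 1 - (1 - \<alpha>)^Suc j \<and> 0 \<le> 1 - (1 - \<alpha>)^j \<and> 1 - (1 - \<alpha>)^j \<le> 1"
    and sum: "(\<Sum>j<2. 1 - (1 - \<alpha>)^j) = \<alpha>" by auto
  have n: "N = Suc (Suc (N - 4)) + 2" "real (N - 4) = real N - 4" using N(1) by auto
  show ?thesis
    unfolding schedule_def sum n(2)
    by (intro conjI n(1) w a interior_C[OF assms(1-3)] final_C[OF assms(1-3)] initial_C[OF assms(1,2)] budget_C[OF assms(1,2) N(2,3)]) simp
qed

lemma schedule_A:
  assumes "9/25 \<le> \<alpha>" "\<alpha> \<le> 1/2" "\<forall>y\<in>D. m \<le> g y + r y"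
    and N: "4 \<le> N" "real N * \<alpha>\<^sup>2 \<le> 1" "3/2 \<le> real N * \<alpha>"
  shows "schedule g r D L m \<alpha> N (959/4000) (219/1250) (1559/20000) (1123/20000) (4257/5000 + 91179/80000 * \<alpha>) (4821/17500 + 1334853/560000 * \<alpha>) (459/2800 + 472/175 * \<alpha>) (1849/10000 + 57/50 * \<alpha>) 2 (\<lambda>j. 1 - (1 - \<alpha>)^j) (N - 4)"
proof -
  have "1 - (1 - \<alpha>)^2 = (1849/10000 + 57/50 * \<alpha>) - (\<alpha> - (43/100))^2" by (simp add: field_simps power2_eq_square)
  also have "\<dots> \<le> (1849/10000 + 57/50 * \<alpha>)" by simp
  finally have a: "1 - (1 - \<alpha>)\<^sup>2 \<le> (1849/10000 + 57/50 * \<alpha>)" .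
  have "(1 - \<alpha>)^j \<le> 1" "0 \<le> (1 - \<alpha>)^j" for j using assms by (simp_all add: power_le_one)
  moreover have "(1 - (1 - \<alpha>)^j) + (1 - (1 - (1 - \<alpha>)^j)) * \<alpha> \<le> 1 - (1 - \<alpha>)^Suc j" for j
    by (simp add: algebra_simps)
  moreover have "(\<Sum>j<2. 1 - (1 - \<alpha>)^j) = \<alpha>" by (simp add: numeral_2_eq_2)
  ultimately have w: "\<forall>j<2. 1 - (1 - \<alpha>)^j + (1 - (1 - (1 - \<alpha>)^j)) * \<alpha> \<le> 1 - (1 - \<alpha>)^Suc j \<and> 0 \<le> 1 - (1 - \<alpha>)^j \<and> 1 - (1 - \<alpha>)^j \<le> 1"
    and sum: "(\<Sum>j<2. 1 - (1 - \<alpha>)^j) = \<alpha>" by auto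
  have n: "N = Suc (Suc (N - 4)) + 2" "real (N - 4) = real N - 4" using N(1) by auto
  show ?thesis
    unfolding schedule_def sum n(2)
    by (intro conjI n(1) w a interior_A[OF assms(1-3)] final_A[OF assms(1-3)] initial_A[OF assms(1,2)] budget_A[OF assms(1,2) N(2,3)]) simp
qed

text \<open>For small stepsizes about \<open>1/(2\<alpha>)\<close> plain steps are taken at the end. Their cost is half of what the same number of
  interior steps would cost, and this saving of order \<open>1/\<alpha>\<close> pays for the initial step.\<close>

lemma schedule_E:
  assumes "0 < \<alpha>" "\<alpha> \<le> 3/25" "\<forall>y\<in>D. m \<le> g y + r y" and N: "3/2 \<le> real N * \<alpha>"
  shows "\<exists>k n. schedule g r D L m \<alpha> N (2499/10000) (138/625) (699/5000) (1467/20000) (9677/10000 + 5767/40000 * \<alpha>) ((18679/20000 + (-6333/40000) * \<alpha>) + 647/5000 / \<alpha>) (9273/10000) (1/2) k (\<lambda>j. real j * \<alpha>) n"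
proof -
  define k where "k = nat \<lfloor>1 / (2 * \<alpha>)\<rfloor>"
  have "0 \<le> 1 / (2 * \<alpha>)" using assms by simp
  then have "real k = real_of_int \<lfloor>1 / (2 * \<alpha>)\<rfloor>" unfolding k_def by simp
  then have "real k \<le> 1 / (2 * \<alpha>)" "1 / (2 * \<alpha>) < real k + 1" by linarith+
  then have k: "real k * \<alpha> \<le> 1/2" "1/2 < real k * \<alpha> + \<alpha>" using assms by (simp_all add: field_simps)
  have "k + 2 \<le> N"
  proof (rule ccontr)
    assume "\<not> k + 2 \<le> N"
    then have "real N * \<alpha> \<le> (real k + 1) * \<alpha>" using assms by (intro mult_right_mono) auto
    then show False using k assms by (simp add: algebra_simps)
  qed
  then have n: "N = Suc (Suc (N - 2 - k)) + k" "real (N - 2 - k) = real N - 2 - real k" by auto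
  have w: "real j * \<alpha> \<le> 1" "0 \<le> real j * \<alpha>" if "j < k" for j
  proof -
    have "real j * \<alpha> \<le> real k * \<alpha>" using that assms by (intro mult_right_mono) auto
    then show "real j * \<alpha> \<le> 1" using k(1) by linarith
  qed (use assms in simp)
  have w': "real j * \<alpha> + (1 - real j * \<alpha>) * \<alpha> \<le> real (Suc j) * \<alpha>" for j
    using assms by (simp add: algebra_simps)
  have "2 * (\<Sum>j<k. real j) = real k * (real k - 1)"
    by (induction k) (auto simp: algebra_simps)
  then have sum: "2 * (\<Sum>j<k. real j * \<alpha>) = (real k * \<alpha>) * (real k - 1)"
    by (simp add: sum_distrib_right[symmetric] mult.assoc[symmetric])
  define b where "b = (9677/10000 + 5767/40000 * \<alpha>)"
  define u where "u = real N * \<alpha>"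
  define K where "K = real k * \<alpha>"
  have b: "9677/10000 \<le> b" "b \<le> 985001/1000000" unfolding b_def using assms by linarith+
  define sv where "sv = (18679/20000 + - 6333/40000 * \<alpha>) * \<alpha>"
  have p1: "b * u - u \<le> b * (3/2) - 3/2"
    using mult_left_mono_neg[of "3/2" u "b - 1"] b N unfolding u_def by (simp add: algebra_simps)
  have p2: "1/2 * K - b * K \<le> (1/2 - b) * (1/2 - \<alpha>)"
    using mult_left_mono_neg[of "1/2 - \<alpha>" K "1/2 - b"] b k unfolding K_def by (simp add: algebra_simps)
  have p3: "(1/2 - b) * (1/2 - \<alpha>) \<le> - (88863/500000)"
  proof -
    have "(4677/10000) * (38/100) \<le> (b - 1/2) * (1/2 - \<alpha>)" using b assms by (intro mult_mono) auto
    then show ?thesis by (simp add: algebra_simps)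
  qed
  have p4: "9677/10000 * \<alpha> \<le> b * \<alpha>" using b assms by (intro mult_right_mono) auto
  have p5: "K * (K - \<alpha>) \<le> 1/2 * (K - \<alpha>)" using k assms unfolding K_def by (intro mult_right_mono) linarith+
  have p6: "sv \<le> 18679/20000 * \<alpha>" unfolding sv_def using assms by (intro mult_right_mono) auto
  have gen: "647/5000 + sv + W + (9273/10000) * \<alpha> + Q \<le> u"
    if "W = BU - 2 * BA - BK" "BU - u \<le> b * (3/2) - 3/2" "1/2 * K - BK \<le> - (88863/500000)"
      "9677/10000 * \<alpha> \<le> BA" "Q \<le> 1/2 * (K - \<alpha>)" for W BU BA BK Q :: real
  proof -
    have "BU - u \<le> - 449/20000" using that(2) b(2) by simp
    then have "W \<le> (u - 449/20000) - 2 * (9677/10000 * \<alpha>) + (- (88863/500000) - 1/2 * K)"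
      using that(1,3,4) by simp
    moreover have "Q \<le> 1/2 * K - 1/2 * \<alpha>" using that(5) by (simp add: right_diff_distrib)
    ultimately show ?thesis using p6 assms(1) by simp
  qed
  have "b * (u - 2 * \<alpha> - K) = b * u - 2 * (b * \<alpha>) - b * K" by (simp add: algebra_simps)
  from gen[OF this p1 order_trans[OF p2 p3] p4 p5]
  have "647/5000 + sv + b * (u - 2 * \<alpha> - K) + (9273/10000) * \<alpha> + K * (K - \<alpha>) \<le> u" .
  then have "(((18679/20000 + (-6333/40000) * \<alpha>) + 647/5000 / \<alpha>) + (real N - 2 - real k) * b + (9273/10000) + (real k * \<alpha>) * (real k - 1)) * \<alpha> \<le> real N * \<alpha>"
    unfolding u_def K_def sv_def using assms by (simp add: algebra_simps)
  then have "((18679/20000 + (-6333/40000) * \<alpha>) + 647/5000 / \<alpha>) + (real N - 2 - real k) * b + (9273/10000) + (real k * \<alpha>) * (real k - 1) \<le> real N"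
    using assms by (simp add: mult_le_cancel_right)
  then have "schedule g r D L m \<alpha> N (2499/10000) (138/625) (699/5000) (1467/20000) b ((18679/20000 + (-6333/40000) * \<alpha>) + 647/5000 / \<alpha>) (9273/10000) (1/2) k (\<lambda>j. real j * \<alpha>) (N - 2 - k)"
    unfolding schedule_def sum n(2) unfolding b_def
    by (intro conjI n(1) interior_E[OF assms(1-3)] final_E[OF assms(1-3)] initial_E[OF assms(1,2)] k(1)) (use w w' in auto)
  then show ?thesis unfolding b_def by blast
qed

lemma schedule_exists:
  assumes "0 < \<alpha>" "\<forall>y\<in>D. m \<le> g y + r y" and N: "4 \<le> N" "real N * \<alpha>\<^sup>2 \<le> 1" "3/2 \<le> real N * \<alpha>"
  shows "\<exists>cg ce cp cr \<beta> s p a k w n. schedule g r D L m \<alpha> N cg ce cp cr \<beta> s p a k w n"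
proof -
  have "4 * \<alpha>\<^sup>2 \<le> real N * \<alpha>\<^sup>2" using N by (intro mult_right_mono) auto
  then have "\<alpha>\<^sup>2 \<le> (1/2)\<^sup>2" using N by (simp add: power2_eq_square)
  then have "\<alpha> \<le> 1/2" using power2_le_imp_le[of \<alpha> "1/2"] by simp
  then consider "\<alpha> \<le> 3/25" | "3/25 \<le> \<alpha>" "\<alpha> \<le> 27/100" | "27/100 \<le> \<alpha>" "\<alpha> \<le> 9/25" | "9/25 \<le> \<alpha>" "\<alpha> \<le> 1/2" by linarith
  then show ?thesis
  proof cases
    case 1 show ?thesis by (rule exE[OF schedule_E[OF assms(1) 1 assms(2) N(3)]], erule exE) (intro exI)
  next
    case 2 show ?thesis by (intro exI) (rule schedule_D[OF 2 assms(2) N])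
  next
    case 3 show ?thesis by (intro exI) (rule schedule_C[OF 3 assms(2) N])
  next
    case 4 show ?thesis by (intro exI) (rule schedule_A[OF 4 assms(2) N])
  qed
qed

section \<open>Proximal points and the Moreau envelope\<close>

text \<open>An affine minorant is dominated by the quadratic, so the sublevel sets of the regularized function are compact; its
  minimum is found as the lowest point of a compact slice of the epigraph.\<close>

lemma prox_attained:
  fixes f :: "'a::euclidean_space \<Rightarrow> ereal"
  assumes closed: "closed (ereal_epigraph f)" and x0: "f x0 < \<infinity>" and proper: "\<And>x. f x \<noteq> -\<infinity>"
    and minorant: "\<And>x. ereal (A - B * norm (x - x0)) \<le> f x" and l: "0 < l"
  shows "is_arg_min (\<lambda>y. f y + ereal (1 / (2 * l) * (norm (y - z))\<^sup>2)) (\<lambda>_. True) (prox l f z)"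
proof -
  define q where "q y = 1 / (2 * l) * (norm (y - z))\<^sup>2" for y
  obtain c0 where c0: "f x0 = ereal c0" using x0 proper[of x0] by (cases "f x0") auto
  define c where "c = c0 + q x0"
  define S where "S = {(x, t). f x \<le> ereal (t - q x) \<and> t \<le> c}"
  have contq: "continuous_on UNIV q" unfolding q_def by (intro continuous_intros)
  have "S = (\<lambda>(x, t). (x, t - q x)) -` ereal_epigraph f \<inter> {p. snd p \<le> c}"
    unfolding S_def ereal_epigraph_def by auto
  moreover have "closed ((\<lambda>(x, t). (x, t - q x)) -` ereal_epigraph f)"
    unfolding case_prod_beta
    by (intro closed_vimage[OF closed] continuous_intros continuous_on_compose2[OF contq]) auto
  moreover have "closed {p::'a \<times> real. snd p \<le> c}"
    by (intro closed_Collect_le continuous_intros)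
  ultimately have "closed S" by (simp only: closed_Int)
  define E where "E = \<bar>B\<bar> + norm (x0 - z) / l + \<bar>c - A\<bar> + 1"
  have low: "norm (x - x0) \<le> 2 * l * E + 2 \<and> A - \<bar>B\<bar> * (2 * l * E + 2) \<le> t" if "(x, t) \<in> S" for x t
  proof -
    define m where "m = norm (x - x0)"
    have m0: "0 \<le> m" unfolding m_def by simp
    have "f x \<le> ereal (t - q x)" using that unfolding S_def by auto
    from order_trans[OF minorant[of x] this] have 1: "A - B * m + q x \<le> t" unfolding m_def by simp
    have t: "t \<le> c" using that unfolding S_def by auto
    have "q x \<ge> 1 / (2 * l) * (m\<^sup>2 - 2 * m * norm (x0 - z))"
    proof -
      have "m \<le> norm (x - z) + norm (x0 - z)" unfolding m_def
        using norm_triangle_ineq[of "x - z" "z - x0"] by (simp add: norm_minus_commute)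
      then have "m\<^sup>2 - 2 * m * norm (x0 - z) \<le> (norm (x - z))\<^sup>2"
      proof (cases "m \<le> norm (x0 - z)")
        case True
        then have "m * m \<le> m * norm (x0 - z)" "0 \<le> m * norm (x0 - z)" using m0 by (auto intro: mult_left_mono)
        then have "m\<^sup>2 - 2 * m * norm (x0 - z) \<le> 0" by (simp add: power2_eq_square)
        then show ?thesis by (meson order_trans zero_le_power2)
      next
        case False
        then have "0 \<le> m - norm (x0 - z)" "m - norm (x0 - z) \<le> norm (x - z)"
          using \<open>m \<le> norm (x - z) + norm (x0 - z)\<close> by linarith+
        then have "(m - norm (x0 - z))\<^sup>2 \<le> (norm (x - z))\<^sup>2" by (rule power_mono[rotated])
        then show ?thesis proof -
          assume "(m - norm (x0 - z))\<^sup>2 \<le> (norm (x - z))\<^sup>2"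
          moreover have "m\<^sup>2 - 2 * m * norm (x0 - z) \<le> (m - norm (x0 - z))\<^sup>2" unfolding power2_diff by simp
          ultimately show ?thesis by linarith
        qed
      qed
      then show ?thesis unfolding q_def using l by (intro mult_left_mono) auto
    qed
    then have 2: "m\<^sup>2 / (2 * l) - m * norm (x0 - z) / l \<le> q x" using l by (simp add: field_simps)
    have "B * m \<le> \<bar>B\<bar> * m" using m0 by (intro mult_right_mono) auto
    then have "m\<^sup>2 / (2 * l) \<le> \<bar>c - A\<bar> + (\<bar>B\<bar> + norm (x0 - z) / l) * m"
      using 1 2 t by (simp add: algebra_simps)
    moreover have "\<bar>c - A\<bar> + (\<bar>B\<bar> + norm (x0 - z) / l) * m \<le> E * m" if "1 \<le> m"
    proof -
      have "\<bar>c - A\<bar> \<le> \<bar>c - A\<bar> * m" using that mult_left_mono[of 1 m "\<bar>c - A\<bar>"] by simp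
      then show ?thesis unfolding E_def using m0 by (simp add: algebra_simps)
    qed
    ultimately have "m\<^sup>2 / (2 * l) \<le> E * m" if "1 \<le> m" using that by linarith
    then have "m * m \<le> (2 * l * E) * m" if "1 \<le> m"
      using that l by (simp add: pos_divide_le_eq power2_eq_square mult.commute mult.left_commute)
    then have "m \<le> 2 * l * E" if "1 \<le> m" using that m0 by (simp add: mult_le_cancel_right)
    moreover have E0: "0 \<le> 2 * l * E" unfolding E_def using l by (intro mult_nonneg_nonneg add_nonneg_nonneg) auto
    ultimately have m: "m \<le> 2 * l * E + 2" by (cases "1 \<le> m") linarith+
    have "\<bar>B\<bar> * m \<le> \<bar>B\<bar> * (2 * l * E + 2)" using m by (intro mult_left_mono) auto
    moreover have "0 \<le> q x" unfolding q_def using l by simp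
    ultimately have "A - \<bar>B\<bar> * (2 * l * E + 2) \<le> t" using 1 \<open>B * m \<le> \<bar>B\<bar> * m\<close> by linarith
    with m show ?thesis unfolding m_def by simp
  qed
  have "bounded S"
  proof -
    have "S \<subseteq> cball x0 (2 * l * E + 2) \<times> {A - \<bar>B\<bar> * (2 * l * E + 2)..c}"
    proof
      fix p assume p: "p \<in> S"
      obtain x t where xt: "p = (x, t)" by (cases p)
      have "t \<le> c" using p unfolding xt S_def by simp
      then show "p \<in> cball x0 (2 * l * E + 2) \<times> {A - \<bar>B\<bar> * (2 * l * E + 2)..c}"
        using low[OF p[unfolded xt]] unfolding xt by (simp add: dist_norm norm_minus_commute)
    qed
    then show ?thesis by (rule bounded_subset[rotated]) (intro bounded_Times bounded_cball bounded_closed_interval)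
  qed
  then have "compact S" using \<open>closed S\<close> by (simp add: compact_eq_bounded_closed)
  moreover have "(x0, c) \<in> S" unfolding S_def c_def by (simp add: c0)
  moreover have "continuous_on S (snd :: 'a \<times> real \<Rightarrow> real)" by (intro continuous_intros)
  ultimately have "\<exists>p\<in>S. \<forall>s\<in>S. snd p \<le> snd s" by (intro continuous_attains_inf) auto
  then obtain p where p: "p \<in> S" "\<forall>s\<in>S. snd p \<le> snd s" by blast
  define h t where "h = fst p" and "t = snd p"
  have ht: "(h, t) \<in> S" "\<And>y s. (y, s) \<in> S \<Longrightarrow> t \<le> s" using p unfolding h_def t_def by (simp, fastforce)
  have "f h + ereal (q h) \<le> f y + ereal (q y)" for y
  proof (cases "f y")
    case (real b)
    have "t \<le> b + q y"
    proof (cases "b + q y \<le> c")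
      case True then show ?thesis using ht(2)[of y "b + q y"] real unfolding S_def by auto
    next
      case False then show ?thesis using ht(1) unfolding S_def by auto
    qed
    moreover have "f h + ereal (q h) \<le> ereal (t - q h) + ereal (q h)"
      using ht(1) unfolding S_def by (intro add_right_mono) auto
    ultimately show ?thesis using real by (auto intro: order_trans)
  qed (use proper in auto)
  then have "is_arg_min (\<lambda>y. f y + ereal (q y)) (\<lambda>_. True) h"
    unfolding is_arg_min_def by (auto simp: not_less)
  then show ?thesis unfolding prox_def arg_min_def q_def by (rule someI)
qed

lemma nonneg_if_affine_nonneg:
  fixes a b :: real
  assumes "\<And>\<theta>. 0 < \<theta> \<Longrightarrow> \<theta> < 1 \<Longrightarrow> 0 \<le> a + \<theta> * b"
  shows "0 \<le> a"
proof (rule ccontr)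
  assume "\<not> 0 \<le> a"
  define \<theta> where "\<theta> = min (1/2) (- a / (2 * (\<bar>b\<bar> + 1)))"
  have "0 < \<theta>" "\<theta> < 1" unfolding \<theta>_def using \<open>\<not> 0 \<le> a\<close> by (auto intro: divide_neg_pos)
  moreover have "\<theta> * b \<le> \<theta> * (\<bar>b\<bar> + 1)" using \<open>0 < \<theta>\<close> by (intro mult_left_mono) auto
  moreover have "\<theta> * (\<bar>b\<bar> + 1) \<le> - a / (2 * (\<bar>b\<bar> + 1)) * (\<bar>b\<bar> + 1)"
    unfolding \<theta>_def by (intro mult_right_mono) auto
  moreover have "- a / (2 * (\<bar>b\<bar> + 1)) * (\<bar>b\<bar> + 1) = - a / 2" by (simp add: field_simps)
  ultimately show False using assms[of \<theta>] \<open>\<not> 0 \<le> a\<close> by linarith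
qed

lemma norm_sq_convex_comb:
  fixes y h :: "'a::real_inner"
  shows "(norm (h + \<theta> *\<^sub>R (y - h)))\<^sup>2 = (1 - \<theta>) * (norm h)\<^sup>2 + \<theta> * (norm y)\<^sup>2 - \<theta> * (1 - \<theta>) * (norm (y - h))\<^sup>2"
  unfolding power2_norm_eq_inner
  by (simp add: inner_add_left inner_add_right inner_diff_left inner_diff_right inner_commute algebra_simps)

lemma weakly_convex_segment:
  assumes g: "weakly_convex \<rho> g" and \<theta>: "0 \<le> \<theta>" "\<theta> \<le> 1"
  shows "g (h + \<theta> *\<^sub>R (y - h)) \<le> (1 - \<theta>) * g h + \<theta> * g y + \<rho> / 2 * (\<theta> * (1 - \<theta>)) * (norm (y - h))\<^sup>2"
proof -
  have "h + \<theta> *\<^sub>R (y - h) = (1 - \<theta>) *\<^sub>R h + \<theta> *\<^sub>R y" by (simp add: algebra_simps)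
  then have "g (h + \<theta> *\<^sub>R (y - h)) + \<rho> / 2 * (norm (h + \<theta> *\<^sub>R (y - h)))\<^sup>2
      \<le> (1 - \<theta>) * (g h + \<rho> / 2 * (norm h)\<^sup>2) + \<theta> * (g y + \<rho> / 2 * (norm y)\<^sup>2)"
    using convex_onD[OF g[unfolded weakly_convex_def], of \<theta> h y] \<theta> by simp
  then show ?thesis unfolding norm_sq_convex_comb by (simp add: algebra_simps add_divide_distrib diff_divide_distrib)
qed

text \<open>The local condition is tested at points close to \<open>x\<close> on the segment to \<open>y\<close>, where weak convexity bounds \<open>g\<close>
  from above.\<close>

lemma subdifferential_global:
  assumes g: "weakly_convex \<rho> g" and v: "v \<in> subdifferential g x"
  shows "g y \<ge> g x + v \<bullet> (y - x) - \<rho> / 2 * (norm (y - x))\<^sup>2"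
proof (cases "y = x")
  case False
  obtain e where e: "e \<in> o[at x](\<lambda>y. norm (y - x))" "\<forall>\<^sub>F y in at x. g y \<ge> g x + v \<bullet> (y - x) + e y"
    using v unfolding subdifferential_def by auto
  define n where "n = norm (y - x)"
  have n: "0 < n" using False unfolding n_def by simp
  have "g x + v \<bullet> (y - x) - \<rho> / 2 * n\<^sup>2 \<le> g y + \<epsilon>" if "0 < \<epsilon>" for \<epsilon>
  proof -
    have "\<forall>\<^sub>F y in at x. norm (e y) \<le> \<epsilon> / (2 * n) * norm (norm (y - x))"
      using e(1) that n by (intro landau_o.smallD) auto
    then have "\<forall>\<^sub>F y in at x. norm (e y) \<le> \<epsilon> / (2 * n) * norm (y - x) \<and> g y \<ge> g x + v \<bullet> (y - x) + e y"
      using e(2) by eventually_elim auto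
    then obtain d where d: "0 < d" "\<And>z. z \<noteq> x \<Longrightarrow> dist z x < d \<Longrightarrow> norm (e z) \<le> \<epsilon> / (2 * n) * norm (z - x) \<and> g z \<ge> g x + v \<bullet> (z - x) + e z"
      unfolding eventually_at by auto
    define K where "K = \<bar>\<rho> / 2 * n\<^sup>2\<bar> + 1"
    define \<theta> where "\<theta> = min (1/2) (min (d / (2 * n)) (\<epsilon> / (2 * K)))"
    have K: "0 < K" unfolding K_def by simp
    have \<theta>: "0 < \<theta>" "\<theta> \<le> 1" "\<theta> * n < d" "\<theta> * K \<le> \<epsilon> / 2"
    proof -
      show "0 < \<theta>" "\<theta> \<le> 1" unfolding \<theta>_def using d n that K by auto
      have "\<theta> * n \<le> d / (2 * n) * n" unfolding \<theta>_def using n by (intro mult_right_mono) auto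
      also have "\<dots> < d" using d n by simp
      finally show "\<theta> * n < d" .
      have "\<theta> * K \<le> \<epsilon> / (2 * K) * K" unfolding \<theta>_def using K by (intro mult_right_mono) auto
      then show "\<theta> * K \<le> \<epsilon> / 2" using K by simp
    qed
    define z where "z = x + \<theta> *\<^sub>R (y - x)"
    have nz: "norm (z - x) = \<theta> * n" unfolding z_def n_def using \<theta> by simp
    have "z \<noteq> x" "dist z x < d" using nz \<theta> n by (auto simp: dist_norm)
    from d(2)[OF this] have "g x + \<theta> * (v \<bullet> (y - x)) - \<epsilon> / (2 * n) * (\<theta> * n) \<le> g z"
      unfolding nz unfolding z_def by (auto simp: abs_le_iff)
    moreover have "\<epsilon> / (2 * n) * (\<theta> * n) = \<theta> * (\<epsilon> / 2)" using n by simp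
    moreover have "g z \<le> (1 - \<theta>) * g x + \<theta> * g y + \<rho> / 2 * (\<theta> * (1 - \<theta>)) * n\<^sup>2"
      unfolding z_def n_def using weakly_convex_segment[OF g, of \<theta> x y] \<theta> by simp
    ultimately have "0 \<le> \<theta> * (g y - g x - v \<bullet> (y - x) + \<epsilon> / 2 + \<rho> / 2 * (1 - \<theta>) * n\<^sup>2)"
      by (simp add: algebra_simps)
    then have "0 \<le> g y - g x - v \<bullet> (y - x) + \<epsilon> / 2 + \<rho> / 2 * (1 - \<theta>) * n\<^sup>2"
      using \<theta>(1) by (simp add: zero_le_mult_iff)
    moreover have "- (\<theta> * (\<rho> / 2 * n\<^sup>2)) \<le> \<theta> * K" unfolding K_def using \<theta>(1)
      by (subst mult_minus_right[symmetric]) (intro mult_left_mono, auto)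
    ultimately show ?thesis using \<theta>(4) by (simp add: algebra_simps add_divide_distrib diff_divide_distrib)
  qed
  then show ?thesis unfolding n_def by (rule field_le_epsilon)
qed simp

lemma weak_subgradient_norm_le:
  fixes g :: "'a::real_inner \<Rightarrow> real"
  assumes lip: "L-lipschitz_on UNIV g" and v: "\<And>y. g y \<ge> g x + v \<bullet> (y - x) - \<rho> / 2 * (norm (y - x))\<^sup>2"
  shows "v \<bullet> v \<le> L\<^sup>2"
proof -
  have L: "0 \<le> L" using lip by (rule lipschitz_on_nonneg)
  define n where "n = norm v"
  have vv: "v \<bullet> v = n * n" unfolding n_def using power2_norm_eq_inner[of v] by (simp only: power2_eq_square)
  have n: "0 \<le> n" unfolding n_def by simp
  have "0 \<le> (L * n - n * n) + \<theta> * (\<rho> / 2 * (n * n))" if \<theta>: "0 < \<theta>" "\<theta> < 1" for \<theta>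
  proof -
    have nt: "norm (x + \<theta> *\<^sub>R v - x) = \<theta> * n" unfolding n_def using \<theta> by simp
    have "\<bar>g (x + \<theta> *\<^sub>R v) - g x\<bar> \<le> L * (\<theta> * n)"
      using lipschitz_onD[OF lip, of "x + \<theta> *\<^sub>R v" x] unfolding dist_norm nt by simp
    moreover have "g (x + \<theta> *\<^sub>R v) \<ge> g x + \<theta> * (n * n) - \<rho> / 2 * (\<theta> * n)\<^sup>2"
      using v[of "x + \<theta> *\<^sub>R v"] unfolding nt by (simp add: vv)
    ultimately have "0 \<le> L * (\<theta> * n) - \<theta> * (n * n) + \<rho> / 2 * (\<theta> * n)\<^sup>2" by linarith
    also have "\<dots> = \<theta> * ((L * n - n * n) + \<theta> * (\<rho> / 2 * (n * n)))" by (simp add: algebra_simps power2_eq_square)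
    finally show ?thesis using \<theta> by (simp only: zero_le_mult_iff) linarith
  qed
  then have "0 \<le> L * n - n * n" by (rule nonneg_if_affine_nonneg)
  then have "n * n \<le> L * n" by simp
  then have "n \<le> L" using L n by (cases "n = 0") (auto simp: mult_le_cancel_right)
  then have "n * n \<le> L * L" using n L by (intro mult_mono)
  then show ?thesis unfolding vv power2_eq_square .
qed

text \<open>A hyperplane separates the strict epigraph of the convexified \<open>g\<close> from the hypograph of minus the tilted \<open>r\<close>. It
  cannot be vertical because \<open>g\<close> is finite everywhere, and its slope is the required subgradient.\<close>

lemma subgradient_sum_split:
  fixes g R :: "'a::euclidean_space \<Rightarrow> real"
  assumes g: "weakly_convex \<rho> g" and D: "convex D" "h \<in> D"
    and R: "\<And>x y \<theta>. x \<in> D \<Longrightarrow> y \<in> D \<Longrightarrow> 0 \<le> \<theta> \<Longrightarrow> \<theta> \<le> 1 \<Longrightarrow> R ((1 - \<theta>) *\<^sub>R x + \<theta> *\<^sub>R y) \<le> (1 - \<theta>) * R x + \<theta> * R y"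
    and w: "\<And>y. y \<in> D \<Longrightarrow> g y + R y \<ge> g h + R h + w \<bullet> (y - h) - \<rho> / 2 * (norm (y - h))\<^sup>2"
  shows "\<exists>u. (\<forall>y. g y \<ge> g h + u \<bullet> (y - h) - \<rho> / 2 * (norm (y - h))\<^sup>2) \<and> (\<forall>y\<in>D. R y \<ge> R h + (w - u) \<bullet> (y - h))"
proof -
  define g1 where "g1 y = g y + \<rho> / 2 * (norm (y - h))\<^sup>2 - g h" for y
  define R1 where "R1 y = R y - w \<bullet> (y - h) - R h" for y
  define C1 where "C1 = {(y, t). g1 y < t}"
  define C2 where "C2 = {(y, t). y \<in> D \<and> t \<le> - R1 y}"
  have g1c: "g1 ((1 - \<theta>) *\<^sub>R x + \<theta> *\<^sub>R y) \<le> (1 - \<theta>) * g1 x + \<theta> * g1 y" if "0 \<le> \<theta>" "\<theta> \<le> 1" for x y \<theta>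
  proof -
    have eq: "(1 - \<theta>) *\<^sub>R x + \<theta> *\<^sub>R y = x + \<theta> *\<^sub>R (y - x)" by (simp add: algebra_simps)
    have eq2: "x + \<theta> *\<^sub>R (y - x) - h = (x - h) + \<theta> *\<^sub>R ((y - h) - (x - h))" by simp
    show ?thesis unfolding eq g1_def eq2 norm_sq_convex_comb
      using weakly_convex_segment[OF g that, of x y] by (simp add: algebra_simps add_divide_distrib diff_divide_distrib)
  qed
  have convC1: "convex C1"
  proof (rule convexI)
    fix a b :: "'a \<times> real" and u v :: real assume *: "a \<in> C1" "b \<in> C1" "0 \<le> u" "0 \<le> v" "u + v = 1"
    have "u * snd a + v * snd b - (u * g1 (fst a) + v * g1 (fst b)) > 0"
    proof -
      have "0 < snd a - g1 (fst a)" "0 < snd b - g1 (fst b)" using * unfolding C1_def by auto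
      then have "0 < u * (snd a - g1 (fst a)) + v * (snd b - g1 (fst b))"
        using *(3-5) by (cases "u = 0") (auto intro!: add_pos_nonneg)
      then show ?thesis by (simp add: algebra_simps)
    qed
    moreover have "g1 (u *\<^sub>R fst a + v *\<^sub>R fst b) \<le> u * g1 (fst a) + v * g1 (fst b)"
    proof -
      have u: "u = 1 - v" using * by simp
      show ?thesis unfolding u using g1c[of v "fst a" "fst b"] * by auto
    qed
    ultimately show "u *\<^sub>R a + v *\<^sub>R b \<in> C1" unfolding C1_def by (auto simp: case_prod_beta)
  qed
  have convC2: "convex C2"
  proof (rule convexI)
    fix a b :: "'a \<times> real" and u v :: real assume *: "a \<in> C2" "b \<in> C2" "0 \<le> u" "0 \<le> v" "u + v = 1"
    have u: "u = 1 - v" using * by simp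
    have D': "fst a \<in> D" "fst b \<in> D" "snd a \<le> - R1 (fst a)" "snd b \<le> - R1 (fst b)" using * unfolding C2_def by auto
    have "R (u *\<^sub>R fst a + v *\<^sub>R fst b) \<le> u * R (fst a) + v * R (fst b)"
      unfolding u using R[of "fst a" "fst b" v] D' * by auto
    then have "R1 (u *\<^sub>R fst a + v *\<^sub>R fst b) \<le> u * R1 (fst a) + v * R1 (fst b)"
      unfolding R1_def u by (simp add: inner_diff_right inner_add_right algebra_simps)
    moreover have "u * snd a + v * snd b \<le> u * (- R1 (fst a)) + v * (- R1 (fst b))"
      using D' * by (intro add_mono mult_left_mono) auto
    moreover have "u *\<^sub>R fst a + v *\<^sub>R fst b \<in> D" using convexD[OF D(1)] D' * by auto
    ultimately show "u *\<^sub>R a + v *\<^sub>R b \<in> C2" unfolding C2_def by (auto simp: case_prod_beta)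
  qed
  have disj: "C2 \<inter> C1 = {}"
  proof -
    have "- R1 y \<le> g1 y" if "y \<in> D" for y using w[OF that] unfolding R1_def g1_def by simp
    then show ?thesis unfolding C1_def C2_def by force
  qed
  have ne: "(h, 1) \<in> C1" "(h, 0) \<in> C2" unfolding C1_def C2_def g1_def R1_def using D by auto
  obtain a b where ab: "a \<noteq> 0" "\<And>x. x \<in> C2 \<Longrightarrow> a \<bullet> x \<le> b" "\<And>x. x \<in> C1 \<Longrightarrow> b \<le> a \<bullet> x"
    using separating_hyperplane_sets[OF convC2 convC1 _ _ disj] ne by blast
  obtain p \<tau> where a: "a = (p, \<tau>)" by (cases a)
  have c1: "b \<le> p \<bullet> y + \<tau> * t" if "g1 y < t" for y t using ab(3)[of "(y, t)"] that unfolding a C1_def by auto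
  have c2: "p \<bullet> y + \<tau> * t \<le> b" if "y \<in> D" "t \<le> - R1 y" for y t using ab(2)[of "(y, t)"] that unfolding a C2_def by auto
  have "0 < \<tau>"
  proof (rule ccontr)
    assume "\<not> 0 < \<tau>"
    show False
    proof (cases "\<tau> = 0")
      case True
      then have b: "b \<le> p \<bullet> y" for y using c1[of y "g1 y + 1"] by simp
      have "p \<noteq> 0" using ab(1) a True by (auto simp: zero_prod_def)
      then have "0 < p \<bullet> p" by simp
      have "b \<le> - (\<bar>b\<bar> + 1)" using b[of "(- (\<bar>b\<bar> + 1) / (p \<bullet> p)) *\<^sub>R p"] \<open>0 < p \<bullet> p\<close> by simp
      then show False by linarith
    next
      case False
      then have "\<tau> < 0" using \<open>\<not> 0 < \<tau>\<close> by simp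
      define t where "t = max 1 ((p \<bullet> h - b + 1) / (- \<tau>))"
      have bt: "b \<le> p \<bullet> h + \<tau> * t" by (rule c1) (auto simp: g1_def t_def)
      have "(p \<bullet> h - b + 1) / (- \<tau>) \<le> t" unfolding t_def by simp
      moreover have "0 < - \<tau>" using \<open>\<tau> < 0\<close> by simp
      ultimately have "p \<bullet> h - b + 1 \<le> t * (- \<tau>)" by (simp only: pos_divide_le_eq)
      with bt show False by (simp add: mult.commute)
    qed
  qed
  have lim: "b \<le> p \<bullet> y + \<tau> * g1 y" for y
  proof (rule field_le_epsilon)
    fix e :: real assume "0 < e"
    then show "b \<le> p \<bullet> y + \<tau> * g1 y + e" using c1[of y "g1 y + e / \<tau>"] \<open>0 < \<tau>\<close> by (simp add: distrib_left)
  qed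
  have bh: "p \<bullet> h = b" using c2[of h 0] lim[of h] D(2) by (simp add: R1_def g1_def)
  define u where "u = (- 1 / \<tau>) *\<^sub>R p"
  have pu: "p \<bullet> z = - \<tau> * (u \<bullet> z)" for z unfolding u_def using \<open>0 < \<tau>\<close> by simp
  show ?thesis
  proof (intro exI[of _ u] conjI allI ballI)
    fix y
    have "0 \<le> \<tau> * (g1 y - u \<bullet> (y - h))" using lim[of y] bh[symmetric] by (simp add: pu inner_diff_right right_diff_distrib)
    then show "g h + u \<bullet> (y - h) - \<rho> / 2 * (norm (y - h))\<^sup>2 \<le> g y"
      using \<open>0 < \<tau>\<close> by (simp add: zero_le_mult_iff g1_def)
  next
    fix y assume "y \<in> D"
    have "0 \<le> \<tau> * (R1 y + u \<bullet> (y - h))" using c2[OF \<open>y \<in> D\<close> order_refl] bh[symmetric]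
      by (simp add: pu inner_diff_right right_diff_distrib distrib_left)
    then show "R h + (w - u) \<bullet> (y - h) \<le> R y"
      using \<open>0 < \<tau>\<close> by (simp add: zero_le_mult_iff R1_def inner_diff_left)
  qed
qed


text \<open>Minimality is compared with the point a fraction \<open>\<theta>\<close> of the way to \<open>y\<close>, and \<open>\<theta>\<close> tends to zero.\<close>

lemma prox_variational:
  fixes f :: "'a::euclidean_space \<Rightarrow> ereal"
  assumes min: "is_arg_min (\<lambda>y. f y + ereal (1 / (2 * l) * (norm (y - z))\<^sup>2)) (\<lambda>_. True) h" and l: "0 < l"
    and f: "\<And>y. y \<in> D \<Longrightarrow> f y = ereal (F y)" "\<And>y. y \<notin> D \<Longrightarrow> f y = \<infinity>" and D: "convex D" "D \<noteq> {}"
    and F: "\<And>x y \<theta>. x \<in> D \<Longrightarrow> y \<in> D \<Longrightarrow> 0 \<le> \<theta> \<Longrightarrow> \<theta> \<le> 1 \<Longrightarrow>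
       F (x + \<theta> *\<^sub>R (y - x)) \<le> (1 - \<theta>) * F x + \<theta> * F y + c / 2 * (\<theta> * (1 - \<theta>)) * (norm (y - x))\<^sup>2"
  shows "h \<in> D" "\<And>y. y \<in> D \<Longrightarrow> F y \<ge> F h + (1 / l) * ((z - h) \<bullet> (y - h)) - c / 2 * (norm (y - h))\<^sup>2"
    "\<And>y. y \<in> D \<Longrightarrow> F h + 1 / (2 * l) * (norm (h - z))\<^sup>2 \<le> F y + 1 / (2 * l) * (norm (y - z))\<^sup>2"
proof -
  have le: "f h + ereal (1 / (2 * l) * (norm (h - z))\<^sup>2) \<le> f y + ereal (1 / (2 * l) * (norm (y - z))\<^sup>2)" for y
    using min unfolding is_arg_min_def by (auto simp: not_less)
  show h: "h \<in> D"
  proof (rule ccontr)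
    assume "h \<notin> D"
    obtain y where "y \<in> D" using D by auto
    then show False using le[of y] f(1)[of y] f(2)[OF \<open>h \<notin> D\<close>] by simp
  qed
  show le': "F h + 1 / (2 * l) * (norm (h - z))\<^sup>2 \<le> F y + 1 / (2 * l) * (norm (y - z))\<^sup>2" if "y \<in> D" for y
    using le[of y] f(1)[OF h] f(1)[OF that] by simp
  fix y assume y: "y \<in> D"
  have "0 \<le> (F y - F h - (1 / l) * ((z - h) \<bullet> (y - h)) + c / 2 * (norm (y - h))\<^sup>2) + \<theta> * ((1 / (2 * l) - c / 2) * (norm (y - h))\<^sup>2)"
    if \<theta>: "0 < \<theta>" "\<theta> < 1" for \<theta>
  proof -
    have "h + \<theta> *\<^sub>R (y - h) = (1 - \<theta>) *\<^sub>R h + \<theta> *\<^sub>R y" by (simp add: algebra_simps)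
    then have "h + \<theta> *\<^sub>R (y - h) \<in> D" using convexD[OF D(1) h y, of "1 - \<theta>" \<theta>] \<theta> by simp
    from le'[OF this] F[OF h y, of \<theta>] \<theta>
    have "F h + 1 / (2 * l) * (norm (h - z))\<^sup>2 \<le> (1 - \<theta>) * F h + \<theta> * F y + c / 2 * (\<theta> * (1 - \<theta>)) * (norm (y - h))\<^sup>2
        + 1 / (2 * l) * (norm (h + \<theta> *\<^sub>R (y - h) - z))\<^sup>2" by simp
    also have "h + \<theta> *\<^sub>R (y - h) - z = (h - z) + \<theta> *\<^sub>R (y - h)" by simp
    also have "(norm ((h - z) + \<theta> *\<^sub>R (y - h)))\<^sup>2 = (norm (h - z))\<^sup>2 - 2 * \<theta> * ((z - h) \<bullet> (y - h)) + \<theta>\<^sup>2 * (norm (y - h))\<^sup>2"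
      unfolding power2_norm_eq_inner
      by (simp add: inner_add_left inner_add_right inner_diff_left inner_diff_right inner_commute power2_eq_square algebra_simps)
    finally have "0 \<le> \<theta> * ((F y - F h - (1 / l) * ((z - h) \<bullet> (y - h)) + c / 2 * (norm (y - h))\<^sup>2) + \<theta> * ((1 / (2 * l) - c / 2) * (norm (y - h))\<^sup>2))"
      by (simp add: algebra_simps power2_eq_square add_divide_distrib diff_divide_distrib)
    then show ?thesis using \<theta> by (simp only: zero_le_mult_iff) linarith
  qed
  from nonneg_if_affine_nonneg[OF this]
  show "F y \<ge> F h + (1 / l) * ((z - h) \<bullet> (y - h)) - c / 2 * (norm (y - h))\<^sup>2" by simp
qed

text \<open>The two variational inequalities are added; the quadratic error is at most half of the strong monotonicity.\<close>

lemma prox_lipschitz: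
  fixes h h' z z' :: "'a::euclidean_space"
  assumes "F h' \<ge> F h + k * ((z - h) \<bullet> (h' - h)) - c / 2 * (norm (h' - h))\<^sup>2"
    and "F h \<ge> F h' + k * ((z' - h') \<bullet> (h - h')) - c / 2 * (norm (h - h'))\<^sup>2"
    and k: "2 * c \<le> k" "0 < k"
  shows "norm (h - h') \<le> 2 * norm (z - z')"
proof -
  define n where "n = norm (h - h')"
  have "(z - h) \<bullet> (h' - h) + (z' - h') \<bullet> (h - h') = n\<^sup>2 - (z - z') \<bullet> (h - h')"
    unfolding n_def power2_norm_eq_inner by (simp add: inner_diff_left inner_diff_right inner_commute algebra_simps)
  then have "k * ((z - h) \<bullet> (h' - h)) + k * ((z' - h') \<bullet> (h - h')) = k * (n\<^sup>2 - (z - z') \<bullet> (h - h'))"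
    by (simp only: distrib_left[symmetric])
  then have "k * n\<^sup>2 - k * ((z - z') \<bullet> (h - h')) \<le> c * n\<^sup>2"
    using assms(1,2) unfolding norm_minus_commute[of h' h] n_def by (simp add: right_diff_distrib)
  moreover have "c * n\<^sup>2 \<le> k / 2 * n\<^sup>2" using k by (intro mult_right_mono) auto
  ultimately have "k * n\<^sup>2 \<le> k * (2 * ((z - z') \<bullet> (h - h')))" by (simp add: algebra_simps)
  then have "n\<^sup>2 \<le> 2 * ((z - z') \<bullet> (h - h'))" using k by simp
  also have "\<dots> \<le> 2 * (norm (z - z') * n)" unfolding n_def using norm_cauchy_schwarz[of "z - z'" "h - h'"] by simp
  finally have "n * n \<le> (2 * norm (z - z')) * n" by (simp add: power2_eq_square)
  then have "n \<le> 2 * norm (z - z')" by (cases "n = 0") (auto simp: n_def mult_le_cancel_right)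
  then show ?thesis unfolding n_def .
qed

locale weakly_convex_composite =
  fixes r :: "'a::euclidean_space \<Rightarrow> ereal" and g :: "'a \<Rightarrow> real" and \<rho> L :: real and x0 :: 'a
  assumes r: "closed_convex_function r" and \<rho>: "0 < \<rho>" and g: "weakly_convex \<rho> g" and lip: "L-lipschitz_on UNIV g"
    and x0: "x0 \<in> effective_domain r" and min_exists: "\<exists>x. is_arg_min (\<lambda>x. ereal (g x) + r x) (\<lambda>_. True) x"
begin

abbreviation "D \<equiv> effective_domain r"
abbreviation "\<phi> \<equiv> (\<lambda>x. ereal (g x) + r x)"
definition "R x = real_of_ereal (r x)"
definition "m = real_of_ereal (INF x. \<phi> x)"
definition "h x = prox (1 / (2 * \<rho>)) \<phi> x"
definition "env x = moreau_envelope (1 / (2 * \<rho>)) \<phi> x"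

lemma r_eq: "y \<in> D \<Longrightarrow> r y = ereal (R y)" "y \<notin> D \<Longrightarrow> r y = \<infinity>"
  using r unfolding closed_convex_function_def effective_domain_def R_def
  by (cases "r y"; auto)+

lemma D_R: "convex D" "\<And>x y \<theta>. x \<in> D \<Longrightarrow> y \<in> D \<Longrightarrow> 0 \<le> \<theta> \<Longrightarrow> \<theta> \<le> 1 \<Longrightarrow> R ((1 - \<theta>) *\<^sub>R x + \<theta> *\<^sub>R y) \<le> (1 - \<theta>) * R x + \<theta> * R y"
proof -
  have *: "(1 - \<theta>) *\<^sub>R x + \<theta> *\<^sub>R y \<in> D \<and> R ((1 - \<theta>) *\<^sub>R x + \<theta> *\<^sub>R y) \<le> (1 - \<theta>) * R x + \<theta> * R y"
    if "x \<in> D" "y \<in> D" "0 \<le> \<theta>" "\<theta> \<le> 1" for x y \<theta>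
  proof -
    have "(x, R x) \<in> ereal_epigraph r" "(y, R y) \<in> ereal_epigraph r"
      using r_eq that unfolding ereal_epigraph_def by auto
    then have "(1 - \<theta>) *\<^sub>R (x, R x) + \<theta> *\<^sub>R (y, R y) \<in> ereal_epigraph r"
      using r that unfolding closed_convex_function_def by (intro convexD) auto
    then have le: "r ((1 - \<theta>) *\<^sub>R x + \<theta> *\<^sub>R y) \<le> ereal ((1 - \<theta>) * R x + \<theta> * R y)"
      unfolding ereal_epigraph_def by simp
    then have "(1 - \<theta>) *\<^sub>R x + \<theta> *\<^sub>R y \<in> D" unfolding effective_domain_def by (auto simp: le_less_trans)
    with le r_eq(1)[OF this] show ?thesis by simp
  qed
  then show "\<And>x y \<theta>. x \<in> D \<Longrightarrow> y \<in> D \<Longrightarrow> 0 \<le> \<theta> \<Longrightarrow> \<theta> \<le> 1 \<Longrightarrow> R ((1 - \<theta>) *\<^sub>R x + \<theta> *\<^sub>R y) \<le> (1 - \<theta>) * R x + \<theta> * R y" by blast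
  show "convex D" unfolding convex_alt using * by blast
qed

lemma m_le: "y \<in> D \<Longrightarrow> m \<le> g y + R y" and m_le': "ereal m \<le> \<phi> y"
proof -
  obtain b where b: "\<And>y. \<phi> b \<le> \<phi> y" using min_exists unfolding is_arg_min_def by (auto simp: not_less)
  have "\<phi> b < \<infinity>" using b[of x0] r_eq(1)[OF x0] by (auto simp: le_less_trans)
  then have bD: "b \<in> D" using r_eq(2)[of b] by auto
  have "(INF x. \<phi> x) = \<phi> b" by (rule antisym) (auto intro: INF_lower INF_greatest b)
  then have m: "m = g b + R b" unfolding m_def using r_eq(1)[OF bD] by simp
  show le: "ereal m \<le> \<phi> y" for y using b[of y] r_eq(1)[OF bD] unfolding m by simp
  show "y \<in> D \<Longrightarrow> m \<le> g y + R y" using le[of y] r_eq(1)[of y] by simp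
qed

lemma segment: "b + \<theta> *\<^sub>R (y - b) = (1 - \<theta>) *\<^sub>R b + \<theta> *\<^sub>R (y::'a)" by (simp add: algebra_simps)

lemma prox_r:
  assumes "0 < l"
  shows "prox l r z \<in> D" "y \<in> D \<Longrightarrow> R y \<ge> R (prox l r z) + (1 / l) * ((z - prox l r z) \<bullet> (y - prox l r z))"
proof -
  have "ereal ((m - g x0) - L * norm (x - x0)) \<le> r x" for x
  proof (cases "x \<in> D")
    case True
    have "\<bar>g x - g x0\<bar> \<le> L * norm (x - x0)" using lipschitz_onD[OF lip, of x x0] by (simp add: dist_norm)
    then show ?thesis using m_le[OF True] unfolding r_eq(1)[OF True] by simp
  qed (simp add: r_eq)
  then have min: "is_arg_min (\<lambda>y. r y + ereal (1 / (2 * l) * (norm (y - z))\<^sup>2)) (\<lambda>_. True) (prox l r z)"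
    using r x0 assms unfolding closed_convex_function_def effective_domain_def by (intro prox_attained) auto
  note V = prox_variational[OF min assms r_eq D_R(1), of 0]
  have F: "x \<in> D \<Longrightarrow> y \<in> D \<Longrightarrow> 0 \<le> \<theta> \<Longrightarrow> \<theta> \<le> 1 \<Longrightarrow> 
     R (x + \<theta> *\<^sub>R (y - x)) \<le> (1 - \<theta>) * R x + \<theta> * R y + 0 / 2 * (\<theta> * (1 - \<theta>)) * (norm (y - x))\<^sup>2" for x y \<theta>
    unfolding segment using D_R(2)[of x y \<theta>] by simp
  show "prox l r z \<in> D" using V(1) F x0 by auto
  show "y \<in> D \<Longrightarrow> R y \<ge> R (prox l r z) + (1 / l) * ((z - prox l r z) \<bullet> (y - prox l r z))"
    using V(2)[of y] F x0 by fastforce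
qed

lemma prox_\<phi>:
  shows h_D: "h z \<in> D" and h_ineq: "y \<in> D \<Longrightarrow> g y + R y \<ge> g (h z) + R (h z) + (2 * \<rho>) * ((z - h z) \<bullet> (y - h z)) - \<rho> / 2 * (norm (y - h z))\<^sup>2"
    and h_min: "y \<in> D \<Longrightarrow> g (h z) + R (h z) + \<rho> * (norm (h z - z))\<^sup>2 \<le> g y + R y + \<rho> * (norm (y - z))\<^sup>2"
proof -
  have gcont: "continuous_on UNIV g" using lip by (rule lipschitz_on_continuous_on)
  have "ereal_epigraph \<phi> = (\<lambda>(x, t). (x, t - g x)) -` ereal_epigraph r"
  proof -
    have "ereal (g x) + r x \<le> ereal t \<longleftrightarrow> r x \<le> ereal (t - g x)" for x t by (cases "r x") auto
    then show ?thesis unfolding ereal_epigraph_def by auto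
  qed
  moreover have "closed ((\<lambda>(x, t). (x, t - g x)) -` ereal_epigraph r)"
    unfolding case_prod_beta using r unfolding closed_convex_function_def
    by (intro closed_vimage continuous_intros continuous_on_compose2[OF gcont]) auto
  ultimately have cl: "closed (ereal_epigraph \<phi>)" by simp
  have min: "is_arg_min (\<lambda>y. \<phi> y + ereal (1 / (2 * (1 / (2 * \<rho>))) * (norm (y - z))\<^sup>2)) (\<lambda>_. True) (h z)"
    unfolding h_def
  proof (rule prox_attained[OF cl, of x0 m 0])
    show "\<phi> x0 < \<infinity>" using r_eq(1)[OF x0] by simp
    show "\<phi> x \<noteq> -\<infinity>" for x using r unfolding closed_convex_function_def by (cases "r x") auto
  qed (use m_le' \<rho> in auto)
  have l: "0 < 1 / (2 * \<rho>)" using \<rho> by simp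
  have F: "g (x + \<theta> *\<^sub>R (y - x)) + R (x + \<theta> *\<^sub>R (y - x)) \<le> (1 - \<theta>) * (g x + R x) + \<theta> * (g y + R y) + \<rho> / 2 * (\<theta> * (1 - \<theta>)) * (norm (y - x))\<^sup>2"
    if "x \<in> D" "y \<in> D" "0 \<le> \<theta>" "\<theta> \<le> 1" for x y \<theta>
    using D_R(2)[OF that] weakly_convex_segment[OF g that(3,4), of x y] unfolding segment by (simp add: algebra_simps)
  have ne: "D \<noteq> {}" using x0 by auto
  have e: "\<phi> y = ereal (g y + R y)" if "y \<in> D" for y using r_eq(1)[OF that] by simp
  have i: "\<phi> y = \<infinity>" if "y \<notin> D" for y using r_eq(2)[OF that] by simp
  note V = prox_variational[OF min l e i D_R(1) ne F]
  have c: "1 / (1 / (2 * \<rho>)) = 2 * \<rho>" "1 / (2 * (1 / (2 * \<rho>))) = \<rho>" using \<rho> by simp_all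
  show "h z \<in> D" by (rule V(1))
  show "y \<in> D \<Longrightarrow> g y + R y \<ge> g (h z) + R (h z) + (2 * \<rho>) * ((z - h z) \<bullet> (y - h z)) - \<rho> / 2 * (norm (y - h z))\<^sup>2"
    using V(2)[of y] unfolding c .
  show "y \<in> D \<Longrightarrow> g (h z) + R (h z) + \<rho> * (norm (h z - z))\<^sup>2 \<le> g y + R y + \<rho> * (norm (y - z))\<^sup>2"
    using V(3)[of y] unfolding c .
qed

lemma h_lipschitz: "norm (h z - h z') \<le> 2 * norm (z - z')"
  by (rule prox_lipschitz[where F = "\<lambda>y. g y + R y" and k = "2 * \<rho>" and c = \<rho>]) (use h_ineq h_D \<rho> in auto)

lemma prox_r_lipschitz: "0 < l \<Longrightarrow> norm (prox l r z - prox l r z') \<le> 2 * norm (z - z')"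
  by (rule prox_lipschitz[where F = R and k = "1 / l" and c = 0]) (use prox_r in auto)

lemma env_eq: "env x = g (h x) + R (h x) + \<rho> * (norm (x - h x))\<^sup>2"
proof -
  have c: "1 / (2 * (1 / (2 * \<rho>))) = \<rho>" using \<rho> by simp
  have "(INF y. \<phi> y + ereal (\<rho> * (norm (y - x))\<^sup>2)) = ereal (g (h x) + R (h x) + \<rho> * (norm (x - h x))\<^sup>2)"
  proof (rule antisym)
    show "(INF y. \<phi> y + ereal (\<rho> * (norm (y - x))\<^sup>2)) \<le> ereal (g (h x) + R (h x) + \<rho> * (norm (x - h x))\<^sup>2)"
      by (rule INF_lower2[of "h x"]) (use r_eq(1)[OF h_D, of x] in \<open>auto simp: norm_minus_commute\<close>)
    show "ereal (g (h x) + R (h x) + \<rho> * (norm (x - h x))\<^sup>2) \<le> (INF y. \<phi> y + ereal (\<rho> * (norm (y - x))\<^sup>2))"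
    proof (rule INF_greatest)
      fix y
      show "ereal (g (h x) + R (h x) + \<rho> * (norm (x - h x))\<^sup>2) \<le> \<phi> y + ereal (\<rho> * (norm (y - x))\<^sup>2)"
      proof (cases "y \<in> D")
        case True then show ?thesis using h_min[OF True, of x] r_eq(1)[OF True] by (simp add: norm_minus_commute)
      qed (simp add: r_eq)
    qed
  qed
  then show ?thesis unfolding env_def moreau_envelope_def c by simp
qed

text \<open>Using each proximal point as a competitor at the other argument bounds the envelope from both sides by its linear
  model, with a quadratic error because the proximal map is Lipschitz.\<close>

lemma env_gradient: "gradient env x = (2 * \<rho>) *\<^sub>R (x - h x)" and env_cont: "isCont env x"
proof -
  define w where "w = (2 * \<rho>) *\<^sub>R (x - h x)"
  have bound: "\<bar>env y - env x - w \<bullet> (y - x)\<bar> \<le> 7 * \<rho> * (norm (y - x))\<^sup>2" for y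
  proof -
    define d where "d = y - x"
    have up: "env y \<le> env x + w \<bullet> d + \<rho> * (norm d)\<^sup>2"
    proof -
      have eq: "(norm (y - h x))\<^sup>2 = (norm (x - h x))\<^sup>2 + 2 * ((x - h x) \<bullet> d) + (norm d)\<^sup>2"
        unfolding d_def power2_norm_eq_inner by (simp add: inner_diff_left inner_diff_right inner_commute algebra_simps)
      have "\<rho> * (norm (y - h x))\<^sup>2 = \<rho> * (norm (x - h x))\<^sup>2 + w \<bullet> d + \<rho> * (norm d)\<^sup>2"
        unfolding w_def eq by (simp add: distrib_left)
      then show ?thesis using h_min[OF h_D, of y x]
        unfolding env_eq norm_minus_commute[of "h x" y] norm_minus_commute[of "h y" y] by linarith
    qed
    have low: "env x \<le> env y - w \<bullet> d - (2 * \<rho>) * (((y - h y) - (x - h x)) \<bullet> d) + \<rho> * (norm d)\<^sup>2"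
    proof -
      have eq: "(norm (x - h y))\<^sup>2 = (norm (y - h y))\<^sup>2 - 2 * ((y - h y) \<bullet> d) + (norm d)\<^sup>2"
        unfolding d_def power2_norm_eq_inner by (simp add: inner_diff_left inner_diff_right inner_commute algebra_simps)
      have "\<rho> * (norm (x - h y))\<^sup>2 = \<rho> * (norm (y - h y))\<^sup>2 - (2 * \<rho>) * ((y - h y) \<bullet> d) + \<rho> * (norm d)\<^sup>2"
        unfolding eq by (simp add: distrib_left right_diff_distrib)
      then have "env x \<le> env y - (2 * \<rho>) * ((y - h y) \<bullet> d) + \<rho> * (norm d)\<^sup>2"
        using h_min[OF h_D, of x y]
        unfolding env_eq norm_minus_commute[of "h x" x] norm_minus_commute[of "h y" x] by linarith
      then show ?thesis unfolding w_def by (simp add: inner_diff_left algebra_simps)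
    qed
    have "norm ((y - h y) - (x - h x)) \<le> 3 * norm d"
    proof -
      have eq: "(y - h y) - (x - h x) = d - (h y - h x)" unfolding d_def by simp
      have "norm (h y - h x) \<le> 2 * norm d" unfolding d_def by (rule h_lipschitz)
      then show ?thesis unfolding eq using norm_triangle_ineq4[of d "h y - h x"] by linarith
    qed
    then have "\<bar>((y - h y) - (x - h x)) \<bullet> d\<bar> \<le> (3 * norm d) * norm d"
      by (intro order_trans[OF Cauchy_Schwarz_ineq2] mult_right_mono) auto
    then have "(2 * \<rho>) * \<bar>((y - h y) - (x - h x)) \<bullet> d\<bar> \<le> (2 * \<rho>) * (3 * (norm d)\<^sup>2)"
      using \<rho> by (intro mult_left_mono) (auto simp: power2_eq_square)
    moreover have "\<bar>(2 * \<rho>) * (((y - h y) - (x - h x)) \<bullet> d)\<bar> = (2 * \<rho>) * \<bar>((y - h y) - (x - h x)) \<bullet> d\<bar>"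
      unfolding abs_mult using \<rho> by simp
    moreover have "0 \<le> \<rho> * (norm d)\<^sup>2" using \<rho> by simp
    ultimately show ?thesis using up low unfolding d_def[symmetric] abs_le_iff by (auto simp: abs_le_iff)
  qed
  have der: "GDERIV env x :> w"
    unfolding gderiv_def has_derivative_iff_norm
  proof (intro conjI bounded_linear_inner_left_comp bounded_linear_ident)
    show "((\<lambda>y. norm (env y - env x - (y - x) \<bullet> w) / norm (y - x)) \<longlongrightarrow> 0) (at x)"
    proof (rule Lim_null_comparison)
      show "((\<lambda>y. 7 * \<rho> * norm (y - x)) \<longlongrightarrow> 0) (at x)" by (auto intro!: tendsto_eq_intros)
      show "\<forall>\<^sub>F y in at x. norm (norm (env y - env x - (y - x) \<bullet> w) / norm (y - x)) \<le> 7 * \<rho> * norm (y - x)"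
      proof (intro eventually_at_filter[THEN iffD2] always_eventually allI impI)
        fix y assume "y \<noteq> x"
        then show "norm (norm (env y - env x - (y - x) \<bullet> w) / norm (y - x)) \<le> 7 * \<rho> * norm (y - x)"
          using bound[of y] by (simp add: inner_commute divide_le_eq power2_eq_square mult.assoc)
      qed
    qed
  qed
  have uniq: "D' = w" if "GDERIV env x :> D'" for D'
  proof -
    have "(\<lambda>h. h \<bullet> D') = (\<lambda>h. h \<bullet> w)" using der that unfolding gderiv_def by (rule has_derivative_unique[rotated])
    then have "\<forall>z. z \<bullet> D' = z \<bullet> w" by (auto dest: fun_cong)
    then show ?thesis by (simp only: vector_eq_ldot)
  qed
  have "gradient env x = w" unfolding gradient_def
  proof (rule the_equality)
    show "GDERIV env x :> w" by (rule der)
    show "D' = w" if "GDERIV env x :> D'" for D' using that by (rule uniq)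
  qed
  then show "gradient env x = (2 * \<rho>) *\<^sub>R (x - h x)" unfolding w_def .
  show "isCont env x" using der unfolding gderiv_def by (rule has_derivative_continuous)
qed

lemma split_exists:
  "\<exists>u. (\<forall>y. g y \<ge> g (h z) + u \<bullet> (y - h z) - \<rho> / 2 * (norm (y - h z))\<^sup>2) \<and> u \<bullet> u \<le> L\<^sup>2 \<and>
       (\<forall>y\<in>D. R y \<ge> R (h z) + ((2 * \<rho>) *\<^sub>R (z - h z) - u) \<bullet> (y - h z))"
proof -
  obtain u where u: "\<forall>y. g y \<ge> g (h z) + u \<bullet> (y - h z) - \<rho> / 2 * (norm (y - h z))\<^sup>2"
     "\<forall>y\<in>D. R y \<ge> R (h z) + ((2 * \<rho>) *\<^sub>R (z - h z) - u) \<bullet> (y - h z)"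
    using subgradient_sum_split[OF g D_R(1) h_D[of z] D_R(2), of "(2 * \<rho>) *\<^sub>R (z - h z)"] h_ineq[of _ z] by auto
  then show ?thesis using weak_subgradient_norm_le[OF lip, of "h z" u \<rho>] by blast
qed

end

section \<open>Integrating out the samples\<close>

lemma prox_sgm_cong: "(\<And>i. i < t \<Longrightarrow> s i = s' i) \<Longrightarrow> prox_sgm r G \<alpha> x0 s t = prox_sgm r G \<alpha> x0 s' t"
  by (induction t) auto

locale sgm_process = weakly_convex_composite r g \<rho> L x0
  for r :: "'a::euclidean_space \<Rightarrow> ereal" and g \<rho> L x0 +
  fixes P :: "'w measure" and U :: "'a set" and G :: "'a \<Rightarrow> 'w \<Rightarrow> 'a" and \<alpha> :: real and T :: nat
  assumes prob: "prob_space P" and U: "open U" "effective_domain r \<subseteq> U"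
    and G_meas: "(\<lambda>(x, w). G x w) \<in> borel_measurable (restrict_space borel U \<Otimes>\<^sub>M P)"
    and G_mean: "\<And>x. x \<in> U \<Longrightarrow> integrable P (G x) \<and> (LINT w|P. G x w) \<in> subdifferential g x"
    and G_sq: "\<And>x. x \<in> effective_domain r \<Longrightarrow>
          integrable P (\<lambda>w. (norm (G x w))\<^sup>2) \<and> (LINT w|P. (norm (G x w))\<^sup>2) \<le> L\<^sup>2"
    and \<alpha>: "0 < \<alpha>"
begin

sublocale P: prob_space P by (rule prob)
sublocale PP: product_prob_space "\<lambda>_. P" "{..T}" by unfold_locales

abbreviation "PX \<equiv> PiM {..T} (\<lambda>_. P)"

lemma prob_PX: "measure PX (space PX) = 1"
  by (rule prob_space.prob_space, rule prob_space_PiM, rule prob)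

definition "X t \<omega> = prox_sgm r G (\<lambda>_. \<alpha>) x0 \<omega> t"
definition "Gt t \<omega> = G (X t \<omega>) (\<omega> t)"
definition "v x = (LINT w|P. G x w)"

lemma X_0: "X 0 \<omega> = x0" and X_Suc: "X (Suc t) \<omega> = prox \<alpha> r (X t \<omega> - \<alpha> *\<^sub>R Gt t \<omega>)"
  unfolding X_def Gt_def by simp_all

lemma X_D: "X t \<omega> \<in> D"
  by (cases t) (simp_all add: X_0 X_Suc x0 prox_r(1) \<alpha>)

lemma X_U: "X t \<omega> \<in> U" using X_D U by auto

lemma X_upd: "t \<le> i \<Longrightarrow> X t ((fun_upd \<omega> i y)) = X t \<omega>"
  unfolding X_def by (intro prox_sgm_cong) auto

lemma cont_prox: "continuous_on UNIV (prox \<alpha> r)"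
  by (rule lipschitz_on_continuous_on[where L = 2], rule lipschitz_onI) (use prox_r_lipschitz[OF \<alpha>] in \<open>auto simp: dist_norm\<close>)

lemma cont_h: "continuous_on UNIV h"
  by (rule lipschitz_on_continuous_on[where L = 2], rule lipschitz_onI) (use h_lipschitz in \<open>auto simp: dist_norm\<close>)

lemma X_Gt_meas: "t \<le> Suc T \<Longrightarrow> X t \<in> borel_measurable PX" "t \<le> T \<Longrightarrow> Gt t \<in> borel_measurable PX"
proof -
  have step: "Gt t \<in> borel_measurable PX" if "X t \<in> borel_measurable PX" "t \<le> T" for t
  proof -
    have "(\<lambda>\<omega>. (X t \<omega>, \<omega> t)) \<in> measurable PX (restrict_space borel U \<Otimes>\<^sub>M P)"
      using that X_U by (intro measurable_Pair measurable_restrict_space2 measurable_component_singleton) auto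
    from measurable_compose[OF this G_meas] show ?thesis unfolding Gt_def[abs_def] by simp
  qed
  have X: "X t \<in> borel_measurable PX" if "t \<le> Suc T" for t using that
  proof (induction t)
    case 0 then show ?case by (simp add: X_0[abs_def])
  next
    case (Suc t)
    then have "X t \<in> borel_measurable PX" "Gt t \<in> borel_measurable PX" using step by auto
    then have "(\<lambda>\<omega>. X t \<omega> - \<alpha> *\<^sub>R Gt t \<omega>) \<in> borel_measurable PX" by measurable
    from borel_measurable_continuous_on[OF cont_prox this] show ?case unfolding X_Suc[abs_def] .
  qed
  show "t \<le> Suc T \<Longrightarrow> X t \<in> borel_measurable PX" by (rule X)
  show "t \<le> T \<Longrightarrow> Gt t \<in> borel_measurable PX" by (rule step) (auto intro: X)
qed

lemma h_meas: "f \<in> borel_measurable N \<Longrightarrow> (\<lambda>\<omega>. h (f \<omega>)) \<in> borel_measurable N"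
  by (rule borel_measurable_continuous_on[OF cont_h])

lemma v_meas: assumes "t \<le> T" shows "(\<lambda>\<omega>. v (X t \<omega>)) \<in> borel_measurable PX"
proof -
  have "(\<lambda>x. LINT w|P. (\<lambda>(x, w). G x w) (x, w)) \<in> borel_measurable (restrict_space borel U)"
    using P.borel_measurable_lebesgue_integral[of "\<lambda>x w. G x w" "restrict_space borel U"] G_meas by simp
  moreover have "X t \<in> measurable PX (restrict_space borel U)"
    using X_Gt_meas(1)[of t] assms X_U by (intro measurable_restrict_space2) auto
  ultimately have "(\<lambda>\<omega>. LINT w|P. (\<lambda>(x, w). G x w) (X t \<omega>, w)) \<in> borel_measurable PX"
    by (rule measurable_compose[rotated])
  then show ?thesis unfolding v_def by simp
qed

lemma v_sub: "g y \<ge> g (X t \<omega>) + v (X t \<omega>) \<bullet> (y - X t \<omega>) - \<rho> / 2 * (norm (y - X t \<omega>))\<^sup>2"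
  unfolding v_def using subdifferential_global[OF g] G_mean X_U by blast

lemma v_norm: "v (X t \<omega>) \<bullet> v (X t \<omega>) \<le> L\<^sup>2"
  by (rule weak_subgradient_norm_le[OF lip]) (rule v_sub)

text \<open>Integrating over the sample of time \<open>t\<close> first turns a bound for the conditional expectation into one for the
  expectation.\<close>

lemma fubini_fresh:
  fixes F :: "(nat \<Rightarrow> 'w) \<Rightarrow> real"
  assumes t: "t \<le> T" and F: "integrable PX F" and le: "\<And>\<omega>. (LINT y|P. F ((fun_upd \<omega> t y))) \<le> 0"
  shows "(LINT \<omega>|PX. F \<omega>) \<le> 0"
proof -
  have ins: "insert t ({..T} - {t}) = {..T}" using t by auto
  have "(LINT \<omega>|PX. F \<omega>) = (LINT \<omega>|PiM ({..T} - {t}) (\<lambda>_. P). (LINT y|P. F ((fun_upd \<omega> t y))))"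
    using PP.product_integral_insert[of "{..T} - {t}" t F] F unfolding ins by simp
  also have "\<dots> \<le> 0"
  proof -
    have "0 \<le> (LINT \<omega>|PiM ({..T} - {t}) (\<lambda>_. P). - (LINT y|P. F ((fun_upd \<omega> t y))))"
      by (rule Bochner_Integration.integral_nonneg) (use le in simp)
    then show ?thesis by simp
  qed
  finally show ?thesis .
qed

definition "sq_int f \<longleftrightarrow> f \<in> borel_measurable PX \<and> integrable PX (\<lambda>\<omega>. f \<omega> \<bullet> (f \<omega> :: 'a))"

lemma sq_int_dom:
  assumes "f \<in> borel_measurable PX" "integrable PX b" "\<And>\<omega>. \<omega> \<in> space PX \<Longrightarrow> f \<omega> \<bullet> f \<omega> \<le> b \<omega>"
  shows "sq_int f"
  unfolding sq_int_def
proof (intro conjI assms(1))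
  show "integrable PX (\<lambda>\<omega>. f \<omega> \<bullet> f \<omega>)"
  proof (rule Bochner_Integration.integrable_bound[OF assms(2)])
    show "(\<lambda>\<omega>. f \<omega> \<bullet> f \<omega>) \<in> borel_measurable PX" using assms(1) by simp
    show "AE \<omega> in PX. norm (f \<omega> \<bullet> f \<omega>) \<le> norm (b \<omega>)"
    proof (intro AE_I2)
      fix \<omega> assume "\<omega> \<in> space PX"
      from assms(3)[OF this] show "norm (f \<omega> \<bullet> f \<omega>) \<le> norm (b \<omega>)"
        unfolding real_norm_def using inner_ge_zero[of "f \<omega>"] by linarith
    qed
  qed
qed

lemma sq_int_inner: assumes "sq_int f" "sq_int k" shows "integrable PX (\<lambda>\<omega>. f \<omega> \<bullet> k \<omega>)"
proof (rule Bochner_Integration.integrable_bound[of _ "\<lambda>\<omega>. f \<omega> \<bullet> f \<omega> + k \<omega> \<bullet> k \<omega>"])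
  show "integrable PX (\<lambda>\<omega>. f \<omega> \<bullet> f \<omega> + k \<omega> \<bullet> k \<omega>)" using assms unfolding sq_int_def by auto
  show "(\<lambda>\<omega>. f \<omega> \<bullet> k \<omega>) \<in> borel_measurable PX" using assms unfolding sq_int_def by auto
  have bd: "\<bar>a \<bullet> b\<bar> \<le> a \<bullet> a + b \<bullet> b" for a b :: 'a
  proof -
    have "0 \<le> (a - b) \<bullet> (a - b)" "0 \<le> (a + b) \<bullet> (a + b)" "0 \<le> a \<bullet> a" "0 \<le> b \<bullet> b" by simp_all
    then show ?thesis unfolding inner_diff_left inner_diff_right inner_add_left inner_add_right inner_commute[of b a] by linarith
  qed
  show "AE \<omega> in PX. norm (f \<omega> \<bullet> k \<omega>) \<le> norm (f \<omega> \<bullet> f \<omega> + k \<omega> \<bullet> k \<omega>)"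
    unfolding real_norm_def by (intro AE_I2 order_trans[OF bd abs_ge_self])
qed

lemma sq_int_add: assumes "sq_int f" "sq_int k" shows "sq_int (\<lambda>\<omega>. f \<omega> + k \<omega>)"
  using assms sq_int_inner[OF assms] sq_int_inner[OF assms(2,1)] unfolding sq_int_def
  by (auto simp: inner_add_left inner_add_right)

lemma sq_int_scale: assumes "sq_int f" shows "sq_int (\<lambda>\<omega>. c *\<^sub>R f \<omega>)"
  using assms unfolding sq_int_def by auto

lemma sq_int_diff: assumes "sq_int f" "sq_int k" shows "sq_int (\<lambda>\<omega>. f \<omega> - k \<omega>)"
  using sq_int_add[OF assms(1) sq_int_scale[OF assms(2), of "-1"]] by simp

lemma sq_int_const: "sq_int (\<lambda>\<omega>. c)" unfolding sq_int_def by simp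

lemma sq_int_lip:
  assumes f: "sq_int f" and q: "continuous_on UNIV q" "\<And>x y. norm (q x - q y) \<le> 2 * norm (x - (y::'a))"
  shows "sq_int (\<lambda>\<omega>. q (f \<omega>))"
proof -
  have m: "f \<in> borel_measurable PX" using f unfolding sq_int_def by simp
  have "sq_int (\<lambda>\<omega>. q (f \<omega>) - q 0)"
  proof (rule sq_int_dom[of _ "\<lambda>\<omega>. 4 * (f \<omega> \<bullet> f \<omega>)"])
    show "(\<lambda>\<omega>. q (f \<omega>) - q 0) \<in> borel_measurable PX" using borel_measurable_continuous_on[OF q(1) m] by simp
    show "integrable PX (\<lambda>\<omega>. 4 * (f \<omega> \<bullet> f \<omega>))" using f unfolding sq_int_def by simp
    fix \<omega>
    have "(norm (q (f \<omega>) - q 0))\<^sup>2 \<le> (2 * norm (f \<omega>))\<^sup>2" using q(2)[of "f \<omega>" 0] by (intro power_mono) auto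
    then show "(q (f \<omega>) - q 0) \<bullet> (q (f \<omega>) - q 0) \<le> 4 * (f \<omega> \<bullet> f \<omega>)"
      unfolding power2_norm_eq_inner[symmetric] by (simp add: power_mult_distrib)
  qed
  from sq_int_add[OF this sq_int_const[of "q 0"]] show ?thesis by simp
qed

lemma Gt_sq: assumes t: "t \<le> T" shows "sq_int (Gt t)"
proof -
  have ins: "insert t ({..T} - {t}) = {..T}" using t by auto
  have meas: "(\<lambda>\<omega>. ennreal (Gt t \<omega> \<bullet> Gt t \<omega>)) \<in> borel_measurable PX" using X_Gt_meas(2)[OF t] by measurable
  have "(\<integral>\<^sup>+\<omega>. ennreal (Gt t \<omega> \<bullet> Gt t \<omega>) \<partial>PX)
     = (\<integral>\<^sup>+\<omega>. \<integral>\<^sup>+y. ennreal (Gt t ((fun_upd \<omega> t y)) \<bullet> Gt t ((fun_upd \<omega> t y))) \<partial>P \<partial>PiM ({..T} - {t}) (\<lambda>_. P))"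
    using PP.product_nn_integral_insert[of "{..T} - {t}" t "\<lambda>\<omega>. ennreal (Gt t \<omega> \<bullet> Gt t \<omega>)"] meas unfolding ins by simp
  also have "\<dots> \<le> (\<integral>\<^sup>+\<omega>. ennreal (L\<^sup>2) \<partial>PiM ({..T} - {t}) (\<lambda>_. P))"
  proof (intro nn_integral_mono)
    fix \<omega>
    have "Gt t ((fun_upd \<omega> t y)) = G (X t \<omega>) y" for y unfolding Gt_def by (simp add: X_upd)
    moreover have "(\<integral>\<^sup>+y. ennreal (G (X t \<omega>) y \<bullet> G (X t \<omega>) y) \<partial>P) = ennreal (LINT y|P. (norm (G (X t \<omega>) y))\<^sup>2)"
      unfolding power2_norm_eq_inner[symmetric] using G_sq[OF X_D] by (intro nn_integral_eq_integral) auto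
    ultimately show "(\<integral>\<^sup>+y. ennreal (Gt t ((fun_upd \<omega> t y)) \<bullet> Gt t ((fun_upd \<omega> t y))) \<partial>P) \<le> ennreal (L\<^sup>2)"
      using G_sq[OF X_D, of t \<omega>] by (simp add: ennreal_leI)
  qed
  also have "\<dots> < \<infinity>"
  proof -
    have "prob_space (PiM ({..T} - {t}) (\<lambda>_. P))" by (rule prob_space_PiM) (rule prob)
    from prob_space.emeasure_space_1[OF this] show ?thesis by simp
  qed
  finally have fin: "(\<integral>\<^sup>+\<omega>. ennreal (Gt t \<omega> \<bullet> Gt t \<omega>) \<partial>PX) < \<infinity>" .
  show ?thesis unfolding sq_int_def
  proof (intro conjI X_Gt_meas(2)[OF t] integrableI_nonneg)
    show "(\<lambda>\<omega>. Gt t \<omega> \<bullet> Gt t \<omega>) \<in> borel_measurable PX" using X_Gt_meas(2)[OF t] by simp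
  qed (use fin in simp_all)
qed

lemma X_sq: "t \<le> Suc T \<Longrightarrow> sq_int (X t)"
proof (induction t)
  case 0 then show ?case using sq_int_const by (simp add: X_0[abs_def])
next
  case (Suc t)
  then have "sq_int (\<lambda>\<omega>. X t \<omega> - \<alpha> *\<^sub>R Gt t \<omega>)" by (intro sq_int_diff sq_int_scale Gt_sq) auto
  then show ?case unfolding X_Suc[abs_def] by (rule sq_int_lip[OF _ cont_prox prox_r_lipschitz[OF \<alpha>]])
qed

lemma hX_sq: "t \<le> Suc T \<Longrightarrow> sq_int (\<lambda>\<omega>. h (X t \<omega>))"
  by (rule sq_int_lip[OF X_sq cont_h h_lipschitz])

lemma v_sq: "t \<le> T \<Longrightarrow> sq_int (\<lambda>\<omega>. v (X t \<omega>))"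
  by (rule sq_int_dom[of _ "\<lambda>_. L\<^sup>2"]) (auto intro: v_meas v_norm)

lemma E_noise:
  assumes t: "t \<le> T" and c: "\<And>\<omega> y. c ((fun_upd \<omega> t y)) = c \<omega>"
  shows "(LINT y|P. c ((fun_upd \<omega> t y)) \<bullet> (Gt t ((fun_upd \<omega> t y)) - v (X t ((fun_upd \<omega> t y))))) = 0"
    "integrable P (\<lambda>y. c ((fun_upd \<omega> t y)) \<bullet> (Gt t ((fun_upd \<omega> t y)) - v (X t ((fun_upd \<omega> t y)))))"
proof -
  have i: "integrable P (G (X t \<omega>))" using G_mean X_U by blast
  have *: "c ((fun_upd \<omega> t y)) \<bullet> (Gt t ((fun_upd \<omega> t y)) - v (X t ((fun_upd \<omega> t y)))) = c \<omega> \<bullet> (G (X t \<omega>) y - v (X t \<omega>))" for y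
    unfolding Gt_def by (simp add: X_upd c)
  show "integrable P (\<lambda>y. c ((fun_upd \<omega> t y)) \<bullet> (Gt t ((fun_upd \<omega> t y)) - v (X t ((fun_upd \<omega> t y)))))"
    unfolding * using i by (intro integrable_inner_right Bochner_Integration.integrable_diff) auto
  have "(LINT y|P. G (X t \<omega>) y - v (X t \<omega>)) = 0" using i unfolding v_def by (simp add: P.prob_space)
  then show "(LINT y|P. c ((fun_upd \<omega> t y)) \<bullet> (Gt t ((fun_upd \<omega> t y)) - v (X t ((fun_upd \<omega> t y))))) = 0"
    unfolding * using i by (subst integral_inner_right) auto
qed

lemma E_second_moment: assumes t: "t \<le> T" shows "(LINT \<omega>|PX. Gt t \<omega> \<bullet> Gt t \<omega> - L\<^sup>2) \<le> 0"
proof (rule fubini_fresh[OF t])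
  show "integrable PX (\<lambda>\<omega>. Gt t \<omega> \<bullet> Gt t \<omega> - L\<^sup>2)" using Gt_sq[OF t] unfolding sq_int_def by simp
  fix \<omega>
  have "Gt t ((fun_upd \<omega> t y)) = G (X t \<omega>) y" for y unfolding Gt_def by (simp add: X_upd)
  then show "(LINT y|P. Gt t ((fun_upd \<omega> t y)) \<bullet> Gt t ((fun_upd \<omega> t y)) - L\<^sup>2) \<le> 0"
    using G_sq[OF X_D, of t \<omega>] unfolding power2_norm_eq_inner by (simp add: P.prob_space)
qed

lemma E_martingale: assumes t: "t \<le> T" shows "(LINT \<omega>|PX. \<mu> * ((v (X t \<omega>) - Gt t \<omega>) \<bullet> (X t \<omega> - h (X t \<omega>)))) \<le> 0"
proof (rule fubini_fresh[OF t])
  have t': "t \<le> Suc T" using t by simp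
  show "integrable PX (\<lambda>\<omega>. \<mu> * ((v (X t \<omega>) - Gt t \<omega>) \<bullet> (X t \<omega> - h (X t \<omega>))))"
    by (intro integrable_mult_right sq_int_inner sq_int_diff v_sq Gt_sq X_sq hX_sq t t')
  fix \<omega>
  have eq: "\<mu> * ((v (X t \<omega>) - Gt t \<omega>) \<bullet> (X t \<omega> - h (X t \<omega>))) = ((- \<mu>) *\<^sub>R (X t \<omega> - h (X t \<omega>))) \<bullet> (Gt t \<omega> - v (X t \<omega>))" for \<omega>
    by (simp add: inner_diff_right inner_diff_left inner_commute algebra_simps)
  show "(LINT y|P. \<mu> * ((v (X t ((fun_upd \<omega> t y))) - Gt t ((fun_upd \<omega> t y))) \<bullet> (X t ((fun_upd \<omega> t y)) - h (X t ((fun_upd \<omega> t y)))))) \<le> 0"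
    unfolding eq
    by (rule eq_refl, rule E_noise(1)[OF t, where c = "\<lambda>\<omega>. (- \<mu>) *\<^sub>R (X t \<omega> - h (X t \<omega>))" and \<omega> = \<omega>]) (simp add: X_upd)
qed

text \<open>The noise coefficient \<open>c\<close> contains a chosen subgradient of \<open>g\<close> and need not be measurable in the past. This is
  harmless because the noise term is only integrated over the fresh sample, with the past fixed.\<close>

lemma E_step:
  fixes A B :: "(nat \<Rightarrow> 'w) \<Rightarrow> real"
  assumes t: "t \<le> T" and c: "\<And>\<omega> y. c ((fun_upd \<omega> t y)) = c \<omega>" and A: "integrable PX A" and B: "integrable PX B"
    and rest: "(LINT \<omega>|PX. B \<omega>) \<le> 0"
    and le: "\<And>\<omega>. A \<omega> \<le> B \<omega> + c \<omega> \<bullet> (Gt t \<omega> - v (X t \<omega>))"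
  shows "(LINT \<omega>|PX. A \<omega>) \<le> 0"
proof -
  have "(LINT \<omega>|PX. A \<omega> - B \<omega>) \<le> 0"
  proof (rule fubini_fresh[OF t])
    fix \<omega>
    show "(LINT y|P. A ((fun_upd \<omega> t y)) - B ((fun_upd \<omega> t y))) \<le> 0"
    proof (cases "integrable P (\<lambda>y. A ((fun_upd \<omega> t y)) - B ((fun_upd \<omega> t y)))")
      case True
      have "(LINT y|P. A ((fun_upd \<omega> t y)) - B ((fun_upd \<omega> t y))) \<le> (LINT y|P. c ((fun_upd \<omega> t y)) \<bullet> (Gt t ((fun_upd \<omega> t y)) - v (X t ((fun_upd \<omega> t y)))))"
      proof (rule integral_mono[OF True E_noise(2)[where c = c and \<omega> = \<omega>, OF t c]])
        fix y
        show "A (fun_upd \<omega> t y) - B (fun_upd \<omega> t y) \<le> c (fun_upd \<omega> t y) \<bullet> (Gt t (fun_upd \<omega> t y) - v (X t (fun_upd \<omega> t y)))"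
          using le[of "fun_upd \<omega> t y"] by linarith
      qed
      also have "\<dots> = 0" by (rule E_noise(1)[where c = c and \<omega> = \<omega>, OF t c])
      finally show ?thesis .
    qed (simp add: not_integrable_integral_eq)
  qed (use A B in simp)
  then show ?thesis using A B rest by simp
qed

end

section \<open>The expected sum of squared gradients\<close>

text \<open>With \<open>b = N\<alpha>/2\<close> the claim is \<open>(1 - \<alpha>)\<^sup>N \<le> 1 - b\<close>, which follows from \<open>exp (- 2 b) \<le> 1 - b\<close> for
  \<open>b \<le> 3/4\<close>.\<close>

lemma plain_budget:
  fixes \<alpha> :: real
  assumes \<alpha>: "0 < \<alpha>" and N: "2 \<le> N" "real N * \<alpha>\<^sup>2 \<le> 1" and small: "real N * \<alpha> \<le> 3/2 \<or> N \<le> 3"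
  shows "2 * (\<Sum>j<N. 1 - (1 - \<alpha>)^j) \<le> N"
proof -
  have "2 * \<alpha>\<^sup>2 \<le> real N * \<alpha>\<^sup>2" using N by (intro mult_right_mono) auto
  then have "\<alpha>\<^sup>2 \<le> 1\<^sup>2" using N by simp
  then have \<alpha>1: "\<alpha> \<le> 1" using power2_le_imp_le[of \<alpha> 1] by simp
  consider "real N * \<alpha> \<le> 3/2" | "N = 2" | "N = 3" using small N by fastforce
  then show ?thesis
  proof cases
    case 1
    define b where "b = real N * \<alpha> / 2"
    have b: "0 \<le> b" "b \<le> 3/4" unfolding b_def using \<alpha> by simp (use 1 in linarith)
    have "(1 - \<alpha>)^N \<le> exp (- \<alpha>)^N" using \<alpha>1 exp_ge_add_one_self[of "- \<alpha>"] by (intro power_mono) auto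
    also have "\<dots> = exp (- (2 * b))" unfolding b_def by (simp add: exp_of_nat_mult[symmetric])
    also have "\<dots> \<le> 1 - b"
    proof -
      have e: "1 + b + b\<^sup>2 / 2 \<le> exp b" using exp_lower_Taylor_quadratic[OF b(1)] .
      have "(1 + b + b\<^sup>2 / 2)\<^sup>2 \<le> (exp b)\<^sup>2" using e b by (intro power_mono) auto
      also have "(exp b)\<^sup>2 = exp (2 * b)" by (simp add: exp_double)
      finally have "(1 - b) * (1 + b + b\<^sup>2 / 2)\<^sup>2 \<le> (1 - b) * exp (2 * b)" using b by (intro mult_left_mono) auto
      moreover have "(1 - b) * (1 + b + b\<^sup>2 / 2)\<^sup>2 = 1 + b * (1 - (b\<^sup>2 + 3/4 * b^3 + 1/4 * b^4))"
        by (simp add: power2_eq_square power3_eq_cube power4_eq_xxxx field_simps)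
      moreover have "b\<^sup>2 + 3/4 * b^3 + 1/4 * b^4 \<le> (3/4)\<^sup>2 + 3/4 * (3/4)^3 + 1/4 * (3/4)^4"
        using b by (intro add_mono mult_left_mono power_mono) auto
      then have "0 \<le> 1 - (b\<^sup>2 + 3/4 * b^3 + 1/4 * b^4)" by (simp add: power2_eq_square power3_eq_cube power4_eq_xxxx)
      then have "0 \<le> b * (1 - (b\<^sup>2 + 3/4 * b^3 + 1/4 * b^4))" using b by simp
      ultimately have "1 \<le> (1 - b) * exp (2 * b)" by linarith
      then show ?thesis by (simp add: exp_minus field_simps)
    qed
    finally have pw: "(1 - \<alpha>)^N \<le> 1 - b" .
    have "\<alpha> * (\<Sum>j<N. (1 - \<alpha>)^j) = 1 - (1 - \<alpha>)^N" using one_diff_power_eq[of "1 - \<alpha>" N] by simp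
    then have "\<alpha> * (real N / 2) \<le> \<alpha> * (\<Sum>j<N. (1 - \<alpha>)^j)" using pw unfolding b_def by (simp add: mult.commute)
    then have "real N / 2 \<le> (\<Sum>j<N. (1 - \<alpha>)^j)" using \<alpha> by simp
    then show ?thesis by (simp add: sum_subtractf)
  next
    case 2 then show ?thesis using \<alpha>1 by (simp add: numeral_2_eq_2)
  next
    case 3
    have "\<alpha>\<^sup>2 \<le> (3/5)\<^sup>2" using N 3 by (simp add: power2_eq_square)
    then have "\<alpha> \<le> 3/5" using power2_le_imp_le[of \<alpha> "3/5"] by simp
    then have "(9/10)\<^sup>2 \<le> (3/2 - \<alpha>)\<^sup>2" by (intro power_mono) auto
    then show ?thesis using 3 by (simp add: numeral_3_eq_3 power2_eq_square algebra_simps)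
  qed
qed

context sgm_process
begin

text \<open>Multiplying all points and both functions by \<open>\<kappa> = 2\<rho>\<close> leaves subgradients unchanged and turns the weak convexity
  parameter into \<open>1/2\<close>. Primed names are the rescaled quantities.\<close>

abbreviation "\<kappa> \<equiv> 2 * \<rho>"
definition "gs y = \<kappa> * g ((1 / \<kappa>) *\<^sub>R y)"
definition "Rs y = \<kappa> * R ((1 / \<kappa>) *\<^sub>R y)"
definition "Ds = (\<lambda>x. \<kappa> *\<^sub>R x) ` D"
definition "ms = \<kappa> * m"
definition "sub z = (SOME u. (\<forall>y. g y \<ge> g (h z) + u \<bullet> (y - h z) - \<rho> / 2 * (norm (y - h z))\<^sup>2) \<and> u \<bullet> u \<le> L\<^sup>2 \<and>
       (\<forall>y\<in>D. R y \<ge> R (h z) + ((2 * \<rho>) *\<^sub>R (z - h z) - u) \<bullet> (y - h z)))"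
abbreviation "x' t \<omega> \<equiv> \<kappa> *\<^sub>R X t \<omega>"
abbreviation "h' t \<omega> \<equiv> \<kappa> *\<^sub>R h (X t \<omega>)"
abbreviation "v' t \<omega> \<equiv> v (X t \<omega>)"
abbreviation "u' t \<omega> \<equiv> sub (X t \<omega>)"
definition "s' t \<omega> = (1 / \<alpha>) *\<^sub>R (X (t - 1) \<omega> - X t \<omega>) - Gt (t - 1) \<omega>"
abbreviation "gap' t \<omega> \<equiv> gap gs Rs ms (x' t \<omega>) (h' t \<omega>)"
abbreviation "d' t \<omega> \<equiv> \<kappa> * \<alpha> / 2 * ((x' t \<omega> - h' t \<omega>) \<bullet> (x' t \<omega> - h' t \<omega>))"
abbreviation "\<Psi>' cg ce cp cr t \<omega> \<equiv> Lyap gs Rs ms (\<kappa> * \<alpha>) cg ce cp cr (x' (t - 1) \<omega>) (h' (t - 1) \<omega>) (x' t \<omega>) (h' t \<omega>) (s' t \<omega>)"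

lemma unscale: "(1 / \<kappa>) *\<^sub>R (\<kappa> *\<^sub>R y) = (y :: 'a)" using \<rho> by simp

lemma scaled [simp]: "gs (\<kappa> *\<^sub>R y) = \<kappa> * g y" "Rs (\<kappa> *\<^sub>R y) = \<kappa> * R y"
  unfolding gs_def Rs_def unscale by simp_all

lemma sq_scale: "1/4 * ((\<kappa> *\<^sub>R y - \<kappa> *\<^sub>R x) \<bullet> (\<kappa> *\<^sub>R y - \<kappa> *\<^sub>R x)) = \<kappa> * (\<rho> / 2 * (norm (y - x))\<^sup>2)" for x y :: 'a
  unfolding scaleR_right_diff_distrib[symmetric] power2_norm_eq_inner by (simp add: power2_eq_square)

lemma in_scale: "z \<bullet> (\<kappa> *\<^sub>R y - \<kappa> *\<^sub>R x) = \<kappa> * (z \<bullet> (y - x))" for x y z :: 'a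
  unfolding scaleR_right_diff_distrib[symmetric] by simp

lemma wc_scale:
  assumes "\<And>y. g y \<ge> g x + z \<bullet> (y - x) - \<rho> / 2 * (norm (y - x))\<^sup>2"
  shows "wc_subgrad gs Ds (\<kappa> *\<^sub>R x) z"
  unfolding wc_subgrad_def Ds_def
proof (intro ballI, elim imageE, hypsubst)
  fix y
  have "\<kappa> * (g x + z \<bullet> (y - x) - \<rho> / 2 * (norm (y - x))\<^sup>2) \<le> \<kappa> * g y" using assms[of y] \<rho> by (intro mult_left_mono) auto
  then show "gs (\<kappa> *\<^sub>R y) \<ge> gs (\<kappa> *\<^sub>R x) + z \<bullet> (\<kappa> *\<^sub>R y - \<kappa> *\<^sub>R x) - 1/4 * ((\<kappa> *\<^sub>R y - \<kappa> *\<^sub>R x) \<bullet> (\<kappa> *\<^sub>R y - \<kappa> *\<^sub>R x))"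
    unfolding sq_scale unfolding in_scale scaled by (simp only: right_diff_distrib distrib_left)
qed

lemma sub_scale:
  assumes "\<And>y. y \<in> D \<Longrightarrow> R y \<ge> R x + z \<bullet> (y - x)"
  shows "subgrad Rs Ds (\<kappa> *\<^sub>R x) z"
  unfolding subgrad_def Ds_def
proof (intro ballI, elim imageE, hypsubst)
  fix y assume "y \<in> D"
  have "\<kappa> * (R x + z \<bullet> (y - x)) \<le> \<kappa> * R y" using assms[OF \<open>y \<in> D\<close>] \<rho> by (intro mult_left_mono) auto
  then show "Rs (\<kappa> *\<^sub>R y) \<ge> Rs (\<kappa> *\<^sub>R x) + z \<bullet> (\<kappa> *\<^sub>R y - \<kappa> *\<^sub>R x)"
    unfolding in_scale scaled by (simp only: distrib_left)
qed

lemma stage_X: "stage gs Rs Ds L (x' t \<omega>) (h' t \<omega>) (v' t \<omega>) (u' t \<omega>)"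
proof -
  note u = someI_ex[OF split_exists[of "X t \<omega>"], folded sub_def]
  have "x' t \<omega> - h' t \<omega> = (2 * \<rho>) *\<^sub>R (X t \<omega> - h (X t \<omega>))" by (simp add: scaleR_right_diff_distrib)
  then show ?thesis
    unfolding stage_def using wc_scale[OF v_sub] wc_scale[of "h (X t \<omega>)"] sub_scale[of "h (X t \<omega>)"] u v_norm X_D h_D
    by (auto simp: Ds_def)
qed

lemma step_X: "x' t \<omega> - x' (Suc t) \<omega> = (\<kappa> * \<alpha>) *\<^sub>R (Gt t \<omega> + s' (Suc t) \<omega>)"
  unfolding s'_def using \<alpha> by (simp add: scaleR_right_diff_distrib)

lemma sub_X: "subgrad Rs Ds (x' (Suc t) \<omega>) (s' (Suc t) \<omega>)"
proof (rule sub_scale)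
  fix y assume y: "y \<in> D"
  have "s' (Suc t) \<omega> = (1 / \<alpha>) *\<^sub>R (X t \<omega> - \<alpha> *\<^sub>R Gt t \<omega> - X (Suc t) \<omega>)"
    unfolding s'_def using \<alpha> by (simp add: scaleR_right_diff_distrib algebra_simps)
  then show "R y \<ge> R (X (Suc t) \<omega>) + s' (Suc t) \<omega> \<bullet> (y - X (Suc t) \<omega>)"
    using prox_r(2)[OF \<alpha> y, of "X t \<omega> - \<alpha> *\<^sub>R Gt t \<omega>"] unfolding X_Suc by simp
qed

lemma ms_le: "\<forall>y\<in>Ds. ms \<le> gs y + Rs y"
proof
  fix y assume "y \<in> Ds"
  then obtain x where x: "y = \<kappa> *\<^sub>R x" "x \<in> D" unfolding Ds_def by auto
  have "\<kappa> * m \<le> \<kappa> * (g x + R x)" using m_le[OF x(2)] \<rho> by (intro mult_left_mono) auto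
  then show "ms \<le> gs y + Rs y" unfolding x(1) scaled ms_def by (simp only: distrib_left)
qed

lemma gap_env: "gap' t \<omega> = \<kappa> * (env (X t \<omega>) - m)"
  unfolding gap_def scaled env_eq ms_def scaleR_right_diff_distrib[symmetric] power2_norm_eq_inner
  by (simp add: algebra_simps power2_eq_square)

lemma gap_lower: "1/2 * ((x' t \<omega> - h' t \<omega>) \<bullet> (x' t \<omega> - h' t \<omega>)) \<le> gap' t \<omega>"
  using ms_le h_D[of "X t \<omega>"] unfolding gap_def Ds_def by auto

lemma gap_int: assumes t: "t \<le> Suc T" shows "integrable PX (gap' t)"
proof (rule Bochner_Integration.integrable_bound[of _ "\<lambda>\<omega>. \<kappa> * (g x0 + R x0 - m + \<rho> * ((x0 - X t \<omega>) \<bullet> (x0 - X t \<omega>)))"])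
  show "integrable PX (\<lambda>\<omega>. \<kappa> * (g x0 + R x0 - m + \<rho> * ((x0 - X t \<omega>) \<bullet> (x0 - X t \<omega>))))"
    by (intro integrable_mult_right Bochner_Integration.integrable_add sq_int_inner sq_int_diff sq_int_const X_sq t) simp
  have "continuous_on UNIV env" using env_cont by (simp add: continuous_at_imp_continuous_on)
  from borel_measurable_continuous_on[OF this X_Gt_meas(1)[OF t]]
  show "gap' t \<in> borel_measurable PX" unfolding gap_env by measurable
  have "0 \<le> gap' t \<omega>" for \<omega> using order_trans[OF _ gap_lower] by simp
  moreover have "gap' t \<omega> \<le> \<kappa> * (g x0 + R x0 - m + \<rho> * ((x0 - X t \<omega>) \<bullet> (x0 - X t \<omega>)))" for \<omega>
    unfolding gap_env env_eq using h_min[OF x0, of "X t \<omega>"] \<rho>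
    by (intro mult_left_mono) (auto simp: power2_norm_eq_inner[symmetric] norm_minus_commute)
  ultimately show "AE \<omega> in PX. norm (gap' t \<omega>) \<le> norm (\<kappa> * (g x0 + R x0 - m + \<rho> * ((x0 - X t \<omega>) \<bullet> (x0 - X t \<omega>))))"
    by (intro AE_I2) (simp add: order_trans[OF _ abs_ge_self])
qed

lemma sq_ints:
  "t \<le> Suc T \<Longrightarrow> sq_int (x' t)" "t \<le> Suc T \<Longrightarrow> sq_int (h' t)" "1 \<le> t \<Longrightarrow> t \<le> Suc T \<Longrightarrow> sq_int (s' t)"
  unfolding s'_def[abs_def] by (intro sq_int_diff sq_int_scale X_sq hX_sq Gt_sq; simp)+

lemma d_int: "t \<le> Suc T \<Longrightarrow> integrable PX (d' t)"
  by (intro integrable_mult_right sq_int_inner sq_int_diff sq_ints)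

lemma \<Psi>_int: assumes t: "1 \<le> t" "t \<le> Suc T" shows "integrable PX (\<Psi>' cg ce cp cr t)"
proof -
  have t': "t - 1 \<le> Suc T" using t by simp
  have gcont: "continuous_on UNIV g" using lip by (rule lipschitz_on_continuous_on)
  have Lnn: "0 \<le> L" using lip by (rule lipschitz_on_nonneg)
  have "integrable PX (\<lambda>\<omega>. g (X t \<omega>) - g (h (X (t - 1) \<omega>)))"
  proof (rule Bochner_Integration.integrable_bound[of _ "\<lambda>\<omega>. L * (1 + (X t \<omega> - h (X (t - 1) \<omega>)) \<bullet> (X t \<omega> - h (X (t - 1) \<omega>)))"])
    show "integrable PX (\<lambda>\<omega>. L * (1 + (X t \<omega> - h (X (t - 1) \<omega>)) \<bullet> (X t \<omega> - h (X (t - 1) \<omega>))))"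
      using t' t by (intro integrable_mult_right Bochner_Integration.integrable_add sq_int_inner sq_int_diff X_sq hX_sq) auto
    show "(\<lambda>\<omega>. g (X t \<omega>) - g (h (X (t - 1) \<omega>))) \<in> borel_measurable PX"
      using borel_measurable_continuous_on[OF gcont X_Gt_meas(1)[OF t(2)]]
        borel_measurable_continuous_on[OF gcont h_meas[OF X_Gt_meas(1)[OF t']]] by measurable
    show "AE \<omega> in PX. norm (g (X t \<omega>) - g (h (X (t - 1) \<omega>))) \<le> norm (L * (1 + (X t \<omega> - h (X (t - 1) \<omega>)) \<bullet> (X t \<omega> - h (X (t - 1) \<omega>))))"
    proof (intro AE_I2)
      fix \<omega>
      define n where "n = norm (X t \<omega> - h (X (t - 1) \<omega>))"
      have "\<bar>g (X t \<omega>) - g (h (X (t - 1) \<omega>))\<bar> \<le> L * n"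
        using lipschitz_onD[OF lip, of "X t \<omega>" "h (X (t - 1) \<omega>)"] unfolding n_def by (simp add: dist_norm)
      also have "n \<le> 1 + n * n"
      proof -
        have "0 \<le> (n - 1)\<^sup>2" "0 \<le> n" unfolding n_def by simp_all
        then show ?thesis by (simp add: power2_eq_square algebra_simps)
      qed
      then have "L * n \<le> L * (1 + n * n)" using Lnn by (intro mult_left_mono)
      finally show "norm (g (X t \<omega>) - g (h (X (t - 1) \<omega>))) \<le> norm (L * (1 + (X t \<omega> - h (X (t - 1) \<omega>)) \<bullet> (X t \<omega> - h (X (t - 1) \<omega>))))"
        unfolding n_def power2_eq_square[symmetric] power2_norm_eq_inner
        by (simp only: real_norm_def) (erule order_trans[OF _ abs_ge_self])?
    qed
  qed
  then have "integrable PX (\<lambda>\<omega>. cg * (\<kappa> * \<alpha>) * (gs (x' t \<omega>) - gs (h' (t - 1) \<omega>)))"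
    unfolding scaled right_diff_distrib[symmetric, of \<kappa>] by (intro integrable_mult_right)
  note gi = this
  show ?thesis
    unfolding Lyap_def
  proof (intro Bochner_Integration.integrable_add Bochner_Integration.integrable_diff gi gap_int[OF t(2)])
  qed (intro integrable_mult_right Bochner_Integration.integrable_diff sq_int_inner sq_int_diff sq_ints t t')+
qed

end

context sgm_process
begin

lemma E_correction:
  assumes t: "t \<le> T" and nn: "0 \<le> \<kappa>c" "0 \<le> \<tau>" and A: "integrable PX A" and prev: "1 \<le> t \<or> (\<tau> = 0 \<and> \<mu> = 0 \<and> p3 = 0)"
    and le: "\<And>\<omega>. A \<omega> \<le> correction L p1 p2 p3 p4 \<kappa>c \<tau> \<mu> (x' t \<omega>) (h' t \<omega>) (v' t \<omega>) (u' t \<omega>) (s' t \<omega>)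
        (x' (t - 1) \<omega>) (h' (t - 1) \<omega>) (v' (t - 1) \<omega>) (Gt (t - 1) \<omega>) (Gt t \<omega>)"
  shows "(LINT \<omega>|PX. A \<omega>) \<le> 0"
proof -
  define B where "B \<omega> = \<kappa>c * (Gt t \<omega> \<bullet> Gt t \<omega> - L\<^sup>2) + \<tau> * (Gt (t - 1) \<omega> \<bullet> Gt (t - 1) \<omega> - L\<^sup>2)
     + \<mu> * \<kappa> * ((v' (t - 1) \<omega> - Gt (t - 1) \<omega>) \<bullet> (X (t - 1) \<omega> - h (X (t - 1) \<omega>)))" for \<omega>
  define c where "c \<omega> = p1 *\<^sub>R (x' t \<omega> - h' t \<omega>) + p2 *\<^sub>R u' t \<omega> + p3 *\<^sub>R s' t \<omega> + p4 *\<^sub>R v' t \<omega>" for \<omega>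
  have t1: "t - 1 \<le> T" "t - 1 \<le> Suc T" using t by auto
  have i: "integrable PX (\<lambda>\<omega>. Gt t \<omega> \<bullet> Gt t \<omega> - L\<^sup>2)" "integrable PX (\<lambda>\<omega>. Gt (t - 1) \<omega> \<bullet> Gt (t - 1) \<omega> - L\<^sup>2)"
    "integrable PX (\<lambda>\<omega>. \<mu> * \<kappa> * ((v' (t - 1) \<omega> - Gt (t - 1) \<omega>) \<bullet> (X (t - 1) \<omega> - h (X (t - 1) \<omega>))))"
  proof -
    show "integrable PX (\<lambda>\<omega>. Gt t \<omega> \<bullet> Gt t \<omega> - L\<^sup>2)" using Gt_sq[OF t] unfolding sq_int_def by simp
    show "integrable PX (\<lambda>\<omega>. Gt (t - 1) \<omega> \<bullet> Gt (t - 1) \<omega> - L\<^sup>2)" using Gt_sq[OF t1(1)] unfolding sq_int_def by simp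
    show "integrable PX (\<lambda>\<omega>. \<mu> * \<kappa> * ((v' (t - 1) \<omega> - Gt (t - 1) \<omega>) \<bullet> (X (t - 1) \<omega> - h (X (t - 1) \<omega>))))"
      by (intro integrable_mult_right sq_int_inner sq_int_diff v_sq Gt_sq X_sq hX_sq t1)
  qed
  have iB: "integrable PX B" unfolding B_def[abs_def]
    by (intro Bochner_Integration.integrable_add integrable_mult_right i)
  have "(LINT \<omega>|PX. B \<omega>) = \<kappa>c * (LINT \<omega>|PX. Gt t \<omega> \<bullet> Gt t \<omega> - L\<^sup>2) + \<tau> * (LINT \<omega>|PX. Gt (t - 1) \<omega> \<bullet> Gt (t - 1) \<omega> - L\<^sup>2)
     + (LINT \<omega>|PX. \<mu> * \<kappa> * ((v' (t - 1) \<omega> - Gt (t - 1) \<omega>) \<bullet> (X (t - 1) \<omega> - h (X (t - 1) \<omega>))))"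
    unfolding B_def using i
    by (simp only: Bochner_Integration.integral_add Bochner_Integration.integrable_add integrable_mult_right integral_mult_right_zero)
  also have "\<dots> \<le> 0"
    using mult_nonneg_nonpos[OF nn(1) E_second_moment[OF t]] mult_nonneg_nonpos[OF nn(2) E_second_moment[OF t1(1)]]
      E_martingale[OF t1(1), of "\<mu> * \<kappa>"] by linarith
  finally have B0: "(LINT \<omega>|PX. B \<omega>) \<le> 0" .
  have cu: "c ((fun_upd \<omega> t y)) = c \<omega>" for \<omega> y
  proof -
    have "p3 *\<^sub>R s' t ((fun_upd \<omega> t y)) = p3 *\<^sub>R s' t \<omega>"
    proof (cases "1 \<le> t")
      case True
      then have "t - 1 \<noteq> t" "t - 1 \<le> t" by auto
      then show ?thesis unfolding s'_def Gt_def by (simp add: X_upd)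
    qed (use prev in simp)
    then show ?thesis unfolding c_def by (simp add: X_upd)
  qed
  show ?thesis
  proof (rule E_step[OF t cu A iB B0])
    fix \<omega>
    have sc: "\<mu> * ((v' (t - 1) \<omega> - Gt (t - 1) \<omega>) \<bullet> (x' (t - 1) \<omega> - h' (t - 1) \<omega>))
       = \<mu> * \<kappa> * ((v' (t - 1) \<omega> - Gt (t - 1) \<omega>) \<bullet> (X (t - 1) \<omega> - h (X (t - 1) \<omega>)))"
      unfolding scaleR_right_diff_distrib[symmetric] by simp
    show "A \<omega> \<le> B \<omega> + c \<omega> \<bullet> (Gt t \<omega> - v (X t \<omega>))"
      using le[of \<omega>] unfolding correction_def sc B_def c_def by linarith
  qed
qed

abbreviation "cost \<equiv> (\<kappa> * \<alpha>)\<^sup>2 * L\<^sup>2"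

lemma E_interior:
  assumes "interior_step gs Rs Ds L ms (\<kappa> * \<alpha>) cg ce cp cr \<beta>" "1 \<le> t" "t \<le> T"
  shows "(LINT \<omega>|PX. \<Psi>' cg ce cp cr (Suc t) \<omega>) + (LINT \<omega>|PX. d' t \<omega>) \<le> (LINT \<omega>|PX. \<Psi>' cg ce cp cr t \<omega>) + \<beta> * cost"
proof -
  obtain p1 p2 p3 p4 \<kappa>c \<tau> \<mu> where nn: "0 \<le> \<kappa>c" "0 \<le> \<tau>" and st: "\<forall>xp hp vp up x h v u xn hn vn un Gp s G sn.
        stage gs Rs Ds L xp hp vp up \<and> stage gs Rs Ds L x h v u \<and> stage gs Rs Ds L xn hn vn un \<and>
        xp - x = (\<kappa> * \<alpha>) *\<^sub>R (Gp + s) \<and> subgrad Rs Ds x s \<and> x - xn = (\<kappa> * \<alpha>) *\<^sub>R (G + sn) \<and> subgrad Rs Ds xn sn \<longrightarrow>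
        Lyap gs Rs ms (\<kappa> * \<alpha>) cg ce cp cr x h xn hn sn + \<kappa> * \<alpha> / 2 * ((x - h) \<bullet> (x - h))
          \<le> Lyap gs Rs ms (\<kappa> * \<alpha>) cg ce cp cr xp hp x h s + \<beta> * (\<kappa> * \<alpha>)\<^sup>2 * L\<^sup>2
            + correction L p1 p2 p3 p4 \<kappa>c \<tau> \<mu> x h v u s xp hp vp Gp G"
    using assms(1) unfolding interior_step_def by (elim exE conjE) (rule that)
  obtain i where i: "t = Suc i" using assms(2) by (cases t) auto
  have ints: "integrable PX (\<Psi>' cg ce cp cr (Suc t))" "integrable PX (d' t)" "integrable PX (\<Psi>' cg ce cp cr t)"
    by (rule \<Psi>_int d_int; use assms in simp)+
  have "(LINT \<omega>|PX. \<Psi>' cg ce cp cr (Suc t) \<omega> + d' t \<omega> - \<Psi>' cg ce cp cr t \<omega> - \<beta> * cost) \<le> 0"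
  proof (rule E_correction[OF assms(3) nn])
    show "integrable PX (\<lambda>\<omega>. \<Psi>' cg ce cp cr (Suc t) \<omega> + d' t \<omega> - \<Psi>' cg ce cp cr t \<omega> - \<beta> * cost)"
      by (intro Bochner_Integration.integrable_diff Bochner_Integration.integrable_add ints) simp
    fix \<omega>
    have "stage gs Rs Ds L (x' (t - 1) \<omega>) (h' (t - 1) \<omega>) (v' (t - 1) \<omega>) (u' (t - 1) \<omega>) \<and> stage gs Rs Ds L (x' t \<omega>) (h' t \<omega>) (v' t \<omega>) (u' t \<omega>)
      \<and> stage gs Rs Ds L (x' (Suc t) \<omega>) (h' (Suc t) \<omega>) (v' (Suc t) \<omega>) (u' (Suc t) \<omega>) \<and>
        x' (t - 1) \<omega> - x' t \<omega> = (\<kappa> * \<alpha>) *\<^sub>R (Gt (t - 1) \<omega> + s' t \<omega>) \<and> subgrad Rs Ds (x' t \<omega>) (s' t \<omega>)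
      \<and> x' t \<omega> - x' (Suc t) \<omega> = (\<kappa> * \<alpha>) *\<^sub>R (Gt t \<omega> + s' (Suc t) \<omega>) \<and> subgrad Rs Ds (x' (Suc t) \<omega>) (s' (Suc t) \<omega>)"
      using stage_X step_X[of t] step_X[of i] sub_X[of t] sub_X[of i] unfolding i by simp
    from st[rule_format, OF this]
    show "\<Psi>' cg ce cp cr (Suc t) \<omega> + d' t \<omega> - \<Psi>' cg ce cp cr t \<omega> - \<beta> * cost \<le> correction L p1 p2 p3 p4 \<kappa>c \<tau> \<mu> (x' t \<omega>) (h' t \<omega>) (v' t \<omega>) (u' t \<omega>) (s' t \<omega>)
        (x' (t - 1) \<omega>) (h' (t - 1) \<omega>) (v' (t - 1) \<omega>) (Gt (t - 1) \<omega>) (Gt t \<omega>)" unfolding diff_Suc_1 mult.assoc[of \<beta>] by linarith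
  qed (use assms in simp)
  then show ?thesis using ints by (simp add: prob_PX)
qed

lemma E_final:
  assumes "final_step gs Rs Ds L ms (\<kappa> * \<alpha>) cg ce cp cr a p" "1 \<le> t" "t \<le> T"
  shows "a * (LINT \<omega>|PX. gap' (Suc t) \<omega>) + (LINT \<omega>|PX. d' t \<omega>) \<le> (LINT \<omega>|PX. \<Psi>' cg ce cp cr t \<omega>) + p * cost"
proof -
  obtain p1 p2 p3 p4 \<kappa>c \<tau> \<mu> where nn: "0 \<le> \<kappa>c" "0 \<le> \<tau>" and st: "\<forall>xp hp vp up x h v u xn hn vn un Gp s G sn.
        stage gs Rs Ds L xp hp vp up \<and> stage gs Rs Ds L x h v u \<and> stage gs Rs Ds L xn hn vn un \<and>
        xp - x = (\<kappa> * \<alpha>) *\<^sub>R (Gp + s) \<and> subgrad Rs Ds x s \<and> x - xn = (\<kappa> * \<alpha>) *\<^sub>R (G + sn) \<and> subgrad Rs Ds xn sn \<longrightarrow>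
        a * gap gs Rs ms xn hn + \<kappa> * \<alpha> / 2 * ((x - h) \<bullet> (x - h))
          \<le> Lyap gs Rs ms (\<kappa> * \<alpha>) cg ce cp cr xp hp x h s + p * (\<kappa> * \<alpha>)\<^sup>2 * L\<^sup>2
            + correction L p1 p2 p3 p4 \<kappa>c \<tau> \<mu> x h v u s xp hp vp Gp G"
    using assms(1) unfolding final_step_def by (elim exE conjE) (rule that)
  obtain i where i: "t = Suc i" using assms(2) by (cases t) auto
  have ints: "integrable PX (gap' (Suc t))" "integrable PX (d' t)" "integrable PX (\<Psi>' cg ce cp cr t)"
    by (rule \<Psi>_int d_int gap_int; use assms in simp)+
  have "(LINT \<omega>|PX. a * gap' (Suc t) \<omega> + d' t \<omega> - \<Psi>' cg ce cp cr t \<omega> - p * cost) \<le> 0"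
  proof (rule E_correction[OF assms(3) nn])
    show "integrable PX (\<lambda>\<omega>. a * gap' (Suc t) \<omega> + d' t \<omega> - \<Psi>' cg ce cp cr t \<omega> - p * cost)"
      by (intro Bochner_Integration.integrable_diff Bochner_Integration.integrable_add integrable_mult_right ints) simp
    fix \<omega>
    have "stage gs Rs Ds L (x' (t - 1) \<omega>) (h' (t - 1) \<omega>) (v' (t - 1) \<omega>) (u' (t - 1) \<omega>) \<and> stage gs Rs Ds L (x' t \<omega>) (h' t \<omega>) (v' t \<omega>) (u' t \<omega>)
      \<and> stage gs Rs Ds L (x' (Suc t) \<omega>) (h' (Suc t) \<omega>) (v' (Suc t) \<omega>) (u' (Suc t) \<omega>) \<and>
        x' (t - 1) \<omega> - x' t \<omega> = (\<kappa> * \<alpha>) *\<^sub>R (Gt (t - 1) \<omega> + s' t \<omega>) \<and> subgrad Rs Ds (x' t \<omega>) (s' t \<omega>)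
      \<and> x' t \<omega> - x' (Suc t) \<omega> = (\<kappa> * \<alpha>) *\<^sub>R (Gt t \<omega> + s' (Suc t) \<omega>) \<and> subgrad Rs Ds (x' (Suc t) \<omega>) (s' (Suc t) \<omega>)"
      using stage_X step_X[of t] step_X[of i] sub_X[of t] sub_X[of i] unfolding i by simp
    from st[rule_format, OF this]
    show "a * gap' (Suc t) \<omega> + d' t \<omega> - \<Psi>' cg ce cp cr t \<omega> - p * cost \<le> correction L p1 p2 p3 p4 \<kappa>c \<tau> \<mu> (x' t \<omega>) (h' t \<omega>) (v' t \<omega>) (u' t \<omega>) (s' t \<omega>)
        (x' (t - 1) \<omega>) (h' (t - 1) \<omega>) (v' (t - 1) \<omega>) (Gt (t - 1) \<omega>) (Gt t \<omega>)" unfolding mult.assoc[of p] by linarith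
  qed (use assms in simp)
  then show ?thesis using ints by (simp add: prob_PX)
qed

lemma E_initial:
  assumes "initial_step gs Rs Ds L ms (\<kappa> * \<alpha>) cg ce cp cr s" "t \<le> T"
  shows "(LINT \<omega>|PX. \<Psi>' cg ce cp cr (Suc t) \<omega>) + (LINT \<omega>|PX. d' t \<omega>) \<le> (LINT \<omega>|PX. gap' t \<omega>) + s * cost"
proof -
  obtain p1 p2 p4 \<kappa>c where nn: "0 \<le> \<kappa>c" and st: "\<And>x h v u xn hn vn un G sn.
        stage gs Rs Ds L x h v u \<and> stage gs Rs Ds L xn hn vn un \<and> x - xn = (\<kappa> * \<alpha>) *\<^sub>R (G + sn) \<and> subgrad Rs Ds xn sn \<longrightarrow>
        Lyap gs Rs ms (\<kappa> * \<alpha>) cg ce cp cr x h xn hn sn + \<kappa> * \<alpha> / 2 * ((x - h) \<bullet> (x - h))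
          \<le> gap gs Rs ms x h + s * (\<kappa> * \<alpha>)\<^sup>2 * L\<^sup>2 + correction L p1 p2 0 p4 \<kappa>c 0 0 x h v u 0 0 0 0 0 G"
    using assms(1) unfolding initial_step_def by blast
  have ints: "integrable PX (\<Psi>' cg ce cp cr (Suc t))" "integrable PX (d' t)" "integrable PX (gap' t)"
    by (rule \<Psi>_int d_int gap_int; use assms in simp)+
  have "(LINT \<omega>|PX. \<Psi>' cg ce cp cr (Suc t) \<omega> + d' t \<omega> - gap' t \<omega> - s * cost) \<le> 0"
  proof (rule E_correction[OF assms(2) nn, of 0 _ 0 0])
    show "integrable PX (\<lambda>\<omega>. \<Psi>' cg ce cp cr (Suc t) \<omega> + d' t \<omega> - gap' t \<omega> - s * cost)"
      by (intro Bochner_Integration.integrable_diff Bochner_Integration.integrable_add ints) simp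
    fix \<omega>
    have "stage gs Rs Ds L (x' t \<omega>) (h' t \<omega>) (v' t \<omega>) (u' t \<omega>)
      \<and> stage gs Rs Ds L (x' (Suc t) \<omega>) (h' (Suc t) \<omega>) (v' (Suc t) \<omega>) (u' (Suc t) \<omega>)
      \<and> x' t \<omega> - x' (Suc t) \<omega> = (\<kappa> * \<alpha>) *\<^sub>R (Gt t \<omega> + s' (Suc t) \<omega>) \<and> subgrad Rs Ds (x' (Suc t) \<omega>) (s' (Suc t) \<omega>)"
      using stage_X step_X[of t] sub_X[of t] by simp
    from st[rule_format, OF this]
    show "\<Psi>' cg ce cp cr (Suc t) \<omega> + d' t \<omega> - gap' t \<omega> - s * cost \<le> correction L p1 p2 0 p4 \<kappa>c 0 0 (x' t \<omega>) (h' t \<omega>) (v' t \<omega>) (u' t \<omega>) (s' t \<omega>)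
        (x' (t - 1) \<omega>) (h' (t - 1) \<omega>) (v' (t - 1) \<omega>) (Gt (t - 1) \<omega>) (Gt t \<omega>)"
      unfolding diff_Suc_1 mult.assoc[of s] correction_def by simp
  qed (use assms in simp_all)
  then show ?thesis using ints by (simp add: prob_PX)
qed

lemma expected_sum:
  assumes T: "1 \<le> T" and small: "real (Suc T) * (\<kappa> * \<alpha>)\<^sup>2 \<le> 1"
  shows "(\<Sum>t<Suc T. LINT \<omega>|PX. d' t \<omega>) \<le> (LINT \<omega>|PX. gap' 0 \<omega>) + real (Suc T) * cost"
proof -
  define F where "F t = (if t \<le> Suc T then LINT \<omega>|PX. gap' t \<omega> else 0)" for t
  define d where "d t = (if t \<le> T then LINT \<omega>|PX. d' t \<omega> else 0)" for t
  have \<alpha>p: "0 < \<kappa> * \<alpha>" using \<alpha> \<rho> by simp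
  have "1 * (\<kappa> * \<alpha>)\<^sup>2 \<le> real (Suc T) * (\<kappa> * \<alpha>)\<^sup>2" by (intro mult_right_mono) auto
  then have "(\<kappa> * \<alpha>)\<^sup>2 \<le> 1\<^sup>2" using small by simp
  then have \<alpha>1: "\<kappa> * \<alpha> \<le> 1" using power2_le_imp_le[of "\<kappa> * \<alpha>" 1] by simp
  have c0: "0 \<le> cost" by simp
  have gap0: "0 \<le> gap' t \<omega>" for t \<omega> using order_trans[OF _ gap_lower] by simp
  have F0: "0 \<le> F t" for t unfolding F_def using gap0 by (auto intro!: integral_nonneg_AE)
  have dF: "d t \<le> (\<kappa> * \<alpha>) * F t" for t
  proof (cases "t \<le> T")
    case True
    have "(LINT \<omega>|PX. d' t \<omega>) \<le> (LINT \<omega>|PX. (\<kappa> * \<alpha>) * gap' t \<omega>)"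
    proof (rule integral_mono)
      show "integrable PX (d' t)" by (rule d_int) (use True in simp)
      show "integrable PX (\<lambda>\<omega>. (\<kappa> * \<alpha>) * gap' t \<omega>)" by (intro integrable_mult_right gap_int) (use True in simp)
      show "d' t \<omega> \<le> (\<kappa> * \<alpha>) * gap' t \<omega>" for \<omega>
        using mult_left_mono[OF gap_lower[of t \<omega>] less_imp_le[OF \<alpha>p]] by simp
    qed
    then show ?thesis unfolding d_def F_def using True by simp
  qed (use F0[of t] \<alpha>p in \<open>simp add: d_def\<close>)
  have X: "F (Suc t) + d t \<le> F t + 2 * cost" for t
  proof (cases "t \<le> T")
    case True
    have le: "gap' (Suc t) \<omega> \<le> \<Psi>' 0 0 0 0 (Suc t) \<omega>" for \<omega> unfolding Lyap_def by simp
    have "(LINT \<omega>|PX. gap' (Suc t) \<omega>) \<le> (LINT \<omega>|PX. \<Psi>' 0 0 0 0 (Suc t) \<omega>)"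
    proof (rule integral_mono)
      show "integrable PX (gap' (Suc t))" by (rule gap_int) (use True in simp)
      show "integrable PX (\<Psi>' 0 0 0 0 (Suc t))" by (rule \<Psi>_int) (use True in simp_all)
    qed (rule le)
    then show ?thesis unfolding F_def d_def using E_initial[OF plain_step[OF \<alpha>p \<alpha>1] True] True by simp
  next
    case False
    then show ?thesis using F0[of t] c0 unfolding F_def[of "Suc t"] d_def by auto
  qed
  have pw: "(1 - \<kappa> * \<alpha>)^j \<le> 1" "0 \<le> (1 - \<kappa> * \<alpha>)^j" for j using \<alpha>p \<alpha>1 by (simp_all add: power_le_one)
  have res: "(\<Sum>t<Suc T. d t) \<le> F 0 + real (Suc T) * cost"
  proof (cases "4 \<le> Suc T \<and> 3/2 \<le> real (Suc T) * (\<kappa> * \<alpha>)")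
    case True
    then obtain cg ce cp cr \<beta> s p a k w n where "schedule gs Rs Ds L ms (\<kappa> * \<alpha>) (Suc T) cg ce cp cr \<beta> s p a k w n"
      using schedule_exists[OF \<alpha>p ms_le _ small, of L] by blast
    then have N: "Suc T = Suc (Suc n) + k" and st: "interior_step gs Rs Ds L ms (\<kappa> * \<alpha>) cg ce cp cr \<beta>"
        "initial_step gs Rs Ds L ms (\<kappa> * \<alpha>) cg ce cp cr s" "final_step gs Rs Ds L ms (\<kappa> * \<alpha>) cg ce cp cr a p"
      and w: "w 0 = 0" "\<And>j. j < k \<Longrightarrow> w j + (1 - w j) * (\<kappa> * \<alpha>) \<le> w (Suc j)" "\<And>j. j < k \<Longrightarrow> 0 \<le> w j \<and> w j \<le> 1" "w k \<le> a"
      and tot: "s + real n * \<beta> + p + 2 * (\<Sum>j<k. w j) \<le> real (Suc T)"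
      unfolding schedule_def by auto
    have "(\<Sum>t<Suc (Suc n) + k. d t) \<le> F 0 + (s + real n * \<beta> + p + 2 * (\<Sum>j<k. w j)) * cost"
    proof (rule accounting[where F = F and d = d and w = w and \<Psi> = "\<lambda>t. LINT \<omega>|PX. \<Psi>' cg ce cp cr t \<omega>" and a = a and \<alpha> = "\<kappa> * \<alpha>"])
      show "(LINT \<omega>|PX. \<Psi>' cg ce cp cr 1 \<omega>) + d 0 \<le> F 0 + s * cost"
        using E_initial[OF st(2), of 0] unfolding d_def F_def by simp
      show "(LINT \<omega>|PX. \<Psi>' cg ce cp cr (Suc t) \<omega>) + d t \<le> (LINT \<omega>|PX. \<Psi>' cg ce cp cr t \<omega>) + \<beta> * cost" if "1 \<le> t" "t \<le> n" for t
        using E_interior[OF st(1) that(1)] that N unfolding d_def by simp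
      show "a * F (Suc (Suc n)) + d (Suc n) \<le> (LINT \<omega>|PX. \<Psi>' cg ce cp cr (Suc n) \<omega>) + p * cost"
        using E_final[OF st(3), of "Suc n"] N unfolding d_def F_def by simp
    qed (fact X dF c0 w F0)+
    also have "\<dots> \<le> F 0 + real (Suc T) * cost" using tot c0 by (intro add_left_mono mult_right_mono)
    finally show ?thesis unfolding N .
  next
    case False
    let ?w = "\<lambda>j. 1 - (1 - \<kappa> * \<alpha>)^j"
    have combine: "a \<le> f + n * c" if "a \<le> v * f + 2 * c * W" "v * f \<le> 1 * f" "2 * W \<le> n" "0 \<le> c" for a v f c W n :: real
      using that(1,2) mult_left_mono[OF that(3,4)] by (simp add: algebra_simps)
    have tail: "(\<Sum>j<Suc T. d (0 + j)) \<le> ?w (Suc T) * F 0 + 2 * cost * (\<Sum>j<Suc T. ?w j)"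
      by (rule tail_sum[where F = F and d = d and w = ?w and \<alpha> = "\<kappa> * \<alpha>"]) (use X dF c0 F0 pw in \<open>auto simp: algebra_simps\<close>)
    have start: "?w (Suc T) * F 0 \<le> 1 * F 0"
      by (intro mult_right_mono) (use pw(2)[of "Suc T"] F0[of 0] in linarith)+
    have budget: "2 * (\<Sum>j<Suc T. ?w j) \<le> real (Suc T)"
      using False T by (intro plain_budget[OF \<alpha>p _ small]) auto
    show ?thesis using combine[OF tail start budget c0] unfolding add_0 .
  qed
  then show ?thesis unfolding d_def F_def by simp
qed

definition "grad_sq \<omega> t = (norm (gradient env (X t \<omega>)))\<^sup>2"

lemma grad_sq_eq: "d' t \<omega> = \<kappa> * \<alpha> / 2 * grad_sq \<omega> t"
  unfolding grad_sq_def env_gradient power2_norm_eq_inner scaleR_right_diff_distrib by simp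

lemma grad_sq_int: assumes "t \<le> T" shows "integrable PX (\<lambda>\<omega>. grad_sq \<omega> t)"
proof -
  have eq: "(\<lambda>\<omega>. grad_sq \<omega> t) = (\<lambda>\<omega>. 2 / (\<kappa> * \<alpha>) * d' t \<omega>)" unfolding grad_sq_eq using \<rho> \<alpha> by (simp add: field_simps)
  show ?thesis unfolding eq by (intro integrable_mult_right d_int) (use assms in simp)
qed

lemma expected_gradient:
  assumes "1 \<le> T" "real (Suc T) * (\<kappa> * \<alpha>)\<^sup>2 \<le> 1"
  shows "\<alpha> / 2 * (\<Sum>t\<le>T. LINT \<omega>|PX. grad_sq \<omega> t) \<le> (env x0 - m) + real (Suc T) * \<kappa> * \<alpha>\<^sup>2 * L\<^sup>2"
proof -
  have "(\<Sum>t<Suc T. LINT \<omega>|PX. d' t \<omega>) = \<kappa> * (\<alpha> / 2 * (\<Sum>t\<le>T. LINT \<omega>|PX. grad_sq \<omega> t))"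
    unfolding grad_sq_eq lessThan_Suc_atMost by (simp add: sum_distrib_left mult.assoc)
  moreover have "(LINT \<omega>|PX. gap' 0 \<omega>) = \<kappa> * (env x0 - m)" unfolding gap_env by (simp add: X_0 prob_PX)
  moreover have "real (Suc T) * cost = \<kappa> * (real (Suc T) * \<kappa> * \<alpha>\<^sup>2 * L\<^sup>2)" by (simp add: power2_eq_square algebra_simps)
  ultimately have "\<kappa> * (\<alpha> / 2 * (\<Sum>t\<le>T. LINT \<omega>|PX. grad_sq \<omega> t)) \<le> \<kappa> * ((env x0 - m) + real (Suc T) * \<kappa> * \<alpha>\<^sup>2 * L\<^sup>2)"
    using expected_sum[OF assms] by (simp only: distrib_left)
  then show ?thesis using \<rho> by (simp only: mult_le_cancel_left_pos[of \<kappa>]) 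
qed

end

text \<open>The value at the random index is the sum over \<open>t\<close> of indicator times value at \<open>t\<close>, and the two factors are
  independent.\<close>

lemma (in prob_space) integral_random_index:
  fixes f :: "nat \<Rightarrow> 'c \<Rightarrow> real"
  assumes ind: "indep_rvs M (count_space {..T}) \<tau> N Z" and f: "\<And>t. t \<le> T \<Longrightarrow> f t \<in> borel_measurable N"
    and int: "\<And>t. t \<le> T \<Longrightarrow> integrable M (\<lambda>\<omega>. f t (Z \<omega>))"
  shows "integrable M (\<lambda>\<omega>. f (\<tau> \<omega>) (Z \<omega>))"
    "(LINT \<omega>|M. f (\<tau> \<omega>) (Z \<omega>)) = (\<Sum>t\<le>T. measure M {\<omega> \<in> space M. \<tau> \<omega> = t} * (LINT \<omega>|M. f t (Z \<omega>)))"
proof -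
  have \<tau>: "\<tau> \<in> measurable M (count_space {..T})" and Z: "Z \<in> measurable M N"
    and isd: "indep_set {\<tau> -` A \<inter> space M | A. A \<in> sets (count_space {..T})} {Z -` B \<inter> space M | B. B \<in> sets N}"
    using ind unfolding indep_rvs_def by auto
  define I where "I t \<omega> = (indicator {\<omega>. \<tau> \<omega> = t} \<omega> :: real)" for t \<omega>
  have ev: "{\<omega> \<in> space M. \<tau> \<omega> = t} = \<tau> -` {t} \<inter> space M" for t by auto
  have evs: "{\<omega> \<in> space M. \<tau> \<omega> = t} \<in> events" if "t \<le> T" for t
    unfolding ev by (rule measurable_sets[OF \<tau>]) (use that in auto)
  have Im: "I t \<in> borel_measurable M" if "t \<le> T" for t
  proof -
    have "(\<lambda>\<omega>. indicator {\<omega> \<in> space M. \<tau> \<omega> = t} \<omega> :: real) \<in> borel_measurable M" using evs[OF that] by simp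
    then show ?thesis by (rule measurable_cong[THEN iffD1, rotated]) (auto simp: I_def indicator_def)
  qed
  have Ii: "integrable M (I t)" if "t \<le> T" for t
    by (rule integrable_const_bound[of _ 1]) (use Im[OF that] in \<open>auto simp: I_def indicator_def\<close>)
  have iv: "indep_var borel (I t) borel (\<lambda>\<omega>. f t (Z \<omega>))" if t: "t \<le> T" for t
    unfolding indep_var_eq
  proof (intro conjI)
    have fm: "(\<lambda>\<omega>. f t (Z \<omega>)) \<in> borel_measurable M" using measurable_compose[OF Z f[OF t]] .
    show "random_variable borel (I t)" "random_variable borel (\<lambda>\<omega>. f t (Z \<omega>))" using Im[OF t] fm by auto
    have sub1: "{I t -` A \<inter> space M |A. A \<in> sets borel} \<subseteq> {\<tau> -` A \<inter> space M | A. A \<in> sets (count_space {..T})}"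
    proof
      fix E assume "E \<in> {I t -` A \<inter> space M |A. A \<in> sets borel}"
      then obtain A where E: "E = I t -` A \<inter> space M" by auto
      have Es: "E = \<tau> -` {i \<in> {..T}. (indicator {t} i :: real) \<in> A} \<inter> space M"
        unfolding E I_def using measurable_space[OF \<tau>] by (auto simp: indicator_def split: if_splits)
      show "E \<in> {\<tau> -` A \<inter> space M | A. A \<in> sets (count_space {..T})}"
        unfolding mem_Collect_eq
      proof (intro exI conjI)
        show "E = \<tau> -` {i \<in> {..T}. (indicator {t} i :: real) \<in> A} \<inter> space M" by (rule Es)
        show "{i \<in> {..T}. (indicator {t} i :: real) \<in> A} \<in> sets (count_space {..T})" by auto
      qed
    qed
    have sub2: "{(\<lambda>\<omega>. f t (Z \<omega>)) -` A \<inter> space M |A. A \<in> sets borel} \<subseteq> {Z -` B \<inter> space M | B. B \<in> sets N}"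
    proof
      fix E assume "E \<in> {(\<lambda>\<omega>. f t (Z \<omega>)) -` A \<inter> space M |A. A \<in> sets borel}"
      then obtain A where A: "A \<in> sets borel" "E = (\<lambda>\<omega>. f t (Z \<omega>)) -` A \<inter> space M" by auto
      have Es: "E = Z -` (f t -` A \<inter> space N) \<inter> space M" unfolding A(2) using measurable_space[OF Z] by auto
      show "E \<in> {Z -` B \<inter> space M | B. B \<in> sets N}"
        unfolding mem_Collect_eq
      proof (intro exI conjI)
        show "E = Z -` (f t -` A \<inter> space N) \<inter> space M" by (rule Es)
        show "f t -` A \<inter> space N \<in> sets N" by (rule measurable_sets[OF f[OF t] A(1)])
      qed
    qed
    have "indep_set {I t -` A \<inter> space M |A. A \<in> sets borel} {(\<lambda>\<omega>. f t (Z \<omega>)) -` A \<inter> space M |A. A \<in> sets borel}"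
      unfolding indep_set_def
    proof (rule indep_sets_mono_sets[OF isd[unfolded indep_set_def]])
      fix i :: bool
      show "case_bool {I t -` A \<inter> space M |A. A \<in> sets borel} {(\<lambda>\<omega>. f t (Z \<omega>)) -` A \<inter> space M |A. A \<in> sets borel} i
        \<subseteq> case_bool {\<tau> -` A \<inter> space M | A. A \<in> sets (count_space {..T})} {Z -` B \<inter> space M | B. B \<in> sets N} i"
        using sub1 sub2 by (cases i) (simp_all only: bool.case)
    qed
    then show "indep_set (sigma_sets (space M) {I t -` A \<inter> space M |A. A \<in> sets borel})
      (sigma_sets (space M) {(\<lambda>\<omega>. f t (Z \<omega>)) -` A \<inter> space M |A. A \<in> sets borel})"
    proof (rule indep_set_sigma_sets)
      show "Int_stable {I t -` A \<inter> space M |A. A \<in> sets borel}"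
      proof (rule Int_stableI, elim CollectE exE conjE, intro CollectI)
        fix a b A B assume "a = I t -` A \<inter> space M" "A \<in> sets borel" "b = I t -` B \<inter> space M" "B \<in> sets borel"
        then show "\<exists>C. a \<inter> b = I t -` C \<inter> space M \<and> C \<in> sets borel" by (intro exI[of _ "A \<inter> B"]) auto
      qed
      show "Int_stable {(\<lambda>\<omega>. f t (Z \<omega>)) -` A \<inter> space M |A. A \<in> sets borel}"
      proof (rule Int_stableI, elim CollectE exE conjE, intro CollectI)
        fix a b A B assume "a = (\<lambda>\<omega>. f t (Z \<omega>)) -` A \<inter> space M" "A \<in> sets borel" "b = (\<lambda>\<omega>. f t (Z \<omega>)) -` B \<inter> space M" "B \<in> sets borel"
        then show "\<exists>C. a \<inter> b = (\<lambda>\<omega>. f t (Z \<omega>)) -` C \<inter> space M \<and> C \<in> sets borel" by (intro exI[of _ "A \<inter> B"]) auto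
      qed
    qed
  qed
  have sum: "f (\<tau> \<omega>) (Z \<omega>) = (\<Sum>t\<le>T. I t \<omega> * f t (Z \<omega>))" if "\<omega> \<in> space M" for \<omega>
  proof -
    have "\<tau> \<omega> \<in> {..T}" using measurable_space[OF \<tau> that] by simp
    moreover have "I t \<omega> * f t (Z \<omega>) = (if t = \<tau> \<omega> then f t (Z \<omega>) else 0)" for t unfolding I_def by auto
    ultimately show ?thesis by simp
  qed
  have ip: "integrable M (\<lambda>\<omega>. I t \<omega> * f t (Z \<omega>))" if "t \<le> T" for t
    by (rule indep_var_integrable[OF iv[OF that] Ii[OF that] int[OF that]])
  show "integrable M (\<lambda>\<omega>. f (\<tau> \<omega>) (Z \<omega>))"
    by (rule Bochner_Integration.integrable_cong[THEN iffD2, OF refl sum Bochner_Integration.integrable_sum]) (use ip in auto)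
  have "(LINT \<omega>|M. f (\<tau> \<omega>) (Z \<omega>)) = (LINT \<omega>|M. (\<Sum>t\<le>T. I t \<omega> * f t (Z \<omega>)))"
    by (rule Bochner_Integration.integral_cong[OF refl sum])
  also have "\<dots> = (\<Sum>t\<le>T. LINT \<omega>|M. I t \<omega> * f t (Z \<omega>))" using ip by (intro Bochner_Integration.integral_sum) auto
  also have "\<dots> = (\<Sum>t\<le>T. measure M {\<omega> \<in> space M. \<tau> \<omega> = t} * (LINT \<omega>|M. f t (Z \<omega>)))"
  proof (intro sum.cong refl)
    fix t assume "t \<in> {..T}"
    then have t: "t \<le> T" by simp
    have "(LINT \<omega>|M. I t \<omega>) = (LINT \<omega>|M. indicator {\<omega> \<in> space M. \<tau> \<omega> = t} \<omega>)"
      by (rule Bochner_Integration.integral_cong) (auto simp: I_def indicator_def)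
    also have "\<dots> = measure M {\<omega> \<in> space M. \<tau> \<omega> = t}" using evs[OF t] by simp
    finally show "(LINT \<omega>|M. I t \<omega> * f t (Z \<omega>)) = measure M {\<omega> \<in> space M. \<tau> \<omega> = t} * (LINT \<omega>|M. f t (Z \<omega>))"
      using indep_var_lebesgue_integral[OF iv[OF t] Ii[OF t] int[OF t]] by simp
  qed
  finally show "(LINT \<omega>|M. f (\<tau> \<omega>) (Z \<omega>)) = (\<Sum>t\<le>T. measure M {\<omega> \<in> space M. \<tau> \<omega> = t} * (LINT \<omega>|M. f t (Z \<omega>)))" .
qed

section \<open>The convergence rate\<close>

theorem corollary2p6:
  fixes r \<phi> :: "'a::euclidean_space \<Rightarrow> ereal"
    and g :: "'a \<Rightarrow> real"
    and P :: "'w measure"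
    and M :: "'m measure"
    and U :: "'a set"
    and G :: "'a \<Rightarrow> 'w \<Rightarrow> 'a"
    and \<rho> L \<gamma> \<alpha> :: real
    and T :: nat
    and x0 :: 'a
    and \<xi> :: "nat \<Rightarrow> 'm \<Rightarrow> 'w"
    and tstar :: "'m \<Rightarrow> nat"
  assumes r: "closed_convex_function r"
    and \<rho>: "\<rho> > 0"
    and g: "weakly_convex \<rho> g"
    and \<phi>: "\<phi> = (\<lambda>x. ereal (g x) + r x)"
    and min_exists: "\<exists>x. is_arg_min \<phi> (\<lambda>_. True) x"
    and P: "prob_space P"
    and U: "open U" "effective_domain r \<subseteq> U"
    and G_measurable: "(\<lambda>(x, w). G x w) \<in> borel_measurable (restrict_space borel U \<Otimes>\<^sub>M P)"
    and G_mean: "\<And>x. x \<in> U \<Longrightarrow>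
          integrable P (G x) \<and> (LINT w|P. G x w) \<in> subdifferential g x"
    and L: "L \<ge> 0"
    and G_second_moment: "\<And>x. x \<in> effective_domain r \<Longrightarrow>
          integrable P (\<lambda>w. (norm (G x w))\<^sup>2) \<and> (LINT w|P. (norm (G x w))\<^sup>2) \<le> L\<^sup>2"
    and g_lipschitz: "L-lipschitz_on UNIV g"
    and \<gamma>: "0 < \<gamma>" "\<gamma> \<le> 1 / (2 * \<rho>)"
    and T: "T > 0"
    and x0: "x0 \<in> effective_domain r"
    and \<alpha>: "\<alpha> = \<gamma> / sqrt (real T + 1)"
    and M: "prob_space M"
    and \<xi>_indep: "prob_space.indep_vars M (\<lambda>_. P) \<xi> {..T}"
    and \<xi>_law: "\<And>t. t \<le> T \<Longrightarrow> distr M P (\<xi> t) = P"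
    and tstar_indep: "indep_rvs M (count_space {..T}) tstar
          (PiM {..T} (\<lambda>_. P)) (\<lambda>\<omega>. \<lambda>t\<in>{..T}. \<xi> t \<omega>)"
    and tstar_law: "\<And>t. t \<le> T \<Longrightarrow>
          measure M {\<omega> \<in> space M. tstar \<omega> = t} = \<alpha> / (\<Sum>s\<le>T. \<alpha>)"
  defines "X \<equiv> (\<lambda>\<omega>. prox_sgm r G (\<lambda>_. \<alpha>) x0 (\<lambda>t. \<xi> t \<omega>) (tstar \<omega>))"
  shows "integrable M (\<lambda>\<omega>. (norm (gradient (moreau_envelope (1 / (2 * \<rho>)) \<phi>) (X \<omega>)))\<^sup>2) \<and>
    (LINT \<omega>|M. (norm (gradient (moreau_envelope (1 / (2 * \<rho>)) \<phi>) (X \<omega>)))\<^sup>2) \<le>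
      2 * (((moreau_envelope (1 / (2 * \<rho>)) \<phi> x0 - real_of_ereal (INF x. \<phi> x)) + 2 * \<rho> * L\<^sup>2 * \<gamma>\<^sup>2)
           / (\<gamma> * sqrt (real T + 1)))"
  proof -
  interpret P: prob_space P by (rule P)
  interpret S: sgm_process r g \<rho> L x0 P U G \<alpha> T
  proof unfold_locales
    show "\<exists>x. is_arg_min (\<lambda>x. ereal (g x) + r x) (\<lambda>_. True) x" using min_exists unfolding \<phi> .
    show "0 < \<alpha>" unfolding \<alpha> using \<gamma> by simp
  qed (rule r \<rho> g g_lipschitz x0 P U G_measurable G_mean G_second_moment; assumption?)+
  interpret M: prob_space M by (rule M)
  define N where "N = real T + 1"
  have N: "0 < N" "real (Suc T) = N" unfolding N_def by auto
  have \<alpha>2: "N * \<alpha>\<^sup>2 = \<gamma>\<^sup>2" unfolding \<alpha> N_def[symmetric] using N by (simp add: power_divide)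
  have "2 * \<rho> * \<gamma> \<le> 1" using \<gamma> \<rho> by (simp add: field_simps)
  then have "(2 * \<rho> * \<gamma>)\<^sup>2 \<le> 1\<^sup>2" using \<gamma> \<rho> by (intro power_mono) auto
  moreover have "real (Suc T) * (2 * \<rho> * \<alpha>)\<^sup>2 = (2 * \<rho> * \<gamma>)\<^sup>2"
    unfolding N(2) power_mult_distrib using \<alpha>2 by (simp add: algebra_simps)
  ultimately have small: "real (Suc T) * (2 * \<rho> * \<alpha>)\<^sup>2 \<le> 1" by simp
  have T1: "1 \<le> T" using T by simp
  define Z where "Z \<omega> = (\<lambda>t\<in>{..T}. \<xi> t \<omega>)" for \<omega>
  have \<xi>m: "\<xi> t \<in> measurable M P" if "t \<le> T" for t
    using \<xi>_indep that unfolding M.indep_vars_def by auto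
  have Zm: "Z \<in> measurable M S.PX" unfolding Z_def using \<xi>m by (intro measurable_restrict) auto
  have Zd: "distr M S.PX Z = S.PX"
  proof -
    have "distr M S.PX Z = PiM {..T} (\<lambda>t. distr M P (\<xi> t))"
      unfolding Z_def
      by (rule M.indep_vars_iff_distr_eq_PiM'[THEN iffD1, OF _ _ \<xi>_indep]) (use \<xi>m in auto)
    also have "\<dots> = S.PX" by (rule PiM_cong) (use \<xi>_law in auto)
    finally show ?thesis .
  qed
  define f where "f t \<omega> = S.grad_sq \<omega> t" for t \<omega>
  have fi: "integrable S.PX (f t)" if "t \<le> T" for t unfolding f_def using S.grad_sq_int[OF that] .
  have fm: "f t \<in> borel_measurable S.PX" if "t \<le> T" for t using fi[OF that] by auto
  have fZ: "integrable M (\<lambda>\<omega>. f t (Z \<omega>))" "(LINT \<omega>|M. f t (Z \<omega>)) = (LINT \<omega>|S.PX. f t \<omega>)" if "t \<le> T" for t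
  proof -
    show "integrable M (\<lambda>\<omega>. f t (Z \<omega>))" using integrable_distr[OF Zm, of "f t"] fi[OF that] unfolding Zd by simp
    show "(LINT \<omega>|M. f t (Z \<omega>)) = (LINT \<omega>|S.PX. f t \<omega>)" using integral_distr[OF Zm, of "f t"] fm[OF that] unfolding Zd by simp
  qed
  have ind: "indep_rvs M (count_space {..T}) tstar S.PX Z" unfolding Z_def using tstar_indep .
  have RI: "integrable M (\<lambda>\<omega>. f (tstar \<omega>) (Z \<omega>))"
    "(LINT \<omega>|M. f (tstar \<omega>) (Z \<omega>)) = (\<Sum>t\<le>T. measure M {\<omega> \<in> space M. tstar \<omega> = t} * (LINT \<omega>|M. f t (Z \<omega>)))"
    by (rule M.integral_random_index[where f = f and T = T and \<tau> = tstar and N = S.PX and Z = Z], rule ind, erule fm, erule fZ(1))+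
  have env: "moreau_envelope (1 / (2 * \<rho>)) \<phi> = S.env" unfolding S.env_def[abs_def] \<phi> ..
  have Xf: "(norm (gradient (moreau_envelope (1 / (2 * \<rho>)) \<phi>) (X \<omega>)))\<^sup>2 = f (tstar \<omega>) (Z \<omega>)" if "\<omega> \<in> space M" for \<omega>
  proof -
    have "tstar \<omega> \<le> T" using tstar_indep that unfolding indep_rvs_def by (auto dest: measurable_space)
    then have "X \<omega> = S.X (tstar \<omega>) (Z \<omega>)" unfolding X_def S.X_def Z_def by (intro prox_sgm_cong) auto
    then show ?thesis unfolding env f_def S.grad_sq_def by simp
  qed
  have "(\<Sum>s\<le>T. \<alpha>) = N * \<alpha>" unfolding N_def by simp
  then have law: "measure M {\<omega> \<in> space M. tstar \<omega> = t} = 1 / N" if "t \<le> T" for t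
    using tstar_law[OF that] S.\<alpha> by simp
  have int: "integrable M (\<lambda>\<omega>. (norm (gradient (moreau_envelope (1 / (2 * \<rho>)) \<phi>) (X \<omega>)))\<^sup>2)"
    by (rule Bochner_Integration.integrable_cong[THEN iffD2, OF refl Xf RI(1)])
  have "(LINT \<omega>|M. (norm (gradient (moreau_envelope (1 / (2 * \<rho>)) \<phi>) (X \<omega>)))\<^sup>2) = (LINT \<omega>|M. f (tstar \<omega>) (Z \<omega>))"
    by (rule Bochner_Integration.integral_cong[OF refl Xf])
  also have "\<dots> = (\<Sum>t\<le>T. 1 / N * (LINT \<omega>|S.PX. f t \<omega>))" unfolding RI(2) using law fZ(2) by (intro sum.cong) auto
  also have "\<dots> = (\<Sum>t\<le>T. LINT \<omega>|S.PX. f t \<omega>) / N" by (simp add: sum_divide_distrib)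
  finally have eq: "(LINT \<omega>|M. (norm (gradient (moreau_envelope (1 / (2 * \<rho>)) \<phi>) (X \<omega>)))\<^sup>2) = (\<Sum>t\<le>T. LINT \<omega>|S.PX. f t \<omega>) / N" .
  have "\<alpha> / 2 * (\<Sum>t\<le>T. LINT \<omega>|S.PX. f t \<omega>) \<le> (S.env x0 - S.m) + real (Suc T) * (2 * \<rho>) * \<alpha>\<^sup>2 * L\<^sup>2"
    unfolding f_def by (rule S.expected_gradient[OF T1 small])
  also have "real (Suc T) * (2 * \<rho>) * \<alpha>\<^sup>2 * L\<^sup>2 = 2 * \<rho> * L\<^sup>2 * (N * \<alpha>\<^sup>2)" unfolding N(2) by simp
  finally have b: "\<alpha> / 2 * (\<Sum>t\<le>T. LINT \<omega>|S.PX. f t \<omega>) \<le> (S.env x0 - S.m) + 2 * \<rho> * L\<^sup>2 * \<gamma>\<^sup>2" unfolding \<alpha>2 .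
  have den: "\<gamma> * sqrt (real T + 1) = \<alpha> * N"
  proof -
    have "sqrt N * sqrt N = N" using N by simp
    then show ?thesis unfolding \<alpha> N_def[symmetric] using N by (simp add: field_simps)
  qed
  have "(\<Sum>t\<le>T. LINT \<omega>|S.PX. f t \<omega>) / N = 2 * (\<alpha> / 2 * (\<Sum>t\<le>T. LINT \<omega>|S.PX. f t \<omega>)) / (\<alpha> * N)"
    using S.\<alpha> by simp
  also have "\<dots> \<le> 2 * ((S.env x0 - S.m) + 2 * \<rho> * L\<^sup>2 * \<gamma>\<^sup>2) / (\<alpha> * N)"
    using b S.\<alpha> N by (intro divide_right_mono mult_left_mono) auto
  finally have bound: "(\<Sum>t\<le>T. LINT \<omega>|S.PX. f t \<omega>) / N
      \<le> 2 * ((S.env x0 - S.m) + 2 * \<rho> * L\<^sup>2 * \<gamma>\<^sup>2) / (\<alpha> * N)" .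
  have m: "S.m = real_of_ereal (INF x. \<phi> x)" unfolding S.m_def \<phi> by simp
  show ?thesis unfolding eq using int bound[unfolded m env[symmetric] den[symmetric]] by simp
qed

end
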